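(* Let $1<p<2$ and $u\in\ell^1(\mathbb{Z})$. If $\widehat{u}\in\mathrm{Lip}_\delta(\mathbb{T})$ for some $\delta>\frac1p-\frac12$, $\dim(\mathcal{Z}(\widehat{u}))<2(p-1)/p$ and $\log d(\cdot,\mathcal{Z}(\widehat{u}))\notin L^1(\mathbb{T})$, then $u$ is cyclic in $\ell^p(\mathbb{Z})$.
   Context: $\mathbb{T}$ is the unit circle of $\mathbb{C}$ with Lebesgue measure. For $u=(u_n)_{n\in\mathbb{Z}}\in\ell^1(\mathbb{Z})$, $\widehat{u}(\zeta)=\sum_{n\in\mathbb{Z}}u_n\zeta^n$ for $\zeta\in\mathbb{T}$, and $\mathcal{Z}(\widehat{u})=\{\zeta\in\mathbb{T}:\widehat{u}(\zeta)=0\}$. $\mathrm{Lip}_\delta(\mathbb{T})$ is the set of functions $f:\mathbb{T}\to\mathbb{C}$ for which there is $C>0$ with $|f(\zeta)-f(\zeta')|\le C|\zeta-\zeta'|^\delta$ for all $\zeta,\zeta'\in\mathbb{T}$. $d(\cdot,\mathcal{Z}(\widehat{u}))$ is the Euclidean distance to $\mathcal{Z}(\widehat{u})$ and $\dim$ is Hausdorff dimension. A vector $u\in\ell^p(\mathbb{Z})$ is cyclic in $\ell^p(\mathbb{Z})$ if the linear span of $\{(u_{n-k})_{n\in\mathbb{Z}}: k=0,1,2,\dots\}$ is dense in $\ell^p(\mathbb{Z})$. *)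

theory Defs
  imports "HOL-Analysis.Analysis" "HOL-Library.Function_Algebras"
begin

section \<open>The spaces of p-summable two-sided sequences\<close>

definition ell :: "real \<Rightarrow> (int \<Rightarrow> complex) set" where
  "ell p = {u. (\<lambda>n. norm (u n) powr p) summable_on UNIV}"

definition ell_norm :: "real \<Rightarrow> (int \<Rightarrow> complex) \<Rightarrow> real" where
  "ell_norm p u = (\<Sum>\<^sub>\<infinity>n\<in>UNIV. norm (u n) powr p) powr (1 / p)"

definition seq_scale :: "complex \<Rightarrow> (int \<Rightarrow> complex) \<Rightarrow> int \<Rightarrow> complex" where
  "seq_scale c u = (\<lambda>n. c * u n)"

global_interpretation seq: vector_space seq_scale
  defines seq_span = seq.span
  by unfold_locales (auto simp: seq_scale_def fun_eq_iff algebra_simps)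

definition shift :: "nat \<Rightarrow> (int \<Rightarrow> complex) \<Rightarrow> int \<Rightarrow> complex" where
  "shift k u = (\<lambda>n. u (n - int k))"

text \<open>Only the nonnegative powers of the bilateral shift are used. The condition
  \<open>u \<in> ell p\<close> puts the span inside \<open>ell p\<close>, so \<open>ell_norm\<close> below is never
  evaluated at a sequence that is not p-summable (where its value would be 0).\<close>

definition ell_cyclic :: "real \<Rightarrow> (int \<Rightarrow> complex) \<Rightarrow> bool" where
  "ell_cyclic p u \<longleftrightarrow> u \<in> ell p \<and>
     (\<forall>v\<in>ell p. \<forall>\<epsilon>>0. \<exists>w\<in>seq_span (range (\<lambda>k. shift k u)). ell_norm p (v - w) < \<epsilon>)"


section \<open>Functions on the unit circle\<close>

abbreviation circle :: "complex set" where
  "circle \<equiv> sphere 0 1"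

definition fourier :: "(int \<Rightarrow> complex) \<Rightarrow> complex \<Rightarrow> complex" where
  "fourier u \<zeta> = (\<Sum>\<^sub>\<infinity>n\<in>UNIV. u n * \<zeta> powi n)"

definition zeros :: "(complex \<Rightarrow> complex) \<Rightarrow> complex set" where
  "zeros f = {\<zeta> \<in> circle. f \<zeta> = 0}"

definition Lip :: "real \<Rightarrow> (complex \<Rightarrow> complex) set" where
  "Lip \<delta> = {f. \<exists>C>0. \<forall>\<zeta>\<in>circle. \<forall>\<zeta>'\<in>circle. norm (f \<zeta> - f \<zeta>') \<le> C * norm (\<zeta> - \<zeta>') powr \<delta>}"

definition circle_measure :: "complex measure" where
  "circle_measure =
     distr (restrict_space lborel {0..<2 * pi}) (restrict_space borel circle) cis"

definition circle_L1 :: "(complex \<Rightarrow> ereal) set" where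
  "circle_L1 = {f. f \<in> borel_measurable circle_measure \<and>
     (\<integral>\<^sup>+ \<zeta>. e2ennreal \<bar>f \<zeta>\<bar> \<partial>circle_measure) < \<infinity>}"

text \<open>Distances between points of the circle lie in the interval from 0 to 2, and the
  infimum of the empty set is taken there, so the distance to the empty set is 2. Any
  positive finite value would do: what matters is that the logarithm of the distance to the
  empty set is integrable. (The unit vector at index 0 has a symbol without zeros and is not
  cyclic, so the value 0 of \<open>infdist\<close>, or the value \<open>\<infinity>\<close>, would be
  inappropriate here.)\<close>

definition circle_dist :: "complex \<Rightarrow> complex set \<Rightarrow> real" where
  "circle_dist \<zeta> Z = (if Z = {} then 2 else infdist \<zeta> Z)"

definition log_dist :: "complex set \<Rightarrow> complex \<Rightarrow> ereal" where
  "log_dist Z \<zeta> = (if circle_dist \<zeta> Z = 0 then -\<infinity> else ereal (ln (circle_dist \<zeta> Z)))"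


section \<open>Hausdorff dimension\<close>

text \<open>Boundedness is required because \<open>diameter\<close> is unspecified on unbounded sets.\<close>

definition hausdorff_premeasure :: "real \<Rightarrow> real \<Rightarrow> 'a::metric_space set \<Rightarrow> ennreal" where
  "hausdorff_premeasure s \<delta> E =
     (INF U\<in>{U :: nat \<Rightarrow> 'a set. E \<subseteq> (\<Union>i. U i) \<and>
                (\<forall>i. bounded (U i) \<and> diameter (U i) \<le> \<delta>)}.
        \<Sum>i. ennreal (diameter (U i) powr s))"

definition hausdorff_measure :: "real \<Rightarrow> 'a::metric_space set \<Rightarrow> ennreal" where
  "hausdorff_measure s E = (SUP \<delta>\<in>{0<..}. hausdorff_premeasure s \<delta> E)"

text \<open>The exponent 0 is left out since \<open>0 powr 0 = 0\<close>; this does not change the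
  infimum.\<close>

definition hausdorff_dim :: "'a::metric_space set \<Rightarrow> ennreal" where
  "hausdorff_dim E = (INF s\<in>{s. 0 < s \<and> hausdorff_measure s E = 0}. ennreal s)"

end

theory Submission
  imports Defs "HOL-Complex_Analysis.Complex_Analysis"
begin

text \<open>
  Let \<open>f\<close> be the symbol of \<open>u\<close>, \<open>Z\<close> its zero set, \<open>d\<close> the distance to \<open>Z\<close> and
  \<open>s > 1/p - 1/2\<close>. By Bessel's inequality on dyadic blocks, a function whose \<open>L\<^sup>2\<close> norm
  and \<open>L\<^sup>2\<close> modulus of continuity (relative to \<open>t\<^sup>s\<close>) are small has Fourier
  coefficients of small \<open>p\<close>-norm; so all estimates are about moduli of continuity.

  Since \<open>log d\<close> is not integrable, there is a finite sum of Herglotz kernels with poles just outside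
  the disc, near \<open>Z\<close>, whose real part is at most \<open>\<epsilon> log (1/d)\<close> up to a constant on the
  circle while its value \<open>M\<close> at 0 is as large as we please. If \<open>k\<close> is this sum, then
  \<open>exp (k - M)\<close> is 1 at 0, and \<open>f exp (k - M)\<close> has an \<open>L\<^sup>2\<close> modulus of continuity
  of order \<open>(1 + M) exp (- 2 M) t\<^bsup>2s\<^esup>\<close>. Hence the backward shift of \<open>u\<close> lies in the closed span
  of the forward shifts, and that span is invariant under both shifts.

  The dimension hypothesis gives coverings of \<open>Z\<close> by arcs with \<open>\<Sum> \<rho>\<^sub>i\<^bsup>1 - 2s\<^esup>\<close> small. The maximum
  \<open>\<chi>\<close> of the corresponding tent functions has small coefficients, because the squared moduli of
  continuity of a maximum are at most the sum of those of the members. The quotient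
  \<open>b = (1 - \<chi>) / f\<close> is Hoelder continuous; with a trigonometric approximation \<open>T\<close> of \<open>b\<close>,
  \<open>1 - f T = \<chi> + f (b - T)\<close> has small coefficients, so the unit vector at 0 is in the closed
  span.\<close>

section \<open>Fourier coefficients of continuous periodic functions\<close>

text \<open>One exponent governs everything. On a dyadic block of about N = 2^j indices, comparing
  the p-sum with the square sum costs N^(1 - p/2), while the modulus gains N^(- s p); the balance is
  s = 1/p - 1/2. The dimension bound 2(p - 1)/p equals 1 - 2(1/p - 1/2), which is the same threshold
  seen through the covering exponent 1 - 2s. The obstacle is that only forward shifts are available,
  while an approximate inverse of \<open>f\<close> needs frequencies of both signs; so analytic
  multipliers must do their work before real cutoffs can be used. A multiplier with value 1 at 0 can
  be small on most of the circle only if it is large near \<open>Z\<close>; here it grows at most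
  like d^(-\<epsilon>), which is paid for by the gap between \<delta> and s. The gain exp (- 2M)
  beats the factor 1 + M, and that factor is linear in M only because a mean value bound is
  multiplied by a trivial bound instead of being squared. Finite sums of Herglotz kernels stand in
  for the logarithm of an outer function of modulus d^(-\<epsilon>): with poles off the closed disc,
  everything is holomorphic across the circle and no boundary values have to be discussed.\<close>

definition cper :: "(real \<Rightarrow> 'a::real_normed_vector) \<Rightarrow> bool" where
  "cper F \<longleftrightarrow> continuous_on UNIV F \<and> (\<forall>x. F (x + 2 * pi) = F x)"

abbreviation pint :: "(real \<Rightarrow> 'a::real_normed_vector) \<Rightarrow> 'a" where
  "pint F \<equiv> integral {0..2 * pi} F"

text \<open>Unqualified, these names refer to the Lebesgue integral.\<close>

lemmas hk_integral_add = Henstock_Kurzweil_Integration.integral_add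
lemmas hk_integral_diff = Henstock_Kurzweil_Integration.integral_diff
lemmas hk_integral_sum = Henstock_Kurzweil_Integration.integral_sum
lemmas hk_integral_nonneg = Henstock_Kurzweil_Integration.integral_nonneg
lemmas hk_integral_combine = Henstock_Kurzweil_Integration.integral_combine
lemmas hk_integral_reflect_real = Henstock_Kurzweil_Integration.integral_reflect_real

lemma cperI: "continuous_on UNIV F \<Longrightarrow> (\<And>x. F (x + 2 * pi) = F x) \<Longrightarrow> cper F"
  by (auto simp: cper_def)

lemma cper_cont: "cper F \<Longrightarrow> continuous_on S F"
  by (auto simp: cper_def intro: continuous_on_subset)

lemma cper_integrable:
  fixes F :: "real \<Rightarrow> 'a::banach"
  shows "cper F \<Longrightarrow> F integrable_on {a..b}"
  by (auto intro: integrable_continuous_interval cper_cont)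

lemma cper_compose_cis:
  assumes "continuous_on circle g"
  shows "cper (\<lambda>x. g (cis x))"
proof (rule cperI)
  have c: "continuous_on UNIV cis" by (intro continuous_intros)
  show "continuous_on UNIV (\<lambda>x. g (cis x))"
    by (rule continuous_on_compose2[OF assms c]) auto
qed (simp add: cis.ctr)

lemma cper_cis [simp]: "cper (\<lambda>x. cis (of_int n * x))"
proof (rule cperI)
  fix x
  have "cis (of_int n * (x + 2 * pi)) = cis (of_int n * x) * cis (2 * pi * of_int n)"
    by (simp add: cis_mult algebra_simps)
  then show "cis (of_int n * (x + 2 * pi)) = cis (of_int n * x)" by simp
qed (intro continuous_intros)

lemma cper_const [simp]: "cper (\<lambda>x. c)"
  by (auto simp: cper_def)

lemma cper_add [simp]: "cper F \<Longrightarrow> cper G \<Longrightarrow> cper (\<lambda>x. F x + G x)"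
  and cper_diff [simp]: "cper F \<Longrightarrow> cper G \<Longrightarrow> cper (\<lambda>x. F x - G x)"
  by (auto simp: cper_def intro!: continuous_intros)

lemma cper_mult [simp]:
  fixes F :: "real \<Rightarrow> 'a::real_normed_algebra"
  shows "cper F \<Longrightarrow> cper G \<Longrightarrow> cper (\<lambda>x. F x * G x)"
  by (auto simp: cper_def intro!: continuous_intros)

lemma cper_norm [simp]: "cper F \<Longrightarrow> cper (\<lambda>x. norm (F x))"
  and cper_cnj [simp]: "cper H \<Longrightarrow> cper (\<lambda>x. cnj (H x))"
  and cper_Re [simp]: "cper H \<Longrightarrow> cper (\<lambda>x. Re (H x))"
  by (auto simp: cper_def intro!: continuous_intros)

lemma cper_power [simp]:
  fixes F :: "real \<Rightarrow> 'a::real_normed_algebra_1"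
  shows "cper F \<Longrightarrow> cper (\<lambda>x. F x ^ n)"
  by (auto simp: cper_def intro!: continuous_intros)

lemma cper_sum [simp]: "(\<And>i. i \<in> I \<Longrightarrow> cper (F i)) \<Longrightarrow> cper (\<lambda>x. \<Sum>i\<in>I. F i x)"
  by (auto simp: cper_def intro!: continuous_intros)

lemma cper_shift [simp]: "cper F \<Longrightarrow> cper (\<lambda>x. F (x + t))"
proof (rule cperI)
  assume F: "cper F"
  show "continuous_on UNIV (\<lambda>x. F (x + t))"
    by (rule continuous_on_compose2[OF cper_cont[OF F, of UNIV]]) (auto intro: continuous_intros)
  show "F (x + 2 * pi + t) = F (x + t)" for x
    using F[unfolded cper_def] by (metis add.assoc add.commute)
qed

text \<open>Removing a multiple of the period from \<open>t\<close> leaves a shift by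
  \<open>r\<close> within one period; the piece that then sticks out on the right is moved back by
  periodicity.\<close>

lemma integral_shift_period:
  fixes F :: "real \<Rightarrow> 'a::banach"
  assumes F: "cper F"
  shows "pint (\<lambda>x. F (x + t)) = pint F"
proof -
  have per: "F (x + 2 * pi) = F x" for x using F by (simp add: cper_def)
  have peri: "F (x + 2 * pi * of_int k) = F x" for x k
  proof (induction k rule: int_induct[where k = 0])
    case base then show ?case by simp
  next
    case (step1 i)
    then show ?case using per[of "x + 2 * pi * of_int i"] by (simp add: algebra_simps)
  next
    case (step2 i)
    then show ?case using per[of "x + 2 * pi * of_int (i - 1)"] by (simp add: algebra_simps)
  qed
  define k where "k = \<lfloor>t / (2 * pi)\<rfloor>"
  define r where "r = t - 2 * pi * of_int k"
  have r: "0 \<le> r" "r \<le> 2 * pi"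
  proof -
    have "of_int k \<le> t / (2 * pi)" "t / (2 * pi) < of_int k + 1" unfolding k_def by linarith+
    then show "0 \<le> r" "r \<le> 2 * pi" unfolding r_def by (auto simp: field_simps)
  qed
  have "F (x + t) = F (x + r)" for x
    using peri[of "x + r" k] by (simp add: r_def algebra_simps)
  then have "pint (\<lambda>x. F (x + t)) = pint (\<lambda>x. F (x + r))" by simp
  also have "\<dots> = integral {r..2 * pi + r} F"
    using integral_shift_Icc_real[of 0 "2 * pi" F r] by (simp add: o_def add.commute)
  also have "\<dots> = integral {r..2 * pi} F + integral {2 * pi..2 * pi + r} F"
    by (rule hk_integral_combine[symmetric]) (use r F in \<open>auto intro: cper_integrable\<close>)
  also have "integral {2 * pi..2 * pi + r} F = integral {0..r} F"
    using integral_shift_Icc_real[of 0 r F "2 * pi"] per by (simp add: o_def add.commute)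
  also have "integral {r..2 * pi} F + integral {0..r} F = pint F"
    using hk_integral_combine[of 0 r "2 * pi" F] r F
    by (auto intro: cper_integrable simp: add.commute)
  finally show ?thesis .
qed

lemma integral_cis: "pint (\<lambda>x. cis (of_int n * x)) = (if n = 0 then of_real (2 * pi) else 0)"
proof (cases "n = 0")
  case True
  then show ?thesis by (simp add: scaleR_conv_of_real)
next
  case False
  have "((\<lambda>x. cis (of_int n * x)) has_integral
      (cis (of_int n * (2 * pi)) / (\<i> * of_int n) - cis (of_int n * 0) / (\<i> * of_int n))) {0..2 * pi}"
  proof (rule fundamental_theorem_of_calculus)
    fix x
    have "((\<lambda>x. exp (\<i> * of_int n * x) / (\<i> * of_int n)) has_field_derivative exp (\<i> * of_int n * of_real x)) (at (of_real x))"
      using False by (auto intro!: derivative_eq_intros)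
    then have "((\<lambda>x. exp (\<i> * of_int n * of_real x) / (\<i> * of_int n)) has_vector_derivative exp (\<i> * of_int n * of_real x)) (at x)"
      by (rule has_vector_derivative_real_field)
    then show "((\<lambda>x. cis (of_int n * x) / (\<i> * of_int n)) has_vector_derivative cis (of_int n * x)) (at x within {0..2 * pi})"
      by (simp add: cis_conv_exp mult.assoc has_vector_derivative_at_within)
  qed simp
  moreover have "cis (of_int n * (2 * pi)) = 1"
    using cis_multiple_2pi[of "of_int n"] by (simp add: mult.commute)
  ultimately show ?thesis using False by (auto dest: integral_unique)
qed

definition coef :: "(real \<Rightarrow> complex) \<Rightarrow> int \<Rightarrow> complex" where
  "coef F n = pint (\<lambda>x. F x * cis (of_int (- n) * x)) / (2 * pi)"

lemma coef_add: "cper F \<Longrightarrow> cper G \<Longrightarrow> coef (\<lambda>x. F x + G x) n = coef F n + coef G n"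
  unfolding coef_def distrib_right
  by (subst hk_integral_add)
     (auto intro!: cper_integrable cper_mult cper_cis simp: add_divide_distrib simp del: of_int_minus)

lemma coef_diff: "cper F \<Longrightarrow> cper G \<Longrightarrow> coef (\<lambda>x. F x - G x) n = coef F n - coef G n"
  unfolding coef_def left_diff_distrib
  by (subst hk_integral_diff)
     (auto intro!: cper_integrable cper_mult cper_cis simp: diff_divide_distrib simp del: of_int_minus)

lemma coef_scale: "coef (\<lambda>x. c * F x) n = c * coef F n"
  unfolding coef_def by (simp add: mult.assoc)

lemma coef_sum:
  "finite I \<Longrightarrow> (\<And>i. i \<in> I \<Longrightarrow> cper (F i)) \<Longrightarrow> coef (\<lambda>x. \<Sum>i\<in>I. F i x) n = (\<Sum>i\<in>I. coef (F i) n)"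
  by (induction I rule: finite_induct) (auto simp: coef_add, simp add: coef_def)

lemma coef_cis_mult: "coef (\<lambda>x. cis (of_int k * x) * F x) n = coef F (n - k)"
proof -
  have eq: "cis (of_int k * x) * F x * cis (of_int (- n) * x) = F x * cis (of_int (- (n - k)) * x)" for x
    by (simp add: cis_mult algebra_simps flip: mult.assoc)
  show ?thesis unfolding coef_def eq ..
qed

lemma coef_cis: "coef (\<lambda>x. cis (of_int k * x)) n = (if n = k then 1 else 0)"
proof -
  have "cis (of_int k * x) * cis (of_int (- n) * x) = cis (of_int (k - n) * x)" for x
    by (simp add: cis_mult algebra_simps)
  then show ?thesis unfolding coef_def integral_cis by (auto simp: integral_cis simp del: of_int_diff)
qed

lemma coef_shift:
  assumes "cper F"
  shows "coef (\<lambda>x. F (x + t)) n = cis (of_int n * t) * coef F n"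
proof -
  define G where "G = (\<lambda>x. F x * cis (of_int (- n) * x))"
  have G: "cper G" unfolding G_def by (intro cper_mult assms cper_cis)
  have "F (x + t) * cis (of_int (- n) * x) = cis (of_int n * t) * G (x + t)" for x
    by (simp add: G_def cis_mult algebra_simps flip: mult.assoc)
  then have "coef (\<lambda>x. F (x + t)) n = cis (of_int n * t) * pint (\<lambda>x. G (x + t)) / (2 * pi)"
    unfolding coef_def by simp
  also have "\<dots> = cis (of_int n * t) * pint G / (2 * pi)"
    using integral_shift_period[OF G] by simp
  finally show ?thesis by (simp add: coef_def G_def)
qed

lemma norm_coef_le:
  assumes "cper F" "\<And>x. norm (F x) \<le> B"
  shows "norm (coef F n) \<le> B"
proof -
  have "norm (pint (\<lambda>x. F x * cis (of_int (- n) * x))) \<le> B * (2 * pi - 0)"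
    by (rule integral_bound) (use assms in \<open>auto simp: norm_mult intro!: cper_cont cper_mult cper_cis simp del: of_int_minus\<close>)
  then show ?thesis by (simp add: coef_def norm_divide field_simps)
qed

lemma bessel_inequality:
  assumes F: "cper F" and A: "finite A"
  shows "(\<Sum>n\<in>A. (norm (coef F n))\<^sup>2) \<le> pint (\<lambda>x. (norm (F x))\<^sup>2) / (2 * pi)"
proof -
  define P where "P x = (\<Sum>n\<in>A. coef F n * cis (of_int n * x))" for x
  define S where "S = (\<Sum>n\<in>A. (norm (coef F n))\<^sup>2)"
  have P: "cper P" unfolding P_def using A by (intro cper_sum cper_mult cper_cis cper_const)
  have cP: "coef P n = coef F n" if "n \<in> A" for n
  proof -
    have "coef P n = (\<Sum>m\<in>A. coef F m * (if n = m then 1 else 0))"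
      unfolding P_def using A by (subst coef_sum) (auto simp: coef_scale coef_cis)
    then show ?thesis using that A by (simp add: if_distrib cong: if_cong)
  qed
  \<comment> \<open>Stated for a general \<open>G\<close> because it serves twice, for
    \<open>F\<close> and for \<open>P\<close>: both have the coefficients of \<open>F\<close> on
    \<open>A\<close>. So the cross term and the square of \<open>P\<close> agree when |F - P|^2 is
    expanded.\<close>
  have key: "pint (\<lambda>x. G x * cnj (P x)) = of_real (2 * pi * S)"
    if G: "cper G" and cG: "\<And>n. n \<in> A \<Longrightarrow> coef G n = coef F n" for G
  proof -
    have "G x * cnj (P x) = (\<Sum>n\<in>A. cnj (coef F n) * (G x * cis (of_int (- n) * x)))" for x
      by (simp add: P_def cis_cnj sum_distrib_left algebra_simps)
    then have "pint (\<lambda>x. G x * cnj (P x)) =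
        (\<Sum>n\<in>A. pint (\<lambda>x. cnj (coef F n) * (G x * cis (of_int (- n) * x))))"
      using A G
      by (simp add: hk_integral_sum cper_integrable cper_mult cper_cis del: of_int_minus)
    also have "\<dots> = (\<Sum>n\<in>A. cnj (coef F n) * (2 * pi * coef G n))"
      by (simp add: coef_def)
    also have "\<dots> = (\<Sum>n\<in>A. 2 * pi * (coef F n * cnj (coef F n)))"
      by (intro sum.cong) (auto simp: cG)
    also have "\<dots> = of_real (2 * pi * S)"
      unfolding S_def by (simp add: complex_norm_square[symmetric] sum_distrib_left del: of_real_power flip: of_real_power)
    finally show ?thesis .
  qed
  have 1: "pint (\<lambda>x. Re (F x * cnj (P x))) = 2 * pi * S"
    using key[OF F] integral_linear[OF cper_integrable[of "\<lambda>x. F x * cnj (P x)" 0 "2*pi"] bounded_linear_Re] F P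
    by (simp add: o_def)
  have 2: "pint (\<lambda>x. Re (P x * cnj (P x))) = 2 * pi * S"
    using key[OF P cP] integral_linear[OF cper_integrable[of "\<lambda>x. P x * cnj (P x)" 0 "2*pi"] bounded_linear_Re] P
    by (simp add: o_def)
  have "0 \<le> pint (\<lambda>x. (norm (F x - P x))\<^sup>2)"
    by (rule hk_integral_nonneg) (use F P in \<open>auto intro: cper_integrable\<close>)
  also have "(\<lambda>x. (norm (F x - P x))\<^sup>2) = (\<lambda>x. (norm (F x))\<^sup>2 - 2 * Re (F x * cnj (P x)) + Re (P x * cnj (P x)))"
    by (rule ext, simp only: cmod_power2) (simp add: power2_eq_square algebra_simps)
  also have "pint \<dots> = pint (\<lambda>x. (norm (F x))\<^sup>2) - 2 * (2 * pi * S) + 2 * pi * S"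
    using F P
    by (simp add: hk_integral_add hk_integral_diff
        cper_integrable cper_mult 1 2 del: complex_mult_cnj times_complex.sel)
  finally show ?thesis by (simp add: S_def field_simps)
qed

section \<open>Smallness of the p-norm of the Fourier coefficients\<close>

text \<open>The bound \<open>e\<close> is on the p-th power of the norm. Finite sums express
  convergence and the bound together, so the default value 0 of a divergent \<open>infsum\<close>
  cannot interfere.\<close>

definition p_small :: "real \<Rightarrow> real \<Rightarrow> (int \<Rightarrow> complex) \<Rightarrow> bool" where
  "p_small p e v \<longleftrightarrow> (\<forall>A. finite A \<longrightarrow> (\<Sum>n\<in>A. norm (v n) powr p) \<le> e)"

lemma p_small_mono: "p_small p e v \<Longrightarrow> e \<le> e' \<Longrightarrow> p_small p e' v"
  unfolding p_small_def by force

text \<open>A ball of the Besov space with indices s, 2 and infinity; \<open>B\<close> bounds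
  squares. On the coefficient side the steps \<open>t = 1 / 2 ^ j\<close> are used.\<close>

definition L2_modulus :: "real \<Rightarrow> real \<Rightarrow> (real \<Rightarrow> complex) \<Rightarrow> bool" where
  "L2_modulus s B F \<longleftrightarrow> cper F \<and> pint (\<lambda>x. (norm (F x))\<^sup>2) \<le> B \<and>
     (\<forall>t. 0 < t \<longrightarrow> t \<le> 1 \<longrightarrow> pint (\<lambda>x. (norm (F (x + t) - F x))\<^sup>2) \<le> B * t powr (2 * s))"

lemma L2_modulusI:
  assumes "cper F" "pint (\<lambda>x. (norm (F x))\<^sup>2) \<le> B"
    and "\<And>t. 0 < t \<Longrightarrow> t \<le> 1 \<Longrightarrow> pint (\<lambda>x. (norm (F (x + t) - F x))\<^sup>2) \<le> B * t powr (2 * s)"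
  shows "L2_modulus s B F"
  using assms by (simp add: L2_modulus_def)

lemma critical_exponent_pos:
  fixes p :: real
  shows "1 < p \<Longrightarrow> p < 2 \<Longrightarrow> 0 < 1 / p - 1 / 2"
  by (simp add: field_simps)

text \<open>A threshold \<open>l\<close> separates small from large values. Summed over a block with
  a good \<open>l\<close>, this takes the place of Hoelder's inequality; it also reduces a Hoelder
  estimate to a second moment in \<open>Lip_trigonometric_approx\<close>.\<close>

lemma powr_le_square_interp:
  fixes x l p :: real
  assumes "0 \<le> x" "0 < l" "0 < p" "p \<le> 2"
  shows "x powr p \<le> x\<^sup>2 * l powr (p - 2) + l powr p"
proof (cases "x \<le> l")
  case True
  then have "x powr p \<le> l powr p" using assms by (intro powr_mono2) auto
  then show ?thesis by (simp add: add_increasing)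
next
  case False
  then have x: "x > 0" using assms by auto
  have "x powr p = x\<^sup>2 * x powr (p - 2)"
    using x by (simp add: powr_diff)
  also have "x powr (p - 2) \<le> l powr (p - 2)"
    using False assms by (intro powr_mono2') auto
  finally show ?thesis using assms by (simp add: mult_left_mono add_increasing2)
qed

lemma norm_cis_minus_one: "norm (cis x - 1) = 2 * \<bar>sin (x / 2)\<bar>"
proof -
  have "(norm (cis x - 1))\<^sup>2 = (cos x - 1)\<^sup>2 + (sin x)\<^sup>2"
    by (simp add: cmod_power2)
  also have "\<dots> = 2 - 2 * cos x"
    using sin_cos_squared_add[of x] by (simp add: power2_eq_square algebra_simps)
  also have "\<dots> = (2 * \<bar>sin (x / 2)\<bar>)\<^sup>2"
    using cos_double_sin[of "x / 2"] by (simp add: power_mult_distrib)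
  finally show ?thesis by (rule power2_eq_imp_eq) auto
qed

lemma norm_cis_diff: "norm (cis x - cis y) = norm (cis (x - y) - 1)"
proof -
  have "cis x - cis y = cis y * (cis (x - y) - 1)" by (simp add: algebra_simps cis_mult)
  then show ?thesis by (simp add: norm_mult)
qed

lemma norm_cis_diff_le: "norm (cis x - cis y) \<le> \<bar>x - y\<bar>"
  unfolding norm_cis_diff norm_cis_minus_one using abs_sin_x_le_abs_x[of "(x - y) / 2"] by simp

text \<open>On [0, 1] the cubic Taylor remainder gives the slope 5/6; beyond 1 the sine has not yet
  decreased, and 5/6 exceeds half of 1.6, an upper bound for pi/2.\<close>

lemma sin_ge_linear:
  fixes x :: real
  assumes "0 \<le> x" "x \<le> pi / 2"
  shows "x / 2 \<le> sin x"
proof -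
  have small: "y * (5 / 6) \<le> sin y" if "0 \<le> y" "y \<le> 1" for y :: real
  proof -
    have "\<bar>sin y - (\<Sum>m<3. sin_coeff m * y ^ m)\<bar> \<le> inverse (fact 3) * \<bar>y\<bar> ^ 3"
      by (rule Maclaurin_sin_bound)
    moreover have "(\<Sum>m<3. sin_coeff m * y ^ m) = y"
      by (simp add: numeral_3_eq_3 sin_coeff_def)
    moreover have "\<bar>y\<bar> ^ 3 \<le> y"
      using that power_decreasing[of 1 3 y] by simp
    ultimately have "\<bar>sin y - y\<bar> \<le> y / 6"
      by (simp add: fact_numeral)
    then show ?thesis by linarith
  qed
  show ?thesis
  proof (cases "x \<le> 1")
    case True
    then show ?thesis using small[of x] assms(1) by linarith
  next
    case False
    then have "sin 1 \<le> sin x" using assms by (intro sin_monotone_2pi_le) auto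
    moreover have "x \<le> 1.6" using assms pi_approx by simp
    ultimately show ?thesis using small[of 1] by simp
  qed
qed

text \<open>For these \<open>n\<close> the half angle of \<open>n / 2 ^ j\<close> lies between 1/2
  and 1 in absolute value, where the sine is at least 1/4.\<close>

lemma cis_gap:
  fixes n :: int
  assumes "2 ^ j \<le> \<bar>n\<bar>" "\<bar>n\<bar> < 2 ^ (j + 1)"
  shows "norm (cis (of_int n * (1 / 2 ^ j)) - 1) \<ge> 1 / 2"
proof -
  have "real_of_int (2 ^ j) \<le> of_int \<bar>n\<bar>" "real_of_int \<bar>n\<bar> < of_int (2 ^ (j + 1))"
    using assms by (simp_all only: of_int_le_iff of_int_less_iff)
  then have half: "1 / 2 \<le> \<bar>of_int n / 2 ^ j / (2::real)\<bar>" "\<bar>of_int n / 2 ^ j / 2\<bar> \<le> (1::real)"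
    by (auto simp: field_simps abs_mult)
  then have "sin \<bar>of_int n / 2 ^ j / 2\<bar> \<ge> (1 / 4 :: real)"
  proof -
    have "1 / 4 \<le> sin y" if "1 / 2 \<le> y" "y \<le> 1" for y :: real
    proof -
      have "y / 2 \<le> sin y" by (rule sin_ge_linear) (use that pi_gt3 in linarith)+
      then show ?thesis using that(1) by linarith
    qed
    from this[OF half] show ?thesis .
  qed
  moreover have "\<bar>sin (of_int n / 2 ^ j / 2)\<bar> \<ge> sin \<bar>of_int n / 2 ^ j / (2::real)\<bar>"
    by (cases "of_int n / 2 ^ j / (2::real) \<ge> 0") (simp_all add: abs_if)
  ultimately show ?thesis unfolding norm_cis_minus_one by simp
qed

text \<open>Taking the difference with a translate multiplies the n-th coefficient by
  \<open>cis (n t) - 1\<close>. With \<open>t = 1 / 2 ^ j\<close> this factor is at least 1/2 on the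
  whole block, so Bessel's inequality for the difference bounds the block of
  \<open>F\<close>.\<close>

lemma coef_diff_shift_bound:
  fixes F :: "real \<Rightarrow> complex" and B s :: real and j :: nat
  assumes F: "cper F" and
    md: "\<And>t. 0 < t \<Longrightarrow> t \<le> 1 \<Longrightarrow> pint (\<lambda>x. (norm (F (x + t) - F x))\<^sup>2) \<le> B * t powr (2 * s)"
    and A: "finite A" "\<And>n. n \<in> A \<Longrightarrow> 2 ^ j \<le> \<bar>n\<bar> \<and> \<bar>n\<bar> < 2 ^ (j + 1)"
  shows "(\<Sum>n\<in>A. (norm (coef F n))\<^sup>2) \<le> B * (1 / 2 ^ j) powr (2 * s)"
proof -
  define t :: real where "t = 1 / 2 ^ j"
  have t: "0 < t" "t \<le> 1" by (auto simp: t_def)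
  have c: "coef (\<lambda>x. F (x + t) - F x) n = (cis (of_int n * t) - 1) * coef F n" for n
    unfolding coef_diff[OF cper_shift[OF F] F] coef_shift[OF F] by (simp add: left_diff_distrib)
  have "(\<Sum>n\<in>A. (norm (coef F n))\<^sup>2) \<le> (\<Sum>n\<in>A. 4 * (norm (coef (\<lambda>x. F (x + t) - F x) n))\<^sup>2)"
  proof (rule sum_mono)
    fix n assume "n \<in> A"
    then have "1 / 2 \<le> norm (cis (of_int n * t) - 1)"
      using cis_gap A(2) unfolding t_def by blast
    then have "1 / 2 * norm (coef F n) \<le> norm (coef (\<lambda>x. F (x + t) - F x) n)"
      unfolding c norm_mult by (rule mult_right_mono) simp
    then have "(1 / 2 * norm (coef F n))\<^sup>2 \<le> (norm (coef (\<lambda>x. F (x + t) - F x) n))\<^sup>2"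
      by (rule power_mono) simp
    then show "(norm (coef F n))\<^sup>2 \<le> 4 * (norm (coef (\<lambda>x. F (x + t) - F x) n))\<^sup>2"
      by (simp add: power_mult_distrib power_divide)
  qed
  also have "\<dots> \<le> 4 * (pint (\<lambda>x. (norm (F (x + t) - F x))\<^sup>2) / (2 * pi))"
    unfolding sum_distrib_left[symmetric]
    by (intro mult_left_mono bessel_inequality cper_diff cper_shift F A) auto
  also have "\<dots> \<le> pint (\<lambda>x. (norm (F (x + t) - F x))\<^sup>2)"
  proof -
    have "0 \<le> pint (\<lambda>x. (norm (F (x + t) - F x))\<^sup>2)"
      by (rule hk_integral_nonneg)
         (use F in \<open>auto intro!: cper_integrable cper_power cper_norm cper_diff cper_shift\<close>)
    then show ?thesis using pi_gt3 by (simp add: field_simps mult_right_mono)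
  qed
  also have "\<dots> \<le> B * t powr (2 * s)" using md t by blast
  finally show ?thesis by (simp add: t_def)
qed

lemma card_dyadic_block:
  assumes A: "\<And>n. n \<in> A \<Longrightarrow> \<bar>n\<bar> < (2 ^ (j + 1) :: int)"
  shows "real (card A) \<le> 4 * 2 ^ j"
proof -
  have "A \<subseteq> {- (2 ^ (j + 1)) <..< (2 ^ (j + 1) :: int)}" using A by force
  then have "card A \<le> card {- (2 ^ (j + 1)) <..< (2 ^ (j + 1) :: int)}"
    by (intro card_mono) auto
  also have "\<dots> = nat (4 * 2 ^ j - 1)" by simp
  also have "\<dots> \<le> nat (4 * 2 ^ j)" by simp
  also have "\<dots> = 4 * 2 ^ j" by (simp add: nat_mult_distrib nat_power_eq)
  finally have "real (card A) \<le> real (4 * 2 ^ j)" by (simp only: of_nat_le_iff)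
  then show ?thesis by simp
qed

lemma sum_UN_le:
  fixes g :: "'b \<Rightarrow> real"
  assumes "finite I" "\<And>i. i \<in> I \<Longrightarrow> finite (D i)" "\<And>x. 0 \<le> g x"
  shows "sum g (\<Union>i\<in>I. D i) \<le> (\<Sum>i\<in>I. sum g (D i))"
  using assms(1,2)
proof (induction I rule: finite_induct)
  case (insert i I)
  have "sum g (\<Union>i\<in>insert i I. D i) = sum g (D i \<union> (\<Union>i\<in>I. D i))" by simp
  also have "\<dots> \<le> sum g (D i) + sum g (\<Union>i\<in>I. D i)"
    using insert.prems insert.hyps by (subst sum_Un) (auto intro: sum_nonneg assms(3))
  also have "\<dots> \<le> sum g (D i) + (\<Sum>i\<in>I. sum g (D i))"
    using insert by simp
  finally show ?case using insert.hyps by simp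
qed simp

text \<open>Block j has at most 4 * 2^j indices and a square sum of at most B * 2^(- 2 j s). Its
  p-sum is therefore of order \<open>B powr (p / 2) * r ^ j\<close>, and \<open>r < 1\<close> is
  exactly the condition s > 1/p - 1/2.\<close>

lemma coef_p_small:
  fixes p s :: real
  assumes p: "1 < p" "p < 2" and s: "1 / p - 1 / 2 < s"
  shows "\<exists>C>0. \<forall>F B. 0 < B \<longrightarrow> L2_modulus s B F \<longrightarrow> p_small p (C * B powr (p / 2)) (coef F)"
proof -
  define r where "r = 2 powr (1 - s * p - p / 2)"
  have "1 - s * p - p / 2 < 0"
  proof -
    have "(1 / p - 1 / 2) * p < s * p" using s p by (intro mult_strict_right_mono) auto
    moreover have "(1 / p - 1 / 2) * p = 1 - p / 2" using p by (simp add: field_simps)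
    ultimately show ?thesis by linarith
  qed
  then have r: "0 < r" "r < 1" by (auto simp: r_def powr_less_one)
  \<comment> \<open>The 1 is for the index 0; the 5 = 1 + 4 collects the two terms of the
    interpolation on each block.\<close>
  define C where "C = 1 + 5 / (1 - r)"
  have C: "C > 0" using r by (auto simp: C_def intro!: add_pos_nonneg)
  show ?thesis
  proof (intro exI[of _ C] conjI C allI impI)
    fix F :: "real \<Rightarrow> complex" and B :: real
    assume B: "0 < B" and mod: "L2_modulus s B F"
    have F: "cper F" and I: "pint (\<lambda>x. (norm (F x))\<^sup>2) \<le> B"
      and md: "\<forall>t. 0 < t \<longrightarrow> t \<le> 1 \<longrightarrow> pint (\<lambda>x. (norm (F (x + t) - F x))\<^sup>2) \<le> B * t powr (2 * s)"
      using mod unfolding L2_modulus_def by blast+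
    \<comment> \<open>Differences do not see the index 0, so this coefficient is taken from the
      bound on the L^2 norm itself.\<close>
    have zero: "norm (coef F 0) powr p \<le> B powr (p / 2)"
    proof -
      have "(norm (coef F 0))\<^sup>2 \<le> pint (\<lambda>x. (norm (F x))\<^sup>2) / (2 * pi)"
        using bessel_inequality[OF F, of "{0}"] by simp
      also have "\<dots> \<le> B / (2 * pi)" using I by (simp add: divide_right_mono)
      also have "\<dots> \<le> B" using B pi_gt3 by (simp add: field_simps)
      finally have "((norm (coef F 0))\<^sup>2) powr (p / 2) \<le> B powr (p / 2)"
        using p by (intro powr_mono2) auto
      then show ?thesis
        by (simp add: powr_powr flip: powr_numeral)
    qed
    have block: "(\<Sum>n\<in>A. norm (coef F n) powr p) \<le> 5 * B powr (p / 2) * r ^ j"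
      if A: "finite A" "\<And>n. n \<in> A \<Longrightarrow> 2 ^ j \<le> \<bar>n\<bar> \<and> \<bar>n\<bar> < 2 ^ (j + 1)" for A j
    proof -
      define q :: real where "q = 2 ^ j"
      have q: "q > 0" by (simp add: q_def)
      \<comment> \<open>Up to a constant, the root mean square of the coefficients that the block
        bound allows; with this threshold both terms of the interpolation have the same
        order.\<close>
      define l where "l = sqrt B * q powr (- s - 1 / 2)"
      have l: "l > 0" using B q by (simp add: l_def)
      have lpow: "l powr a = B powr (a / 2) * q powr ((- s - 1 / 2) * a)" for a
        using B by (simp add: l_def powr_mult powr_powr powr_half_sqrt[symmetric])
      have "(\<Sum>n\<in>A. norm (coef F n) powr p) \<le> (\<Sum>n\<in>A. (norm (coef F n))\<^sup>2 * l powr (p - 2) + l powr p)"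
        using l p by (intro sum_mono powr_le_square_interp) auto
      also have "\<dots> = (\<Sum>n\<in>A. (norm (coef F n))\<^sup>2) * l powr (p - 2) + card A * l powr p"
        by (simp add: sum.distrib sum_distrib_right)
      also have "\<dots> \<le> (B * (1 / 2 ^ j) powr (2 * s)) * l powr (p - 2) + (4 * 2 ^ j) * l powr p"
        using A md F coef_diff_shift_bound[OF F _ A, of B s]
        by (intro add_mono mult_right_mono card_dyadic_block) auto
      also have "(B * (1 / 2 ^ j) powr (2 * s)) * l powr (p - 2) = B powr (p / 2) * q powr (1 - s * p - p / 2)"
      proof -
        have e1: "B * B powr ((p - 2) / 2) = B powr (p / 2)"
          using B powr_add[of B 1 "(p - 2) / 2"] by (simp add: field_simps)
        have e2: "(1 / q) powr (2 * s) * q powr ((- s - 1 / 2) * (p - 2)) = q powr (1 - s * p - p / 2)"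
        proof -
          have 1: "(1 / q) powr (2 * s) = q powr (- (2 * s))"
            using q by (simp add: powr_divide powr_minus_divide)
          have 2: "- (2 * s) + (- s - 1 / 2) * (p - 2) = 1 - s * p - p / 2"
            by (simp add: field_simps)
          show ?thesis unfolding 1 using powr_add[of q "- (2 * s)" "(- s - 1 / 2) * (p - 2)"] unfolding 2 ..
        qed
        show ?thesis unfolding lpow q_def[symmetric] e1[symmetric] e2[symmetric] by (simp only: mult_ac)
      qed
      also have "(4 * 2 ^ j) * l powr p = 4 * (B powr (p / 2) * q powr (1 - s * p - p / 2))"
      proof -
        have e3: "q powr (1 - s * p - p / 2) = q * q powr ((- s - 1 / 2) * p)"
          using q powr_add[of q 1 "(- s - 1 / 2) * p"] by (simp add: algebra_simps)
        show ?thesis unfolding lpow q_def[symmetric] e3 by (simp only: mult_ac)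
      qed
      also have "q powr (1 - s * p - p / 2) = r ^ j"
        unfolding q_def r_def by (simp add: powr_powr powr_realpow[symmetric] mult.commute)
      finally show ?thesis by (simp add: algebra_simps)
    qed
    show "p_small p (C * B powr (p / 2)) (coef F)"
      unfolding p_small_def
    proof (intro allI impI)
      fix A :: "int set" assume A: "finite A"
      define D where "D j = {n \<in> A. 2 ^ j \<le> \<bar>n\<bar> \<and> \<bar>n\<bar> < 2 ^ (j + 1)}" for j :: nat
      obtain N where N: "\<And>n. n \<in> A \<Longrightarrow> \<bar>n\<bar> < 2 ^ N"
      proof -
        obtain m :: int where m: "\<And>n. n \<in> A \<Longrightarrow> \<bar>n\<bar> \<le> m"
          using A by (metis finite_imageI finite_has_maximal2 Max_ge image_eqI)
        have "int (nat m) < 2 ^ nat m" using of_nat_less_two_power by blast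
        then have "\<bar>n\<bar> < 2 ^ nat m" if "n \<in> A" for n
          using m[OF that] int_nat_eq[of m] by linarith
        then show ?thesis by (rule that)
      qed
      \<comment> \<open>The block of a nonzero \<open>n\<close> has as its index the predecessor of
        the least \<open>j\<close> with |n| < 2^j.\<close>
      have sub: "A \<subseteq> {0} \<union> (\<Union>j<N. D j)"
      proof
        fix n assume n: "n \<in> A"
        show "n \<in> {0} \<union> (\<Union>j<N. D j)"
        proof (cases "n = 0")
          case False
          define P where "P j \<longleftrightarrow> \<bar>n\<bar> < 2 ^ j" for j :: nat
          have PN: "P N" using N n by (simp add: P_def)
          define j where "j = (LEAST j. P j)"
          have Pj: "P j" unfolding j_def using PN by (rule LeastI)
          have "j \<noteq> 0" using Pj False by (auto simp: P_def intro: ccontr)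
          then obtain i where i: "j = Suc i" by (cases j) auto
          have "\<not> P i" using not_less_Least[of i P] i by (simp add: j_def)
          moreover have "j \<le> N" unfolding j_def using PN by (rule Least_le)
          ultimately show ?thesis using Pj n i by (auto simp: P_def D_def intro!: bexI[of _ i])
        qed simp
      qed
      have fin: "finite (D j)" for j using A by (simp add: D_def)
      have "(\<Sum>n\<in>A. norm (coef F n) powr p) \<le> (\<Sum>n\<in>{0} \<union> (\<Union>j<N. D j). norm (coef F n) powr p)"
        using sub fin by (intro sum_mono2) auto
      also have "\<dots> \<le> (\<Sum>n\<in>{0}. norm (coef F n) powr p) + (\<Sum>n\<in>(\<Union>j<N. D j). norm (coef F n) powr p)"
        using fin by (subst sum_Un) (auto intro: sum_nonneg)
      also have "(\<Sum>n\<in>(\<Union>j<N. D j). norm (coef F n) powr p) \<le> (\<Sum>j<N. \<Sum>n\<in>D j. norm (coef F n) powr p)"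
        using fin by (intro sum_UN_le) auto
      also have "\<dots> \<le> (\<Sum>j<N. 5 * B powr (p / 2) * r ^ j)"
        by (intro sum_mono block fin) (auto simp: D_def)
      also have "\<dots> = 5 * B powr (p / 2) * (\<Sum>j<N. r ^ j)" by (simp add: sum_distrib_left)
      also have "\<dots> \<le> 5 * B powr (p / 2) * (1 / (1 - r))"
      proof (intro mult_left_mono)
        have "(\<Sum>j<N. r ^ j) = (1 - r ^ N) / (1 - r)" using r by (simp add: sum_gp_strict)
        also have "\<dots> \<le> 1 / (1 - r)" using r by (intro divide_right_mono) auto
        finally show "(\<Sum>j<N. r ^ j) \<le> 1 / (1 - r)" .
      qed auto
      finally have "(\<Sum>n\<in>A. norm (coef F n) powr p) \<le> norm (coef F 0) powr p + 5 * B powr (p / 2) * (1 / (1 - r))"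
        by simp
      then show "(\<Sum>n\<in>A. norm (coef F n) powr p) \<le> C * B powr (p / 2)"
        using zero by (simp add: C_def algebra_simps)
    qed
  qed
qed

lemma coef_p_small_eps:
  fixes p s e :: real
  assumes p: "1 < p" "p < 2" and s: "1 / p - 1 / 2 < s" and e: "0 < e"
  shows "\<exists>B>0. \<forall>F. L2_modulus s B F \<longrightarrow> p_small p e (coef F)"
proof -
  from coef_p_small[OF p s] obtain C where C: "C > 0" and
    *: "\<forall>F B. 0 < B \<longrightarrow> L2_modulus s B F \<longrightarrow> p_small p (C * B powr (p / 2)) (coef F)"
    by (elim exE conjE)
  define B where "B = (e / C) powr (2 / p)"
  have B: "B > 0" using e C by (simp add: B_def)
  have "C * B powr (p / 2) = e"
    using e C p by (simp add: B_def powr_powr)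
  then show ?thesis using * B by (metis (no_types))
qed

text \<open>A rotation moves \<open>w\<close> to 1 and the period is centred there. On [-pi, pi] the
  chord is at least half the angle, and the resulting power of \<open>t + x / 2\<close> integrates
  explicitly; as a < -1, the scale \<open>t\<close> near the pole dominates. Uniformity in
  \<open>w\<close> allows many nodes to be summed later.\<close>

lemma integral_power_distance:
  fixes a :: real
  assumes a: "a < -1"
  shows "\<exists>C>0. \<forall>t>0. \<forall>w\<in>circle. pint (\<lambda>x. (t + norm (w - cis x)) powr a) \<le> C * t powr (a + 1)"
proof -
  define C where "C = 2 * (2 / - (a + 1))"
  have C: "C > 0" using a by (auto simp: C_def field_simps)
  show ?thesis
  proof (intro exI[of _ C] conjI C allI ballI impI)
    fix t :: real and w :: complex
    assume t: "t > 0" and w: "w \<in> circle"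
    define G where "G x = (t + norm (1 - cis x)) powr a" for x
    have G: "cper G" unfolding G_def
    proof (rule cper_compose_cis[of "\<lambda>z. (t + norm (1 - z)) powr a"])
      have "t + norm (1 - z) \<noteq> 0" for z :: complex using t by (smt (verit) norm_ge_zero)
      then show "continuous_on circle (\<lambda>z. (t + norm (1 - z)) powr a)"
        by (intro continuous_intros) auto
    qed
    obtain y where y: "w = cis y" using w by (metis complex_norm_eq_1_exp cis_conv_exp mem_sphere_0)
    have "norm (w - cis x) = norm (1 - cis (x - y))" for x
      using norm_cis_diff[of x y] by (simp add: y norm_minus_commute)
    then have "pint (\<lambda>x. (t + norm (w - cis x)) powr a) = pint (\<lambda>x. G (x + - y))"
      by (simp add: G_def)
    also have "\<dots> = pint (\<lambda>x. G (x + - pi))"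
      using integral_shift_period[OF G, of "- y"] integral_shift_period[OF G, of "- pi"] by simp
    also have "\<dots> = integral {0..pi} (\<lambda>x. G (x + - pi)) + integral {pi..2 * pi} (\<lambda>x. G (x + - pi))"
      using G by (intro hk_integral_combine[symmetric])
         (auto intro!: cper_integrable cper_shift simp del: add_uminus_conv_diff)
    also have "\<dots> \<le> t powr (a + 1) * (2 / - (a + 1)) + t powr (a + 1) * (2 / - (a + 1))"
    proof -
      have nb: "\<bar>x\<bar> / 2 \<le> norm (1 - cis x)" if "\<bar>x\<bar> \<le> pi" for x
      proof -
        have "\<bar>x / 2\<bar> / 2 \<le> sin \<bar>x / 2\<bar>" using that by (intro sin_ge_linear) auto
        also have "\<dots> \<le> \<bar>sin (x / 2)\<bar>" by (cases "x \<ge> 0") (auto simp: abs_if)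
        finally show ?thesis using norm_cis_minus_one[of x] by (simp add: norm_minus_commute)
      qed
      have Gb: "G x \<le> (t + \<bar>x\<bar> / 2) powr a" if "\<bar>x\<bar> \<le> pi" for x
        unfolding G_def using nb[OF that] t a by (intro powr_mono2') auto
      have FTC: "((\<lambda>x. (t + x / 2) powr a) has_integral
          (2 / (a + 1) * (t + pi / 2) powr (a + 1) - 2 / (a + 1) * (t + 0 / 2) powr (a + 1))) {0..pi}"
      proof (rule fundamental_theorem_of_calculus)
        fix x assume x: "x \<in> {0..pi}"
        have "((\<lambda>x. (t + x / 2) powr (a + 1)) has_real_derivative
            (a + 1) * (t + x / 2) powr (a + 1 - of_nat 1) * (1 / 2)) (at x)"
          by (rule DERIV_fun_powr) (use t x in \<open>auto intro!: derivative_eq_intros\<close>)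
        then have "((\<lambda>x. 2 / (a + 1) * (t + x / 2) powr (a + 1)) has_real_derivative
            2 / (a + 1) * ((a + 1) * (t + x / 2) powr (a + 1 - of_nat 1) * (1 / 2))) (at x)"
          by (rule DERIV_cmult)
        then have "((\<lambda>x. 2 / (a + 1) * (t + x / 2) powr (a + 1)) has_real_derivative (t + x / 2) powr a) (at x)"
          using a by simp
        then show "((\<lambda>x. 2 / (a + 1) * (t + x / 2) powr (a + 1)) has_vector_derivative (t + x / 2) powr a)
            (at x within {0..pi})"
          by (simp add: has_real_derivative_iff_has_vector_derivative has_vector_derivative_at_within)
      qed simp
      have FTCb: "integral {0..pi} (\<lambda>x. (t + x / 2) powr a) \<le> t powr (a + 1) * (2 / - (a + 1))"
      proof -
        have "2 / (a + 1) * (t + pi / 2) powr (a + 1) \<le> 0"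
          by (rule mult_nonpos_nonneg[OF divide_nonneg_nonpos]) (use a in auto)
        moreover have "t powr (a + 1) * (2 / - (a + 1)) = - (2 / (a + 1) * t powr (a + 1))"
          unfolding minus_divide_right[symmetric] by (simp only: mult_minus_right mult.commute)
        ultimately show ?thesis unfolding integral_unique[OF FTC] by simp
      qed
      have int1: "(\<lambda>x. (t + x / 2) powr a) integrable_on {0..pi}" using FTC by blast
      have A2: "integral {pi..2 * pi} (\<lambda>x. G (x + - pi)) = integral {0..pi} G"
        using integral_shift_Icc_real[of 0 pi "\<lambda>x. G (x + - pi)" pi] by (simp add: o_def)
      have A3: "integral {0..pi} G \<le> integral {0..pi} (\<lambda>x. (t + x / 2) powr a)"
        by (intro integral_le cper_integrable[OF G] int1) (metis Gb abs_of_nonneg atLeastAtMost_iff)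
      have A1: "integral {0..pi} (\<lambda>x. G (x + - pi)) \<le> integral {0..pi} (\<lambda>x. (t + x / 2) powr a)"
      proof -
        have "integral {0..pi} (\<lambda>x. G (x + - pi)) = integral {-pi..0} G"
          using integral_shift_Icc_real[of "-pi" 0 "\<lambda>x. G (x + - pi)" pi] by (simp add: o_def)
        also have "\<dots> = integral {0..pi} (\<lambda>x. G (- x))"
          using hk_integral_reflect_real[of pi 0 "\<lambda>x. G (- x)"] by simp
        also have "(\<lambda>x. G (- x)) = G"
          using norm_cis_minus_one by (auto simp: G_def norm_minus_commute[of 1])
        finally show ?thesis using A3 by simp
      qed
      show ?thesis using A1 A2 A3 FTCb by linarith
    qed
    also have "\<dots> = C * t powr (a + 1)" by (simp add: C_def)
    finally show "pint (\<lambda>x. (t + norm (w - cis x)) powr a) \<le> C * t powr (a + 1)" .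
  qed
qed

section \<open>Hoelder functions on the circle, and products with a uniformly small factor\<close>

lemma Lip_continuous:
  assumes "f \<in> Lip \<delta>" "\<delta> > 0"
  shows "continuous_on circle f"
proof -
  obtain C where C: "C > 0" and L: "\<And>x y. x \<in> circle \<Longrightarrow> y \<in> circle \<Longrightarrow> norm (f x - f y) \<le> C * norm (x - y) powr \<delta>"
    using assms by (auto simp: Lip_def)
  show ?thesis
    unfolding continuous_on_iff
  proof (intro ballI allI impI)
    fix x :: complex and e :: real
    assume x: "x \<in> circle" and e: "0 < e"
    define d where "d = (e / C) powr (1 / \<delta>)"
    have d: "d > 0" using e C by (simp add: d_def)
    show "\<exists>d>0. \<forall>x'\<in>circle. dist x' x < d \<longrightarrow> dist (f x') (f x) < e"
    proof (intro exI[of _ d] conjI d ballI impI)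
      fix y assume y: "y \<in> circle" and "dist y x < d"
      then have "norm (y - x) powr \<delta> < d powr \<delta>"
        using assms by (intro powr_less_mono2) (auto simp: dist_norm)
      also have "d powr \<delta> = e / C" using e C assms by (simp add: d_def powr_powr)
      finally have "C * norm (y - x) powr \<delta> < e" using C by (simp add: field_simps)
      then show "dist (f y) (f x) < e" using L[OF y x] by (simp add: dist_norm)
    qed
  qed
qed

lemma powr_le_two_powr:
  fixes x a b :: real
  assumes "0 \<le> x" "x \<le> 2" "a \<le> b"
  shows "x powr b \<le> 2 powr (b - a) * x powr a"
proof (cases "x = 0")
  case False
  then have "x powr b = x powr (b - a) * x powr a" using assms by (simp add: powr_diff)
  also have "\<dots> \<le> 2 powr (b - a) * x powr a"
    using assms by (intro mult_right_mono powr_mono2) auto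
  finally show ?thesis .
qed simp

lemma norm_circle_diff_le: "x \<in> circle \<Longrightarrow> y \<in> circle \<Longrightarrow> norm (x - y) \<le> (2::real)"
  using norm_triangle_ineq4[of x y] by simp

lemma Lip_weaken:
  assumes "f \<in> Lip \<delta>" "\<delta>' \<le> \<delta>"
  shows "f \<in> Lip \<delta>'"
proof -
  obtain C where C: "C > 0" and L: "\<And>x y. x \<in> circle \<Longrightarrow> y \<in> circle \<Longrightarrow> norm (f x - f y) \<le> C * norm (x - y) powr \<delta>"
    using assms by (auto simp: Lip_def)
  have "norm (f x - f y) \<le> (C * 2 powr (\<delta> - \<delta>')) * norm (x - y) powr \<delta>'" if "x \<in> circle" "y \<in> circle" for x y
  proof -
    have "C * norm (x - y) powr \<delta> \<le> C * (2 powr (\<delta> - \<delta>') * norm (x - y) powr \<delta>')"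
      using C assms(2) that norm_circle_diff_le[OF that] by (intro mult_left_mono powr_le_two_powr) auto
    then show ?thesis using L[OF that] by (simp add: mult.assoc)
  qed
  moreover have "C * 2 powr (\<delta> - \<delta>') > 0" using C by simp
  ultimately show ?thesis unfolding Lip_def by blast
qed

lemma integral_square_le:
  fixes F :: "real \<Rightarrow> complex"
  assumes "cper F" "\<And>x. norm (F x) \<le> Q"
  shows "pint (\<lambda>x. (norm (F x))\<^sup>2) \<le> 2 * pi * Q\<^sup>2"
proof -
  have "pint (\<lambda>x. (norm (F x))\<^sup>2) \<le> pint (\<lambda>x. Q\<^sup>2)"
    using assms by (intro integral_le cper_integrable cper_power cper_norm cper_const power_mono) auto
  then show ?thesis by simp
qed

lemma min_le_interp:
  fixes a b \<theta> m :: real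
  assumes "0 \<le> m" "m \<le> a" "m \<le> b" "0 \<le> \<theta>" "\<theta> \<le> 1"
  shows "m \<le> a powr (1 - \<theta>) * b powr \<theta>"
proof (cases "m = 0")
  case False
  then have "m = m powr (1 - \<theta>) * m powr \<theta>" using assms by (simp flip: powr_add)
  also have "\<dots> \<le> a powr (1 - \<theta>) * b powr \<theta>"
    using assms by (intro mult_mono powr_mono2) auto
  finally show ?thesis .
qed simp

text \<open>A small sup norm and a Hoelder bound of exponent \<delta> interpolate to a Hoelder bound
  of a smaller exponent s with a small constant, and s can still be above the critical exponent. The
  constant \<open>C\<close> may thus be large, provided \<eta> is chosen after it. This handles the
  error of a polynomial approximation twice below.\<close>

lemma Lip_mult_coef_small:
  fixes p \<delta> e C :: real and f :: "complex \<Rightarrow> complex"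
  assumes p: "1 < p" "p < 2" and d: "1 / p - 1 / 2 < \<delta>" and f: "f \<in> Lip \<delta>"
    and e: "e > 0" and C: "C > 0"
  shows "\<exists>\<eta>>0. \<forall>g. continuous_on circle g \<longrightarrow> (\<forall>z\<in>circle. norm (g z) \<le> \<eta>) \<longrightarrow>
     (\<forall>z\<in>circle. \<forall>w\<in>circle. norm (g z - g w) \<le> C * norm (z - w) powr \<delta>) \<longrightarrow>
     p_small p e (coef (\<lambda>x. f (cis x) * g (cis x)))"
proof -
  define s where "s = (1 / p - 1 / 2 + \<delta>) / 2"
  note s0 = critical_exponent_pos[OF p]
  have s: "1 / p - 1 / 2 < s" "s < \<delta>" "0 < s" using d s0 by (auto simp: s_def)
  define \<theta> where "\<theta> = s / \<delta>"
  have th: "0 < \<theta>" "\<theta> < 1" "\<delta> * \<theta> = s" using s by (auto simp: \<theta>_def)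
  have fc: "continuous_on circle f" using f Lip_continuous s by fastforce
  obtain L where L: "L > 0" and Lf: "\<And>x y. x \<in> circle \<Longrightarrow> y \<in> circle \<Longrightarrow> norm (f x - f y) \<le> L * norm (x - y) powr \<delta>"
    using f by (auto simp: Lip_def)
  have "bounded (f ` circle)" using fc by (intro compact_imp_bounded compact_continuous_image) auto
  then obtain M where M: "M > 0" "\<And>z. z \<in> circle \<Longrightarrow> norm (f z) \<le> M"
    unfolding bounded_pos by auto
  from coef_p_small_eps[OF p s(1) e] obtain B where B: "B > 0" and
    small: "\<forall>F. L2_modulus s B F \<longrightarrow> p_small p e (coef F)"
    by (elim exE conjE)
  define K where "K = M * (2 powr (1 - \<theta>) * C powr \<theta>) + L + M"
  have K: "K > 0" using M L by (auto simp: K_def intro!: add_nonneg_pos)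
  define q where "q = sqrt (B / (2 * pi)) / K"
  have q: "q > 0" using B K by (simp add: q_def)
  \<comment> \<open>The cap at 1 gives \<eta> \<le> \<open>h\<close>, so that the single quantity
    \<open>h\<close> controls both the size and the increments of the product.\<close>
  define \<eta> where "\<eta> = min 1 (q powr (1 / (1 - \<theta>)))"
  have eta: "\<eta> > 0" "\<eta> \<le> 1" using q by (auto simp: \<eta>_def)
  define h where "h = \<eta> powr (1 - \<theta>)"
  have h: "0 < h" "\<eta> \<le> h"
  proof -
    show "0 < h" using eta by (simp add: h_def)
    show "\<eta> \<le> h" unfolding h_def using eta th powr_mono'[of "1 - \<theta>" 1 \<eta>] by simp
  qed
  have hq: "h \<le> q"
  proof -
    have "h \<le> (q powr (1 / (1 - \<theta>))) powr (1 - \<theta>)"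
      unfolding h_def using eta th by (intro powr_mono2) (auto simp: \<eta>_def)
    then show ?thesis using q th by (simp add: powr_powr)
  qed
  have KB: "2 * pi * (K * h)\<^sup>2 \<le> B"
  proof -
    have "K * h \<le> sqrt (B / (2 * pi))" using hq K by (simp add: q_def field_simps)
    then have "(K * h)\<^sup>2 \<le> (sqrt (B / (2 * pi)))\<^sup>2" using K h by (intro power_mono) auto
    then show ?thesis using B by (simp add: field_simps)
  qed
  show ?thesis
  proof (intro exI[of _ \<eta>] conjI eta allI impI)
    fix g :: "complex \<Rightarrow> complex"
    assume gc: "continuous_on circle g" and g1: "\<forall>z\<in>circle. norm (g z) \<le> \<eta>"
      and g2: "\<forall>z\<in>circle. \<forall>w\<in>circle. norm (g z - g w) \<le> C * norm (z - w) powr \<delta>"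
    define F where "F x = f (cis x) * g (cis x)" for x
    have F: "cper F" unfolding F_def by (intro cper_mult cper_compose_cis fc gc)
    have "p_small p e (coef F)"
    proof (rule small[rule_format, OF L2_modulusI[OF F]])
      have "norm (F x) \<le> K * h" for x
      proof -
        have "norm (F x) \<le> M * h"
          unfolding F_def norm_mult using M g1 h by (intro mult_mono) (auto intro: order_trans)
        also have "\<dots> \<le> K * h" using h M L by (intro mult_right_mono) (auto simp: K_def)
        finally show ?thesis .
      qed
      from integral_square_le[OF F this] KB
      show "pint (\<lambda>x. (norm (F x))\<^sup>2) \<le> B" by linarith
    next
      fix t :: real assume t: "0 < t" "t \<le> 1"
      have "norm (F (x + t) - F x) \<le> K * h * t powr s" for x
      proof -
        define z where "z = cis x"
        define w where "w = cis (x + t)"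
        have zw: "z \<in> circle" "w \<in> circle" by (auto simp: z_def w_def)
        have nzw: "norm (w - z) \<le> t" using norm_cis_diff_le[of "x + t" x] t by (simp add: z_def w_def)
        then have nd: "norm (w - z) powr \<delta> \<le> t powr \<delta>" using s by (intro powr_mono2) auto
        have td: "t powr \<delta> \<le> t powr s" using t s by (intro powr_mono') auto
        have 1: "norm (g w - g z) \<le> 2 powr (1 - \<theta>) * C powr \<theta> * (h * t powr s)"
        proof -
          have "norm (g w - g z) \<le> C * t powr \<delta>"
            using g2 zw nd C by (meson mult_left_mono order_trans less_imp_le)
          moreover have "norm (g w - g z) \<le> 2 * \<eta>"
            using norm_triangle_ineq4[of "g w" "g z"] bspec[OF g1 zw(1)] bspec[OF g1 zw(2)] by linarith
          ultimately have "norm (g w - g z) \<le> (2 * \<eta>) powr (1 - \<theta>) * (C * t powr \<delta>) powr \<theta>"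
            using th by (intro min_le_interp) auto
          also have "\<dots> = 2 powr (1 - \<theta>) * C powr \<theta> * (h * t powr s)"
            using eta C t th by (simp add: powr_mult powr_powr h_def)
          finally show ?thesis .
        qed
        have 2: "norm (f w - f z) * norm (g z) \<le> L * (h * t powr s)"
        proof -
          have "norm (f w - f z) \<le> L * t powr s"
            using Lf[OF zw(2,1)] nd td L by (meson mult_left_mono order_trans less_imp_le)
          moreover have "norm (g z) \<le> h" using g1 zw h by force
          ultimately have "norm (f w - f z) * norm (g z) \<le> (L * t powr s) * h"
            using L h by (intro mult_mono) auto
          then show ?thesis by (simp add: algebra_simps)
        qed
        have "F (x + t) - F x = f w * (g w - g z) + (f w - f z) * g z"
          by (simp add: F_def z_def w_def algebra_simps)
        then have "norm (F (x + t) - F x) \<le> norm (f w) * norm (g w - g z) + norm (f w - f z) * norm (g z)"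
          by (metis norm_mult norm_triangle_ineq)
        also have "\<dots> \<le> M * (2 powr (1 - \<theta>) * C powr \<theta> * (h * t powr s)) + L * (h * t powr s)"
          using 1 M zw by (intro add_mono[OF mult_mono 2]) auto
        also have "\<dots> \<le> K * h * t powr s"
          using M h by (simp add: K_def algebra_simps)
        finally show ?thesis .
      qed
      from integral_square_le[OF cper_diff[OF cper_shift[OF F] F] this]
      have "pint (\<lambda>x. (norm (F (x + t) - F x))\<^sup>2) \<le> 2 * pi * (K * h * t powr s)\<^sup>2" .
      also have "\<dots> = 2 * pi * (K * h)\<^sup>2 * t powr (2 * s)"
        using t powr_powr[of t s 2] by (simp add: power_mult_distrib mult.commute[of s])
      also have "\<dots> \<le> B * t powr (2 * s)" using KB by (intro mult_right_mono) auto
      finally show "pint (\<lambda>x. (norm (F (x + t) - F x))\<^sup>2) \<le> B * t powr (2 * s)" .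
    qed
    then show "p_small p e (coef (\<lambda>x. f (cis x) * g (cis x)))" unfolding F_def .
  qed
qed

section \<open>Shift-invariant subspaces\<close>

text \<open>A quasi-triangle inequality replaces Minkowski's inequality throughout.\<close>

lemma p_small_add:
  assumes "p > 0" "p_small p a v" "p_small p b w"
  shows "p_small p (2 powr p * (a + b)) (\<lambda>n. v n + w n)"
  unfolding p_small_def
proof (intro allI impI)
  fix A :: "int set" assume A: "finite A"
  have "norm (v n + w n) powr p \<le> 2 powr p * (norm (v n) powr p + norm (w n) powr p)" for n
  proof -
    define m where "m = max (norm (v n)) (norm (w n))"
    have "norm (v n + w n) \<le> 2 * m"
      using norm_triangle_ineq[of "v n" "w n"] by (auto simp: m_def)
    then have "norm (v n + w n) powr p \<le> (2 * m) powr p" using assms by (intro powr_mono2) auto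
    also have "\<dots> = 2 powr p * m powr p" by (simp add: powr_mult m_def)
    also have "m powr p \<le> norm (v n) powr p + norm (w n) powr p" by (auto simp: m_def max_def)
    finally show ?thesis by simp
  qed
  then have "(\<Sum>n\<in>A. norm (v n + w n) powr p) \<le> (\<Sum>n\<in>A. 2 powr p * (norm (v n) powr p + norm (w n) powr p))"
    by (intro sum_mono) auto
  also have "\<dots> = 2 powr p * ((\<Sum>n\<in>A. norm (v n) powr p) + (\<Sum>n\<in>A. norm (w n) powr p))"
    by (simp add: sum.distrib sum_distrib_left distrib_left)
  also have "\<dots> \<le> 2 powr p * (a + b)"
    using assms A by (intro mult_left_mono add_mono) (auto simp: p_small_def)
  finally show "(\<Sum>n\<in>A. norm (v n + w n) powr p) \<le> 2 powr p * (a + b)" .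
qed

lemma p_small_scale:
  assumes "p_small p a v"
  shows "p_small p (norm c powr p * a) (\<lambda>n. c * v n)"
  unfolding p_small_def
proof (intro allI impI)
  fix A :: "int set" assume A: "finite A"
  have "(\<Sum>n\<in>A. norm (c * v n) powr p) = norm c powr p * (\<Sum>n\<in>A. norm (v n) powr p)"
    by (simp add: norm_mult powr_mult sum_distrib_left)
  also have "\<dots> \<le> norm c powr p * a" using assms A by (intro mult_left_mono) (auto simp: p_small_def)
  finally show "(\<Sum>n\<in>A. norm (c * v n) powr p) \<le> norm c powr p * a" .
qed

section \<open>Two-sided shifts and closures in the p-norm\<close>

definition bishift :: "int \<Rightarrow> (int \<Rightarrow> complex) \<Rightarrow> int \<Rightarrow> complex" where
  "bishift i v = (\<lambda>n. v (n - i))"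

lemma bishift_bishift: "bishift i (bishift j v) = bishift (i + j) v"
  by (simp add: bishift_def fun_eq_iff algebra_simps)

lemma bishift_zero [simp]: "bishift 0 v = v"
  by (simp add: bishift_def)

lemma shift_eq_bishift: "shift k = bishift (int k)"
  by (simp add: bishift_def shift_def fun_eq_iff)

lemma p_small_bishift:
  assumes "p_small p a v"
  shows "p_small p a (bishift i v)"
  unfolding p_small_def
proof (intro allI impI)
  fix A :: "int set" assume A: "finite A"
  have "(\<Sum>n\<in>A. norm (bishift i v n) powr p) = (\<Sum>n\<in>(\<lambda>n. n - i) ` A. norm (v n) powr p)"
    by (subst sum.reindex) (auto simp: bishift_def inj_on_def)
  also have "\<dots> \<le> a" using assms A by (simp add: p_small_def)
  finally show "(\<Sum>n\<in>A. norm (bishift i v n) powr p) \<le> a" .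
qed

text \<open>Closure for the p-norm, phrased through \<open>p_small\<close> so that it makes sense
  without discussing summability; \<open>ell_cyclicI\<close> translates back to
  \<open>ell_norm\<close>.\<close>

definition p_closure :: "real \<Rightarrow> (int \<Rightarrow> complex) set \<Rightarrow> (int \<Rightarrow> complex) set" where
  "p_closure p X = {v. \<forall>e>0. \<exists>w\<in>X. p_small p e (\<lambda>n. v n - w n)}"

lemma p_small_zero [simp]: "0 \<le> e \<Longrightarrow> p_small p e (\<lambda>n. 0)"
  by (simp add: p_small_def)

lemma p_closure_superset: "X \<subseteq> p_closure p X"
  by (force simp: p_closure_def)

text \<open>The divisor undoes the factor of \<open>p_small_add\<close>; this is where the recurring
  \<open>e' = e / (2 * 2 powr p)\<close> comes from.\<close>

lemma p_small_add_half:
  assumes "p > 0" "p_small p (e / (2 * 2 powr p)) v" "p_small p (e / (2 * 2 powr p)) w"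
  shows "p_small p e (\<lambda>n. v n + w n)"
  using p_small_add[OF assms] by (simp add: field_simps)

lemma p_closure_closed:
  assumes p: "p > 0" and "\<And>e. e > 0 \<Longrightarrow> \<exists>w\<in>p_closure p X. p_small p e (\<lambda>n. v n - w n)"
  shows "v \<in> p_closure p X"
  unfolding p_closure_def
proof (intro CollectI allI impI)
  fix e :: real assume e: "0 < e"
  define e' where "e' = e / (2 * 2 powr p)"
  have e': "e' > 0" using e by (simp add: e'_def)
  obtain w where w: "w \<in> p_closure p X" "p_small p e' (\<lambda>n. v n - w n)" using assms(2)[OF e'] by blast
  obtain x where x: "x \<in> X" "p_small p e' (\<lambda>n. w n - x n)"
    using w(1) e' unfolding p_closure_def by blast
  have "p_small p e (\<lambda>n. (v n - w n) + (w n - x n))"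
    using p_small_add_half[OF p] w(2) x(2) unfolding e'_def by blast
  then show "\<exists>w\<in>X. p_small p e (\<lambda>n. v n - w n)" using x(1) by (intro bexI[of _ x]) auto
qed

lemma p_closure_subspace:
  assumes p: "p > 0" and X: "seq.subspace X"
  shows "seq.subspace (p_closure p X)"
  unfolding seq.subspace_def
proof (intro conjI ballI allI)
  show "0 \<in> p_closure p X" using p_closure_superset seq.subspace_0[OF X] by blast
next
  fix v w assume vw: "v \<in> p_closure p X" "w \<in> p_closure p X"
  show "v + w \<in> p_closure p X"
    unfolding p_closure_def
  proof (intro CollectI allI impI)
    fix e :: real assume e: "0 < e"
    define e' where "e' = e / (2 * 2 powr p)"
    have e': "e' > 0" using e by (simp add: e'_def)
    obtain x where x: "x \<in> X" "p_small p e' (\<lambda>n. v n - x n)" using vw(1) e' unfolding p_closure_def by blast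
    obtain y where y: "y \<in> X" "p_small p e' (\<lambda>n. w n - y n)" using vw(2) e' unfolding p_closure_def by blast
    have "p_small p e (\<lambda>n. (v n - x n) + (w n - y n))"
      using p_small_add_half[OF p] x(2) y(2) unfolding e'_def by blast
    then have "p_small p e (\<lambda>n. (v + w) n - (x + y) n)" by (simp add: algebra_simps)
    then show "\<exists>x\<in>X. p_small p e (\<lambda>n. (v + w) n - x n)"
      using seq.subspace_add[OF X x(1) y(1)] by blast
  qed
next
  fix c v assume v: "v \<in> p_closure p X"
  show "seq_scale c v \<in> p_closure p X"
    unfolding p_closure_def
  proof (intro CollectI allI impI)
    fix e :: real assume e: "0 < e"
    define e' where "e' = e / (norm c powr p + 1)"
    have e': "e' > 0" using e by (simp add: e'_def add_nonneg_pos)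
    obtain x where x: "x \<in> X" "p_small p e' (\<lambda>n. v n - x n)" using v e' unfolding p_closure_def by blast
    have "norm c powr p * e' \<le> e"
    proof -
      have "norm c powr p * e' \<le> (norm c powr p + 1) * e'" using e' by (intro mult_right_mono) auto
      also have "\<dots> = e" using powr_ge_zero[of "norm c" p] by (simp add: e'_def add_nonneg_eq_0_iff)
      finally show ?thesis .
    qed
    then have "p_small p e (\<lambda>n. c * (v n - x n))"
      using p_small_scale[OF x(2), of c] p_small_mono by blast
    then have "p_small p e (\<lambda>n. seq_scale c v n - seq_scale c x n)"
      by (simp add: seq_scale_def algebra_simps)
    then show "\<exists>x\<in>X. p_small p e (\<lambda>n. seq_scale c v n - x n)"
      using seq.subspace_scale[OF X x(1)] by blast
  qed
qed

abbreviation forward_span :: "(int \<Rightarrow> complex) \<Rightarrow> (int \<Rightarrow> complex) set" where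
  "forward_span u \<equiv> seq_span (range (\<lambda>k. shift k u))"

text \<open>The sequences that are shifted into the closure form a subspace, which contains the
  generators and hence their span. Shifts preserve \<open>p_small\<close>, so the property passes to
  limits.\<close>

lemma bishift_p_closure:
  assumes p: "p > 0" and gen: "\<And>k. bishift i (shift k u) \<in> p_closure p (forward_span u)"
    and v: "v \<in> p_closure p (forward_span u)"
  shows "bishift i v \<in> p_closure p (forward_span u)"
proof -
  let ?L = "p_closure p (forward_span u)"
  have sub: "seq.subspace ?L" by (rule p_closure_subspace[OF p seq.subspace_span])
  have "seq.subspace {w. bishift i w \<in> ?L}"
    unfolding seq.subspace_def
  proof (intro conjI ballI allI CollectI)
    have "bishift i 0 = 0" by (simp add: bishift_def fun_eq_iff)
    then show "bishift i 0 \<in> ?L" using seq.subspace_0[OF sub] by simp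
  next
    fix x y assume "x \<in> {w. bishift i w \<in> ?L}" "y \<in> {w. bishift i w \<in> ?L}"
    moreover have "bishift i (x + y) = bishift i x + bishift i y" by (simp add: bishift_def fun_eq_iff)
    ultimately show "bishift i (x + y) \<in> ?L" using seq.subspace_add[OF sub] by simp
  next
    fix c x assume "x \<in> {w. bishift i w \<in> ?L}"
    moreover have "bishift i (seq_scale c x) = seq_scale c (bishift i x)"
      by (simp add: bishift_def seq_scale_def fun_eq_iff)
    ultimately show "bishift i (seq_scale c x) \<in> ?L" using seq.subspace_scale[OF sub] by simp
  qed
  then have span: "forward_span u \<subseteq> {w. bishift i w \<in> ?L}"
    using gen by (intro seq.span_minimal) auto
  show ?thesis
  proof (rule p_closure_closed[OF p])
    fix e :: real assume "0 < e"
    then obtain w where w: "w \<in> forward_span u" "p_small p e (\<lambda>n. v n - w n)"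
      using v unfolding p_closure_def by blast
    have "p_small p e (bishift i (\<lambda>n. v n - w n))" by (rule p_small_bishift[OF w(2)])
    then have "p_small p e (\<lambda>n. bishift i v n - bishift i w n)" by (simp add: bishift_def)
    then show "\<exists>w\<in>?L. p_small p e (\<lambda>n. bishift i v n - w n)" using span w(1) by blast
  qed
qed

text \<open>Shifting back a later generator gives an earlier one. Only the first generator can leave
  the span, and \<open>bk\<close> settles that case.\<close>

lemma bishift_invariant:
  assumes p: "p > 0" and bk: "bishift (- 1) u \<in> p_closure p (forward_span u)"
    and v: "v \<in> p_closure p (forward_span u)"
  shows "bishift i v \<in> p_closure p (forward_span u)"
proof -
  let ?L = "p_closure p (forward_span u)"
  have sh: "shift k u \<in> ?L" for k
    by (rule subsetD[OF p_closure_superset], rule seq.span_base) auto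
  have fw: "bishift 1 w \<in> ?L" if "w \<in> ?L" for w
  proof (rule bishift_p_closure[OF p _ that])
    fix k
    have "bishift 1 (shift k u) = shift (Suc k) u" by (simp add: shift_eq_bishift bishift_bishift add.commute)
    then show "bishift 1 (shift k u) \<in> ?L" using sh by metis
  qed
  have bw: "bishift (-1) w \<in> ?L" if "w \<in> ?L" for w
  proof (rule bishift_p_closure[OF p _ that])
    fix k
    show "bishift (-1) (shift k u) \<in> ?L"
    proof (cases k)
      case 0
      then show ?thesis using bk by (simp add: shift_eq_bishift)
    next
      case (Suc m)
      then have "bishift (-1) (shift k u) = shift m u" by (simp add: shift_eq_bishift bishift_bishift)
      then show ?thesis using sh by simp
    qed
  qed
  show ?thesis
  proof (induction i rule: int_induct[where k = 0])
    case base then show ?case using v by simp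
  next
    case (step1 i)
    then show ?case using fw[of "bishift i v"] by (simp add: bishift_bishift add.commute)
  next
    case (step2 i)
    then show ?case using bw[of "bishift i v"] by (simp add: bishift_bishift)
  qed
qed

text \<open>If a polynomial in the shift with constant term 1 makes \<open>u\<close> small, then
  shifting everything back by one place writes \<open>bishift (- 1) u\<close> as a small error minus
  a combination of forward shifts.\<close>

lemma backward_shift_in_closure:
  assumes "\<And>e. e > 0 \<Longrightarrow> \<exists>h K. h 0 = 1 \<and> p_small p e (\<lambda>n. \<Sum>k\<le>K. h k * u (n - int k))"
  shows "bishift (- 1) u \<in> p_closure p (forward_span u)"
  unfolding p_closure_def
proof (intro CollectI allI impI)
  fix e :: real assume "e > 0"
  then obtain h :: "nat \<Rightarrow> complex" and K where h: "h 0 = 1" and small: "p_small p e (\<lambda>n. \<Sum>k\<le>K. h k * u (n - int k))"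
    using assms by blast
  define w where "w = (\<Sum>k<K. seq_scale (- h (Suc k)) (shift k u))"
  have w: "w \<in> forward_span u"
    unfolding w_def by (intro seq.span_sum seq.span_scale seq.span_base) auto
  have wn: "w n = - (\<Sum>k<K. h (Suc k) * u (n - int k))" for n
  proof -
    have "w n = (\<Sum>k<K. seq_scale (- h (Suc k)) (shift k u) n)"
      unfolding w_def by (induction K) auto
    then show ?thesis by (simp add: seq_scale_def shift_def sum_negf)
  qed
  have "bishift (-1) (\<lambda>n. \<Sum>k\<le>K. h k * u (n - int k)) = (\<lambda>n. bishift (- 1) u n - w n)"
    unfolding fun_eq_iff wn bishift_def
    by (subst sum.atMost_shift) (simp add: h lessThan_Suc_atMost[symmetric] algebra_simps)
  then show "\<exists>w\<in>forward_span u. p_small p e (\<lambda>n. bishift (- 1) u n - w n)"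
    using p_small_bishift[OF small, of "-1"] w by metis
qed

section \<open>From closures back to cyclicity, and from the symbol back to its coefficients\<close>

lemma infsum_le_finite_sum_plus:
  fixes f :: "'a \<Rightarrow> real"
  assumes "f summable_on UNIV" "e > 0"
  shows "\<exists>A. finite A \<and> infsum f UNIV \<le> sum f A + e"
proof -
  obtain A where "finite A" "dist (sum f A) (infsum f UNIV) \<le> e"
    using infsum_finite_approximation[OF assms] by blast
  then show ?thesis by (intro exI[of _ A]) (simp add: dist_real_def abs_if split: if_splits)
qed

lemma ell_one_imp_ell:
  assumes "u \<in> ell 1" "p > 1"
  shows "u \<in> ell p"
proof -
  have s: "(\<lambda>n. norm (u n)) summable_on UNIV" using assms by (simp add: ell_def)
  define S where "S = (\<Sum>\<^sub>\<infinity>n. norm (u n))"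
  have le: "norm (u n) \<le> S" for n
    using finite_sum_le_infsum[OF s, of "{n}"] by (simp add: S_def)
  have "(\<lambda>n. S powr (p - 1) * norm (u n)) summable_on UNIV" by (rule summable_on_cmult_right[OF s])
  moreover have "norm (u n) powr p \<le> S powr (p - 1) * norm (u n)" for n
  proof (cases "u n = 0")
    case False
    then have "norm (u n) powr p = norm (u n) powr (p - 1) * norm (u n)"
      by (simp add: powr_diff)
    also have "\<dots> \<le> S powr (p - 1) * norm (u n)"
      using le assms by (intro mult_right_mono powr_mono2) auto
    finally show ?thesis .
  qed simp
  ultimately have "(\<lambda>n. norm (u n) powr p) summable_on UNIV"
    by (rule summable_on_comparison_test) auto
  then show ?thesis by (simp add: ell_def)
qed

definition delta :: "int \<Rightarrow> complex" where
  "delta n = (if n = 0 then 1 else 0)"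

text \<open>Combinations of shifted unit vectors are finite truncations, and the error of truncating
  \<open>v\<close> is a tail of a convergent sum.\<close>

lemma ell_cyclicI:
  assumes p: "1 < p" and u: "u \<in> ell p" and d: "\<And>i. bishift i delta \<in> p_closure p (forward_span u)"
  shows "ell_cyclic p u"
  unfolding ell_cyclic_def
proof (intro conjI u ballI allI impI)
  let ?L = "p_closure p (forward_span u)"
  have p0: "p > 0" using p by simp
  have sub: "seq.subspace ?L" by (rule p_closure_subspace[OF p0 seq.subspace_span])
  fix v and \<epsilon> :: real assume v: "v \<in> ell p" and eps: "0 < \<epsilon>"
  have s: "(\<lambda>n. norm (v n) powr p) summable_on UNIV" using v by (simp add: ell_def)
  have "v \<in> ?L"
  proof (rule p_closure_closed[OF p0])
    fix e :: real assume e: "0 < e"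
    obtain A where A: "finite A" "infsum (\<lambda>n. norm (v n) powr p) UNIV \<le> sum (\<lambda>n. norm (v n) powr p) A + e"
      using infsum_le_finite_sum_plus[OF s e] by blast
    define w where "w = (\<Sum>i\<in>A. seq_scale (v i) (bishift i delta))"
    have w: "w \<in> ?L" unfolding w_def
      by (intro seq.subspace_sum[OF sub] seq.subspace_scale[OF sub] d)
    have wn: "w n = (if n \<in> A then v n else 0)" for n
    proof -
      have "w n = (\<Sum>i\<in>A. seq_scale (v i) (bishift i delta) n)"
        unfolding w_def using A(1) by (induction A rule: finite_induct) auto
      also have "\<dots> = (\<Sum>i\<in>A. if n = i then v i else 0)"
        by (rule sum.cong) (auto simp: seq_scale_def bishift_def delta_def)
      finally show ?thesis using A(1) by simp
    qed
    have "p_small p e (\<lambda>n. v n - w n)"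
      unfolding p_small_def
    proof (intro allI impI)
      fix B :: "int set" assume B: "finite B"
      have "(\<Sum>n\<in>B. norm (v n - w n) powr p) = (\<Sum>n\<in>B - A. norm (v n) powr p)"
        using B by (intro sum.mono_neutral_cong_right) (auto simp: wn)
      also have "\<dots> = (\<Sum>n\<in>B \<union> A. norm (v n) powr p) - (\<Sum>n\<in>A. norm (v n) powr p)"
        using A B sum_diff[of "B \<union> A" A "\<lambda>n. norm (v n) powr p"] by (simp add: Un_Diff)
      also have "\<dots> \<le> e"
        using A finite_sum_le_infsum[OF s, of "B \<union> A"] B by simp
      finally show "(\<Sum>n\<in>B. norm (v n - w n) powr p) \<le> e" .
    qed
    then show "\<exists>w\<in>?L. p_small p e (\<lambda>n. v n - w n)" using w by blast
  qed
  then have "\<forall>e>0. \<exists>w\<in>forward_span u. p_small p e (\<lambda>n. v n - w n)" by (simp add: p_closure_def)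
  moreover have "(\<epsilon> / 2) powr p > 0" using eps by simp
  ultimately obtain w where w: "w \<in> forward_span u" "p_small p ((\<epsilon> / 2) powr p) (\<lambda>n. v n - w n)"
    by blast
  have b: "sum (\<lambda>n. norm (v n - w n) powr p) A \<le> (\<epsilon> / 2) powr p" if "finite A" for A
    using w(2) that by (simp add: p_small_def)
  \<comment> \<open>Summability follows from the bounded finite sums. Only then does
    \<open>ell_norm\<close> of the difference have its intended value instead of the default
    0.\<close>
  then have "(\<lambda>n. norm (v n - w n) powr p) summable_on UNIV"
    by (intro nonneg_bdd_above_summable_on bdd_aboveI2[where M = "(\<epsilon> / 2) powr p"]) auto
  then have "(\<Sum>\<^sub>\<infinity>n. norm (v n - w n) powr p) \<le> (\<epsilon> / 2) powr p"
    using b by (intro infsum_le_finite_sums) auto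
  then have "(\<Sum>\<^sub>\<infinity>n. norm (v n - w n) powr p) powr (1 / p) \<le> ((\<epsilon> / 2) powr p) powr (1 / p)"
    using p by (intro powr_mono2 infsum_nonneg) auto
  also have "\<dots> = \<epsilon> / 2" using p eps by (simp add: powr_powr)
  finally have "ell_norm p (v - w) < \<epsilon>" using eps by (simp add: ell_norm_def)
  then show "\<exists>w\<in>forward_span u. ell_norm p (v - w) < \<epsilon>" using w(1) by blast
qed

text \<open>Finite partial sums approximate the symbol uniformly, with an error given by a tail of
  the l^1 norm, and their coefficients are known exactly.\<close>

lemma coef_fourier:
  assumes u: "u \<in> ell 1" and c: "cper (\<lambda>x. fourier u (cis x))"
  shows "coef (\<lambda>x. fourier u (cis x)) = u"
proof
  fix n
  have s: "(\<lambda>n. norm (u n)) summable_on UNIV" using u by (simp add: ell_def)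
  have "norm (coef (\<lambda>x. fourier u (cis x)) n - u n) \<le> e" if e: "e > 0" for e
  proof -
    obtain A0 where A0: "finite A0" "infsum (\<lambda>n. norm (u n)) UNIV \<le> sum (\<lambda>n. norm (u n)) A0 + e"
      using infsum_le_finite_sum_plus[OF s e] by blast
    \<comment> \<open>With \<open>n\<close> included, the partial sum has precisely
      \<open>u n\<close> as its n-th coefficient.\<close>
    define A where "A = insert n A0"
    have A: "finite A" "n \<in> A" "infsum (\<lambda>n. norm (u n)) UNIV \<le> sum (\<lambda>n. norm (u n)) A + e"
    proof -
      show "finite A" "n \<in> A" using A0 by (auto simp: A_def)
      have "sum (\<lambda>n. norm (u n)) A0 \<le> sum (\<lambda>n. norm (u n)) A"
        using A0 by (intro sum_mono2) (auto simp: A_def)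
      then show "infsum (\<lambda>n. norm (u n)) UNIV \<le> sum (\<lambda>n. norm (u n)) A + e" using A0 by linarith
    qed
    define P where "P x = (\<Sum>k\<in>A. u k * cis (of_int k * x))" for x
    have P: "cper P" unfolding P_def by (intro cper_sum cper_mult cper_const cper_cis)
    have cP: "coef P n = u n"
    proof -
      have "coef P n = (\<Sum>k\<in>A. u k * (if n = k then 1 else 0))"
        unfolding P_def using A by (subst coef_sum) (auto simp: coef_scale coef_cis)
      then show ?thesis using A by (simp add: if_distrib cong: if_cong)
    qed
    have "norm (fourier u (cis x) - P x) \<le> e" for x
    proof -
      define g where "g k = u k * cis x powi k" for k
      have ng: "norm (g k) = norm (u k)" for k by (simp add: g_def norm_mult norm_power_int)
      have sg: "g summable_on UNIV"
        by (rule abs_summable_summable) (simp add: ng s)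
      have "cis x powi k = cis (of_int k * x)" for k by (simp add: cis_power_int)
      then have Pg: "P x = sum g A" by (simp add: P_def g_def)
      have "fourier u (cis x) - P x = infsum g (UNIV - A)"
        unfolding fourier_def g_def[symmetric] Pg
        using infsum_Diff[OF sg, of A] A by (simp add: summable_on_finite)
      also have "norm \<dots> \<le> (\<Sum>\<^sub>\<infinity>k\<in>UNIV - A. norm (g k))"
        by (rule norm_infsum_bound) (rule summable_on_subset[of _ UNIV], auto simp: ng s)
      also have "\<dots> = infsum (\<lambda>k. norm (u k)) UNIV - sum (\<lambda>k. norm (u k)) A"
        unfolding ng using infsum_Diff[OF s, of A] A by (simp add: summable_on_finite)
      also have "\<dots> \<le> e" using A by simp
      finally show ?thesis .
    qed
    then have "norm (coef (\<lambda>x. fourier u (cis x) - P x) n) \<le> e"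
      by (intro norm_coef_le cper_diff c P)
    then show ?thesis by (simp add: coef_diff[OF c P] cP)
  qed
  then have "norm (coef (\<lambda>x. fourier u (cis x)) n - u n) \<le> 0" by (rule field_le_epsilon[of _ 0, simplified]) 
  then show "coef (\<lambda>x. fourier u (cis x)) n = u n" by simp
qed

section \<open>Means of the Herglotz kernel over roots of unity\<close>

lemma sum_roots_of_unity:
  assumes i: "i < N"
  shows "(\<Sum>m<N. cis (- (2 * pi * real m / real N)) ^ i) = (if i = 0 then of_nat N else 0)"
proof (cases "i = 0")
  case False
  define r where "r = cis (- (2 * pi * real i / real N))"
  have N: "N > 0" using i by simp
  have "cis (- (2 * pi * real m / real N)) ^ i = r ^ m" for m
    by (simp add: r_def Complex.DeMoivre mult_ac)
  then have "(\<Sum>m<N. cis (- (2 * pi * real m / real N)) ^ i) = (\<Sum>m<N. r ^ m)" by simp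
  moreover have "r \<noteq> 1"
  proof
    assume "r = 1"
    then have "exp (2 * of_real pi * \<i> * of_nat i / of_nat N) = 1"
      by (simp add: r_def cis_conv_exp exp_minus mult_ac)
    then have "N dvd i" using complex_root_unity_eq_1[of N i] N by simp
    then show False using i False by (auto dest: dvd_imp_le)
  qed
  moreover have "r ^ N = 1"
  proof -
    have "r ^ N = cis (2 * pi * - real i)" using N by (simp add: r_def Complex.DeMoivre)
    also have "\<dots> = 1" by (rule cis_multiple_2pi) auto
    finally show ?thesis .
  qed
  ultimately show ?thesis using False by (simp add: sum_gp_strict)
qed simp

text \<open>With \<open>y m\<close> the quotient of \<open>z\<close> by the m-th pole,
  \<open>y m ^ N\<close> is the same for all \<open>m\<close>. So 1/(1 - y m) is a finite geometric
  sum over a common denominator, and summing over the roots of unity leaves the constant term. In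
  effect N equally spaced poles of radius R act as one pole of radius R^N in the variable
  z^N.\<close>

lemma herglotz_mean:
  assumes N: "N > 0" and z: "norm z < R" and R: "R > 0"
  shows "(\<Sum>m<N. (of_real R * cis (2 * pi * real m / real N) + z) / (of_real R * cis (2 * pi * real m / real N) - z)) =
    of_nat N * ((of_real (R ^ N) + z ^ N) / (of_real (R ^ N) - z ^ N))"
proof -
  define q where "q = z / of_real R"
  have nq: "norm q < 1" using z R by (simp add: q_def norm_divide)
  have "norm q ^ N < 1" using nq N by (simp add: power_less_one_iff)
  then have qN: "q ^ N \<noteq> 1" by (metis norm_one norm_power order_less_irrefl)
  define y where "y m = q * cis (- (2 * pi * real m / real N))" for m
  have yN: "y m ^ N = q ^ N" for m
  proof -
    have "cis (- (2 * pi * real m / real N)) ^ N = cis (2 * pi * - real m)" using N by (simp add: Complex.DeMoivre)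
    also have "\<dots> = 1" by (rule cis_multiple_2pi) auto
    finally show ?thesis by (simp add: y_def power_mult_distrib)
  qed
  have ny: "norm (y m) < 1" for m using nq by (simp add: y_def norm_mult)
  have y1: "y m \<noteq> 1" for m using ny[of m] by auto
  have inv: "1 / (1 - y m) = (\<Sum>i<N. y m ^ i) / (1 - q ^ N)" for m
    unfolding sum_gp_strict using y1[of m] qN yN[of m] by simp
  have trm: "(of_real R * cis (2 * pi * real m / real N) + z) / (of_real R * cis (2 * pi * real m / real N) - z) =
      2 * (1 / (1 - y m)) - 1" for m
  proof -
    define a where "a = of_real R * cis (2 * pi * real m / real N)"
    have a0: "a \<noteq> 0" using R by (simp add: a_def)
    have "z = a * y m"
      using R by (simp add: a_def y_def q_def cis_mult mult_ac flip: cis_inverse)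
    then have "(a + z) / (a - z) = (a * (1 + y m)) / (a * (1 - y m))" by (simp add: algebra_simps)
    also have "\<dots> = (1 + y m) / (1 - y m)" using a0 by simp
    also have "\<dots> = 2 * (1 / (1 - y m)) - 1" using y1[of m] by (simp add: field_simps)
    finally show ?thesis by (simp add: a_def)
  qed
  have "(\<Sum>m<N. \<Sum>i<N. y m ^ i) = (\<Sum>i<N. q ^ i * (\<Sum>m<N. cis (- (2 * pi * real m / real N)) ^ i))"
    by (subst sum.swap) (simp add: y_def power_mult_distrib sum_distrib_left)
  also have "\<dots> = (\<Sum>i<N. q ^ i * (if i = 0 then of_nat N else 0))"
    by (intro sum.cong refl arg_cong2[where f = "(*)"] sum_roots_of_unity) simp
  also have "\<dots> = of_nat N"
    using N by (simp add: if_distrib cong: if_cong)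
  finally have "(\<Sum>m<N. 1 / (1 - y m)) = of_nat N / (1 - q ^ N)"
    unfolding inv by (simp flip: sum_divide_distrib)
  moreover have "(\<Sum>m<N. 2 * (1 / (1 - y m)) - 1) = 2 * (\<Sum>m<N. 1 / (1 - y m)) - of_nat N"
    by (simp add: sum_subtractf sum_distrib_left)
  ultimately have "(\<Sum>m<N. 2 * (1 / (1 - y m)) - 1) = 2 * (of_nat N / (1 - q ^ N)) - of_nat N"
    by (simp only:)
  also have "\<dots> = of_nat N * ((1 + q ^ N) / (1 - q ^ N))"
    using qN by (simp add: field_simps)
  also have "(1 + q ^ N) / (1 - q ^ N) = (of_real (R ^ N) + z ^ N) / (of_real (R ^ N) - z ^ N)"
  proof -
    have z: "z ^ N = of_real (R ^ N) * q ^ N" using R by (simp add: q_def power_divide)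
    have R0: "of_real (R ^ N) \<noteq> (0::complex)" using R by simp
    have "(of_real (R ^ N) + z ^ N) / (of_real (R ^ N) - z ^ N) = (of_real (R ^ N) * (1 + q ^ N)) / (of_real (R ^ N) * (1 - q ^ N))"
      unfolding z by (simp add: algebra_simps)
    then show ?thesis using R0 by simp
  qed
  finally show ?thesis unfolding trm .
qed

lemma norm_dilate_diff:
  fixes w z :: complex
  assumes "norm w = 1" "norm z = 1"
  shows "(norm (of_real R * w - z))\<^sup>2 = (R - 1)\<^sup>2 + R * (norm (w - z))\<^sup>2"
proof -
  have 1: "(Re w)\<^sup>2 + (Im w)\<^sup>2 = 1" "(Re z)\<^sup>2 + (Im z)\<^sup>2 = 1"
    using assms by (simp_all add: cmod_def)
  define c where "c = Re w * Re z + Im w * Im z"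
  have "(norm (of_real R * w - z))\<^sup>2 = R\<^sup>2 * ((Re w)\<^sup>2 + (Im w)\<^sup>2) + ((Re z)\<^sup>2 + (Im z)\<^sup>2) - 2 * R * c"
    unfolding cmod_power2 by (simp add: c_def power2_eq_square algebra_simps)
  moreover have "(norm (w - z))\<^sup>2 = ((Re w)\<^sup>2 + (Im w)\<^sup>2) + ((Re z)\<^sup>2 + (Im z)\<^sup>2) - 2 * c"
    unfolding cmod_power2 by (simp add: c_def power2_eq_square algebra_simps)
  ultimately have nR: "(norm (of_real R * w - z))\<^sup>2 = R\<^sup>2 + 1 - 2 * R * c" and nw: "(norm (w - z))\<^sup>2 = 2 - 2 * c"
    unfolding 1 by simp_all
  show ?thesis unfolding nR nw by (simp add: power2_eq_square algebra_simps)
qed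

lemma dilate_diff_bounds:
  fixes w z :: complex
  assumes "norm w = 1" "norm z = 1" "R \<ge> 1"
  shows "R - 1 \<le> norm (of_real R * w - z)" "norm (w - z) \<le> norm (of_real R * w - z)"
proof -
  have "(R - 1)\<^sup>2 \<le> (norm (of_real R * w - z))\<^sup>2" "(norm (w - z))\<^sup>2 \<le> (norm (of_real R * w - z))\<^sup>2"
    unfolding norm_dilate_diff[OF assms(1,2)] using assms(3) mult_right_mono[of 1 R "(norm (w - z))\<^sup>2"]
    by (auto simp: add_increasing)
  then show "R - 1 \<le> norm (of_real R * w - z)" "norm (w - z) \<le> norm (of_real R * w - z)"
    by (meson norm_ge_zero power2_le_imp_le)+
qed

text \<open>This is the Poisson kernel (|a|^2 - |z|^2) / |a - z|^2 with its pole a = R w outside the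
  disc.\<close>

lemma Re_herglotz:
  fixes w z :: complex
  assumes "norm w = 1" "norm z = 1" "R > 1"
  shows "Re ((of_real R * w + z) / (of_real R * w - z)) = (R\<^sup>2 - 1) / (norm (of_real R * w - z))\<^sup>2"
proof -
  have 1: "(Re w)\<^sup>2 + (Im w)\<^sup>2 = 1" "(Re z)\<^sup>2 + (Im z)\<^sup>2 = 1"
    using assms by (simp_all add: cmod_def)
  define a where "a = of_real R * w"
  have a: "(Re a)\<^sup>2 + (Im a)\<^sup>2 = R\<^sup>2"
    using 1 by (simp add: a_def power_mult_distrib flip: distrib_left)
  have "Re ((a + z) / (a - z)) = (Re (a + z) * Re (a - z) + Im (a + z) * Im (a - z)) / (norm (a - z))\<^sup>2"
    by (simp only: Re_divide cmod_power2)
  also have "Re (a + z) * Re (a - z) + Im (a + z) * Im (a - z) = ((Re a)\<^sup>2 + (Im a)\<^sup>2) - ((Re z)\<^sup>2 + (Im z)\<^sup>2)"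
    by (simp add: power2_eq_square algebra_simps)
  finally show ?thesis unfolding a 1 by (simp add: a_def)
qed

lemma Re_herglotz_nonneg:
  fixes w z :: complex
  assumes "norm w = 1" "norm z = 1" "R > 1"
  shows "0 \<le> Re ((of_real R * w + z) / (of_real R * w - z))"
  unfolding Re_herglotz[OF assms] using assms(3) by (simp add: one_le_power)

text \<open>Positivity allows the sum to be extended to all N nodes, where its value is known.
  Bernoulli's inequality gives R^N \<ge> 2, and (x + 1) / (x - 1) \<le> 3 for such x.\<close>

lemma Re_herglotz_mean_le:
  assumes N: "N > 0" and z: "norm z = 1" and R: "R \<ge> 1 + 1 / real N" and G: "G \<subseteq> {..<N}"
  shows "(\<Sum>m\<in>G. Re ((of_real R * cis (2 * pi * real m / real N) + z) / (of_real R * cis (2 * pi * real m / real N) - z)))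
     \<le> 3 * real N"
proof -
  let ?H = "\<lambda>m. (of_real R * cis (2 * pi * real m / real N) + z) / (of_real R * cis (2 * pi * real m / real N) - z)"
  have R1: "R > 1" using R N by (smt (verit) divide_pos_pos of_nat_0_less_iff)
  have RN: "R ^ N \<ge> 2"
  proof -
    have "1 + real N * (1 / real N) \<le> (1 + 1 / real N) ^ N"
      by (rule Bernoulli_inequality) (use N in \<open>simp add: field_simps\<close>)
    also have "\<dots> \<le> R ^ N" using R N by (intro power_mono) auto
    finally show ?thesis using N by simp
  qed
  have "(\<Sum>m\<in>G. Re (?H m)) \<le> (\<Sum>m<N. Re (?H m))"
    using G z R1 by (intro sum_mono2 Re_herglotz_nonneg) auto
  also have "\<dots> = Re (\<Sum>m<N. ?H m)" by (simp only: Re_sum)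
  also have "(\<Sum>m<N. ?H m) = of_nat N * ((of_real (R ^ N) + z ^ N) / (of_real (R ^ N) - z ^ N))"
    using N z R1 by (intro herglotz_mean) auto
  also have "Re \<dots> = real N * Re ((of_real (R ^ N) + z ^ N) / (of_real (R ^ N) - z ^ N))"
    by (simp only: times_complex.sel complex_Re_of_nat complex_Im_of_nat mult_zero_left diff_zero)
  also have "Re ((of_real (R ^ N) + z ^ N) / (of_real (R ^ N) - z ^ N)) \<le> 3"
  proof -
    have zN: "norm (z ^ N) = 1" using z by (simp add: norm_power)
    have n1: "norm (of_real (R ^ N) + z ^ N) \<le> R ^ N + 1"
      using norm_triangle_ineq[of "of_real (R ^ N)" "z ^ N"] zN RN by (simp del: of_real_power)
    have n2: "R ^ N - 1 \<le> norm (of_real (R ^ N) - z ^ N)"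
      using norm_triangle_ineq2[of "of_real (R ^ N)" "z ^ N"] zN RN by (simp del: of_real_power)
    have "Re ((of_real (R ^ N) + z ^ N) / (of_real (R ^ N) - z ^ N)) \<le> norm (of_real (R ^ N) + z ^ N) / norm (of_real (R ^ N) - z ^ N)"
      using complex_Re_le_cmod by (metis norm_divide)
    also have "\<dots> \<le> (R ^ N + 1) / (R ^ N - 1)" using n1 n2 RN by (intro frac_le) auto
    also have "\<dots> \<le> 3" using RN by (simp add: field_simps)
    finally show ?thesis .
  qed
  finally show ?thesis using N by (simp add: mult_left_mono mult.commute)
qed

text \<open>Seen from a distance of at least D, a pole at height 1/N above the circle has at most
  2/(N D) times the effect of a pole at height D. So the poles are moved out to radius
  \<open>R' = 1 + D\<close>, where the mean bound 3 N applies.\<close>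

lemma Re_herglotz_far_le:
  assumes N: "N > 0" and z: "norm z = 1" and G: "G \<subseteq> {..<N}" and D: "1 / real N \<le> D"
    and far: "\<And>m. m \<in> G \<Longrightarrow> D \<le> norm (cis (2 * pi * real m / real N) - z)"
  shows "(\<Sum>m\<in>G. Re ((of_real (1 + 1 / real N) * cis (2 * pi * real m / real N) + z) /
            (of_real (1 + 1 / real N) * cis (2 * pi * real m / real N) - z)))
     \<le> 6 / D"
proof -
  define R where "R = 1 + 1 / real N"
  define R' where "R' = 1 + D"
  have N1: "0 < 1 / real N" using N by simp
  have D0: "D > 0" using D N1 by linarith
  let ?w = "\<lambda>m. cis (2 * pi * real m / real N)"
  have "(\<Sum>m\<in>G. Re ((of_real R * ?w m + z) / (of_real R * ?w m - z)))
      \<le> (\<Sum>m\<in>G. 2 / (real N * D) * Re ((of_real R' * ?w m + z) / (of_real R' * ?w m - z)))"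
  proof (rule sum_mono)
    fix m assume m: "m \<in> G"
    define y where "y = norm (?w m - z)"
    have y: "D \<le> y" using far[OF m] by (simp add: y_def)
    have y0: "y > 0" using y D0 by linarith
    have R1: "R > 1" "R - 1 = 1 / real N" using N1 by (auto simp: R_def)
    have "(R\<^sup>2 - 1) / ((R - 1)\<^sup>2 + R * y\<^sup>2) \<le> (R\<^sup>2 - 1) / (R * y\<^sup>2)"
      using R1 y0 by (intro divide_left_mono) (auto simp: one_le_power intro!: mult_pos_pos add_nonneg_pos)
    also have "\<dots> = (R - 1) * ((R + 1) / R) / y\<^sup>2"
      using R1 by (simp add: power2_eq_square field_simps)
    also have "\<dots> \<le> (R - 1) * 2 / y\<^sup>2"
      using R1(1) by (intro divide_right_mono mult_left_mono) (auto simp: field_simps)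
    also have "\<dots> = 2 / (real N * D) * (D / y\<^sup>2)"
      using R1 D0 by simp
    also have "\<dots> \<le> 2 / (real N * D) * ((R'\<^sup>2 - 1) / ((R' - 1)\<^sup>2 + R' * y\<^sup>2))"
    proof (rule mult_left_mono)
      have "D\<^sup>2 \<le> y\<^sup>2" using y D0 by (intro power_mono) auto
      then have "D * (D\<^sup>2 + (1 + D) * y\<^sup>2) \<le> D * ((2 + D) * y\<^sup>2)"
        using D0 by (intro mult_left_mono) (auto simp: algebra_simps)
      moreover have "R'\<^sup>2 - 1 = D * (2 + D)" by (simp add: R'_def power2_eq_square algebra_simps)
      moreover have "D\<^sup>2 + (1 + D) * y\<^sup>2 > 0" using D0 by (intro add_pos_nonneg) auto
      ultimately show "D / y\<^sup>2 \<le> (R'\<^sup>2 - 1) / ((R' - 1)\<^sup>2 + R' * y\<^sup>2)"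
        using y0 by (simp add: R'_def divide_simps mult_ac)
    qed (use D0 in simp)
    finally have "(R\<^sup>2 - 1) / ((R - 1)\<^sup>2 + R * y\<^sup>2) \<le> 2 / (real N * D) * ((R'\<^sup>2 - 1) / ((R' - 1)\<^sup>2 + R' * y\<^sup>2))"
      .
    moreover have "Re ((of_real R * ?w m + z) / (of_real R * ?w m - z)) = (R\<^sup>2 - 1) / ((R - 1)\<^sup>2 + R * y\<^sup>2)"
      using Re_herglotz[of "?w m" z R] norm_dilate_diff[of "?w m" z R] z R1 by (simp add: y_def)
    moreover have "Re ((of_real R' * ?w m + z) / (of_real R' * ?w m - z)) = (R'\<^sup>2 - 1) / ((R' - 1)\<^sup>2 + R' * y\<^sup>2)"
      using Re_herglotz[of "?w m" z R'] norm_dilate_diff[of "?w m" z R'] z D0 by (simp add: y_def R'_def)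
    ultimately show "Re ((of_real R * ?w m + z) / (of_real R * ?w m - z))
       \<le> 2 / (real N * D) * Re ((of_real R' * ?w m + z) / (of_real R' * ?w m - z))"
      by (simp only:)
  qed
  also have "\<dots> = 2 / (real N * D) * (\<Sum>m\<in>G. Re ((of_real R' * ?w m + z) / (of_real R' * ?w m - z)))"
    by (simp only: sum_distrib_left)
  also have "\<dots> \<le> 2 / (real N * D) * (3 * real N)"
    using D0 by (intro mult_left_mono Re_herglotz_mean_le N z G) (auto simp: R'_def D)
  also have "\<dots> = 6 / D" using N by simp
  finally show ?thesis by (simp add: R_def)
qed

lemma norm_exp_diff_le:
  fixes a b :: complex
  assumes "Re a \<le> m" "Re b \<le> m"
  shows "norm (exp a - exp b) \<le> exp m * norm (a - b)"
proof -
  have "norm (exp a - exp b) \<le> exp m * norm (a - b)"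
  proof (rule field_differentiable_bound[where S = "{z. Re z \<le> m}" and f' = exp])
    show "convex {z. Re z \<le> m}" by (rule convex_halfspace_Re_le)
    show "(exp has_field_derivative exp z) (at z within {z. Re z \<le> m})" for z :: complex
      by (rule DERIV_exp[THEN has_field_derivative_at_within])
  qed (use assms in auto)
  then show ?thesis .
qed

section \<open>Holomorphic multipliers that are large near the zero set\<close>

lemma sum_powr_half_tail: "(\<Sum>j<J. if n \<le> j then 1 / 2 ^ j else 0) \<le> (2 / 2 ^ n :: real)"
proof -
  \<comment> \<open>The added second term is the tail that is still missing; with it the inequality
    is stable under induction.\<close>
  have "(\<Sum>j<J. if n \<le> j then 1 / 2 ^ j else 0) + (if n \<le> J then 2 / 2 ^ J else 2 / 2 ^ n) \<le> (2 / 2 ^ n :: real)"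
  proof (induction J)
    case (Suc J)
    consider "n \<le> J" | "n = Suc J" | "n > Suc J" by linarith
    then show ?case using Suc by cases auto
  qed auto
  moreover have "0 \<le> (if n \<le> J then 2 / 2 ^ J else 2 / 2 ^ n :: real)" by simp
  ultimately show ?thesis by linarith
qed

text \<open>An abstraction of the distance to the zero set: the construction sees \<open>Z\<close>
  only through a nonnegative function that is at most 2 and 1-Lipschitz on the circle.\<close>

locale circle_gauge =
  fixes d :: "complex \<Rightarrow> real"
  assumes d_nonneg: "0 \<le> d z"
    and d_le_2: "norm z = 1 \<Longrightarrow> d z \<le> 2"
    and d_Lip: "norm z = 1 \<Longrightarrow> norm w = 1 \<Longrightarrow> d z \<le> d w + norm (z - w)"
begin

definition node :: "nat \<Rightarrow> nat \<Rightarrow> complex" where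
  "node j m = cis (2 * pi * real m / real (2 ^ j))"

text \<open>The 8 is dictated by \<open>emeasure_sublevel_le\<close>: the node to the left of a
  point with d < 2^(-j) must qualify, and it is at most 2 pi / 2^j away.\<close>

definition near :: "nat \<Rightarrow> nat set" where
  "near j = {m. m < 2 ^ j \<and> d (node j m) \<le> 8 / 2 ^ j}"

text \<open>The height 2^(-j) above the circle is the spacing of the nodes divided by 2 pi, as
  \<open>Re_herglotz_mean_le\<close> requires with N = 2^j.\<close>

definition pole :: "nat \<Rightarrow> nat \<Rightarrow> complex" where
  "pole j m = of_real (1 + 1 / real (2 ^ j)) * node j m"

text \<open>At a point of the circle, the real part of the \<open>j\<close>-th term is bounded, and it decays
  geometrically in \<open>j\<close> once \<open>2\<^bsup>-j\<^esup>\<close> is below \<open>d z\<close>; so the real part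
  of the sum is at most a multiple of \<open>log (1 / d z)\<close>.\<close>

definition kfun :: "nat \<Rightarrow> complex \<Rightarrow> complex" where
  "kfun J z = (\<Sum>j<J. \<Sum>m\<in>near j. of_real (1 / 2 ^ j) * ((pole j m + z) / (pole j m - z)))"

text \<open>This is \<open>kfun J\<close> at 0. Since the inner sum dominates the measure of the set
  where d < 2^(-j), up to the factor 2 pi, it is also a layer-cake sum for the integral of log
  (1/d).\<close>

definition mass :: "nat \<Rightarrow> real" where
  "mass J = (\<Sum>j<J. \<Sum>m\<in>near j. 1 / 2 ^ j)"

abbreviation pole_sum :: "nat \<Rightarrow> complex \<Rightarrow> real" where
  "pole_sum J z \<equiv> (\<Sum>j<J. \<Sum>m\<in>near j. 1 / 2 ^ j * (1 / (norm (pole j m - z))\<^sup>2))"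

lemma norm_node [simp]: "norm (node j m) = 1"
  by (simp add: node_def)

lemma finite_near [simp]: "finite (near j)"
  by (simp add: near_def)

lemma norm_pole: "norm (pole j m) = 1 + 1 / 2 ^ j"
proof -
  have "0 < 1 + 1 / (2 ^ j :: real)" by (simp add: add_pos_pos)
  then show ?thesis by (simp add: pole_def norm_mult abs_of_pos del: of_real_add)
qed

lemma pole_nz: "pole j m \<noteq> 0"
  using norm_pole[of j m] by (metis add_pos_pos divide_pos_pos less_irrefl norm_zero zero_less_numeral zero_less_one zero_less_power)

lemma kfun_0: "kfun J 0 = of_real (mass J)"
  using pole_nz by (simp add: kfun_def mass_def)

lemma Re_kfun: "Re (kfun J z) = (\<Sum>j<J. (\<Sum>m\<in>near j. Re ((pole j m + z) / (pole j m - z))) / 2 ^ j)"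
proof -
  have "Re (of_real (1 / 2 ^ j) * w) = Re w / 2 ^ j" for w :: complex and j :: nat
    by (simp only: times_complex.sel Re_complex_of_real Im_complex_of_real) simp
  then show ?thesis
    unfolding kfun_def Re_sum sum_divide_distrib by (simp only:)
qed

lemma Re_kfun_le:
  assumes z: "norm z = 1" and dz: "d z > 0"
  shows "Re (kfun J z) \<le> 3 * log 2 (32 / d z) + 2"
proof -
  define T where "T j = (\<Sum>m\<in>near j. Re ((pole j m + z) / (pole j m - z))) / 2 ^ j" for j
  have T3: "T j \<le> 3" for j
  proof -
    have "(\<Sum>m\<in>near j. Re ((pole j m + z) / (pole j m - z))) \<le> 3 * real (2 ^ j)"
      unfolding pole_def node_def
      by (rule Re_herglotz_mean_le) (use z in \<open>auto simp: near_def\<close>)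
    then show ?thesis by (simp add: T_def field_simps)
  qed
  \<comment> \<open>A near node has \<open>d\<close> at most 8 / 2^j \<le> \<open>d z / 2\<close>,
    so it lies at a distance of at least \<open>d z / 2\<close> from \<open>z\<close>. The far
    estimate with \<open>D = d z / 2\<close> then gives 12 / d z.\<close>
  have T12: "T j \<le> 12 / d z * (1 / 2 ^ j)" if j: "16 / d z \<le> 2 ^ j" for j
  proof -
    have dj: "16 / 2 ^ j \<le> d z" using j dz by (simp add: field_simps)
    have "(\<Sum>m\<in>near j. Re ((pole j m + z) / (pole j m - z))) \<le> 6 / (d z / 2)"
      unfolding pole_def node_def
    proof (rule Re_herglotz_far_le)
      have "0 \<le> 1 / (2 ^ j :: real)" by simp
      moreover have "16 * (1 / 2 ^ j) \<le> d z" using dj by (simp only: times_divide_eq_right mult_1_right)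
      ultimately have "1 / 2 ^ j \<le> d z / 2" by linarith
      then show "1 / real (2 ^ j) \<le> d z / 2" by simp
      fix m assume m: "m \<in> near j"
      have "d z \<le> d (node j m) + norm (z - node j m)" by (rule d_Lip) (use z in auto)
      also have "d (node j m) \<le> 8 / 2 ^ j" using m by (simp add: near_def)
      also have "8 / 2 ^ j \<le> d z / 2" using dj by simp
      finally show "d z / 2 \<le> norm (cis (2 * pi * real m / real (2 ^ j)) - z)"
        by (simp add: node_def norm_minus_commute)
    qed (use z in \<open>auto simp: near_def\<close>)
    then have "T j \<le> 6 / (d z / 2) / 2 ^ j" unfolding T_def by (rule divide_right_mono) simp
    then show ?thesis by simp
  qed
  \<comment> \<open>The least index at which the second bound is available. Each earlier term costs
    3, and the geometric tail costs at most 24 / (d z * 2^n) \<le> 3/2.\<close>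
  define n where "n = nat \<lceil>log 2 (16 / d z)\<rceil>"
  have lg: "0 \<le> log 2 (16 / d z)" using dz d_le_2[OF z] by simp
  have n1: "16 / d z \<le> 2 ^ n"
  proof -
    have "log 2 (16 / d z) \<le> real n" unfolding n_def using lg by linarith
    then have "16 / d z \<le> 2 powr real n" using dz by (simp add: log_le_iff)
    then show ?thesis by (simp add: powr_realpow)
  qed
  have n2: "real n \<le> log 2 (32 / d z)"
  proof -
    have "real n \<le> log 2 (16 / d z) + 1" unfolding n_def using lg by linarith
    also have "\<dots> = log 2 (16 / d z * 2)" using dz by (subst log_mult) auto
    finally show ?thesis by simp
  qed
  have "Re (kfun J z) = (\<Sum>j<J. T j)" by (simp add: Re_kfun T_def)
  also have "\<dots> \<le> (\<Sum>j<J. (if j < n then 3 else 0) + 12 / d z * (if n \<le> j then 1 / 2 ^ j else 0))"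
  proof (rule sum_mono)
    fix j
    show "T j \<le> (if j < n then 3 else 0) + 12 / d z * (if n \<le> j then 1 / 2 ^ j else 0)"
    proof (cases "j < n")
      case True then show ?thesis using T3[of j] by simp
    next
      case False
      then have "2 ^ n \<le> (2 ^ j :: real)" by (intro power_increasing) auto
      with n1 have "16 / d z \<le> 2 ^ j" by (rule order_trans)
      then show ?thesis using T12[of j] False by simp
    qed
  qed
  also have "\<dots> = (\<Sum>j<J. if j < n then 3 else 0) + 12 / d z * (\<Sum>j<J. if n \<le> j then 1 / 2 ^ j else 0)"
    by (simp only: sum.distrib sum_distrib_left)
  also have "(\<Sum>j<J. if j < n then 3 else 0) \<le> 3 * real n"
  proof -
    have "(\<Sum>j<J. if j < n then 3 else (0::real)) = (\<Sum>j\<in>{..<J} \<inter> {..<n}. 3)"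
      by (subst sum.inter_restrict) auto
    also have "\<dots> = 3 * real (card ({..<J} \<inter> {..<n}))" by simp
    also have "card ({..<J} \<inter> {..<n}) \<le> card {..<n}" by (intro card_mono) auto
    finally show ?thesis by simp
  qed
  also have "12 / d z * (\<Sum>j<J. if n \<le> j then 1 / 2 ^ j else 0) \<le> 12 / d z * (2 / 2 ^ n)"
    using dz by (intro mult_left_mono sum_powr_half_tail) auto
  also have "\<dots> \<le> 2"
    using n1 dz by (simp add: field_simps)
  finally show ?thesis using n2 by linarith
qed

section \<open>The multiplier and its modulus of continuity\<close>

definition bnd :: "real \<Rightarrow> real" where
  "bnd \<epsilon> = exp \<epsilon> * 32 powr \<epsilon>"

text \<open>The factor ln 2 / 3 converts 3 log 2 (32 / d) from \<open>Re_kfun_le\<close> into ln (32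
  / d), so that before the subtraction of the mass the modulus is at most
  \<open>bnd \<epsilon> * d z powr (- \<epsilon>)\<close>; \<open>bnd\<close> collects the 32 and
  the additive 2.\<close>

definition hfun :: "real \<Rightarrow> nat \<Rightarrow> complex \<Rightarrow> complex" where
  "hfun \<epsilon> J z = exp (of_real (\<epsilon> * ln 2 / 3) * (kfun J z - of_real (mass J)))"

lemma exp_kfun_le:
  assumes z: "norm z = 1" and dz: "d z > 0" and e: "\<epsilon> > 0"
  shows "exp (\<epsilon> * ln 2 / 3 * Re (kfun J z)) \<le> bnd \<epsilon> * d z powr (- \<epsilon>)"
proof -
  have l2: "0 < ln (2::real)" "ln (2::real) \<le> 1" using ln_le_minus_one[of "2::real"] by auto
  have "\<epsilon> * ln 2 / 3 * Re (kfun J z) \<le> \<epsilon> * ln 2 / 3 * (3 * log 2 (32 / d z) + 2)"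
    using Re_kfun_le[OF z dz] e l2 by (intro mult_left_mono) auto
  also have "\<dots> = \<epsilon> * ln (32 / d z) + \<epsilon> * (2 * ln 2 / 3)"
    using l2 by (simp add: log_def field_simps)
  also have "\<dots> \<le> \<epsilon> * ln (32 / d z) + \<epsilon> * 1"
    using l2 e by (intro add_left_mono mult_left_mono) auto
  finally have "exp (\<epsilon> * ln 2 / 3 * Re (kfun J z)) \<le> exp (\<epsilon> * ln (32 / d z)) * exp \<epsilon>"
    by (simp flip: exp_add)
  also have "exp (\<epsilon> * ln (32 / d z)) = (32 / d z) powr \<epsilon>" using dz by (simp add: powr_def)
  also have "\<dots> = 32 powr \<epsilon> * d z powr (- \<epsilon>)" using dz by (simp add: powr_divide powr_minus_divide)
  finally show ?thesis by (simp add: bnd_def mult_ac)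
qed

text \<open>The 9 is 8 + 1: the pole is at least 2^(-j) away from \<open>z\<close>, and its radial
  projection, the node, is at least as close to \<open>z\<close> as the pole.\<close>

lemma pole_far: assumes z: "norm z = 1" and m: "m \<in> near j"
  shows "d z \<le> 9 * norm (pole j m - z)" "norm (node j m - z) \<le> norm (pole j m - z)"
proof -
  have b: "1 / 2 ^ j \<le> norm (pole j m - z)" "norm (node j m - z) \<le> norm (pole j m - z)"
    using dilate_diff_bounds[of "node j m" z "1 + 1 / real (2 ^ j)"] z by (auto simp: pole_def)
  have "d z \<le> d (node j m) + norm (z - node j m)" by (rule d_Lip) (use z in auto)
  also have "d (node j m) \<le> 8 / 2 ^ j" using m by (simp add: near_def)
  finally show "d z \<le> 9 * norm (pole j m - z)" using b by (simp add: norm_minus_commute)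
  show "norm (node j m - z) \<le> norm (pole j m - z)" by (rule b)
qed

text \<open>For one pole a the difference is 2 a (w - z) / ((a - w)(a - z)). By \<open>far\<close>
  the point \<open>w\<close> keeps half of the distance r from \<open>z\<close> to the pole, and |a|
  \<le> 2, whence 2 * 2 * t / (r/2 * r).\<close>

lemma kfun_diff:
  assumes z: "norm z = 1" and w: "norm w = 1" and t: "norm (w - z) \<le> t" "t > 0"
    and far: "\<And>j m. m \<in> near j \<Longrightarrow> 2 * t \<le> norm (pole j m - z)"
  shows "norm (kfun J w - kfun J z) \<le> 8 * t * pole_sum J z"
proof -
  have "kfun J w - kfun J z = (\<Sum>j<J. \<Sum>m\<in>near j. of_real (1 / 2 ^ j) * ((pole j m + w) / (pole j m - w) - (pole j m + z) / (pole j m - z)))"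
    unfolding kfun_def by (simp only: sum_subtractf[symmetric] right_diff_distrib)
  also have "norm \<dots> \<le> (\<Sum>j<J. \<Sum>m\<in>near j. 1 / 2 ^ j * (8 * t * (1 / (norm (pole j m - z))\<^sup>2)))"
  proof (intro sum_norm_le)
    fix j m assume m: "m \<in> near j"
    define a where "a = pole j m"
    define r where "r = norm (a - z)"
    have r: "2 * t \<le> r" "r > 0" using far[OF m] t by (auto simp: a_def r_def)
    have rw: "r / 2 \<le> norm (a - w)"
      using norm_triangle_ineq[of "a - w" "w - z"] t r by (simp add: r_def)
    have a2: "norm a \<le> 2" by (simp add: a_def norm_pole)
    have nz: "a - w \<noteq> 0" "a - z \<noteq> 0" using rw r by (auto simp: r_def)
    then have "(a + w) / (a - w) - (a + z) / (a - z) = 2 * a * (w - z) / ((a - w) * (a - z))"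
      by (simp add: field_simps)
    then have "norm ((a + w) / (a - w) - (a + z) / (a - z)) = 2 * norm a * norm (w - z) / (norm (a - w) * r)"
      by (simp add: norm_mult norm_divide r_def)
    also have "\<dots> \<le> 2 * 2 * t / (r / 2 * r)"
      using a2 t r rw nz by (intro frac_le mult_mono mult_nonneg_nonneg mult_pos_pos) auto
    also have "\<dots> = 8 * t * (1 / r\<^sup>2)" using r by (simp add: power2_eq_square)
    finally have "norm ((a + w) / (a - w) - (a + z) / (a - z)) \<le> 8 * t * (1 / r\<^sup>2)" .
    moreover have "norm (of_real (1 / 2 ^ j) :: complex) = 1 / 2 ^ j"
      by (simp only: norm_of_real) simp
    ultimately show "norm (of_real (1 / 2 ^ j) * ((pole j m + w) / (pole j m - w) - (pole j m + z) / (pole j m - z)))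
        \<le> 1 / 2 ^ j * (8 * t * (1 / (norm (pole j m - z))\<^sup>2))"
      unfolding norm_mult a_def r_def by (intro mult_mono) auto
  qed
  also have "\<dots> = 8 * t * pole_sum J z"
    unfolding sum_distrib_left by (simp only: mult_ac)
  finally show ?thesis .
qed

end

lemma power2_add_le: "(x + y)\<^sup>2 \<le> 2 * x\<^sup>2 + 2 * (y::real)\<^sup>2"
  using zero_le_power2[of "x - y"] by (simp add: power2_sum power2_diff)

context circle_gauge
begin

lemma bnd_pos: "bnd \<epsilon> > 0"
  by (simp add: bnd_def)

definition damp :: "real \<Rightarrow> nat \<Rightarrow> real" where
  "damp \<epsilon> J = exp (- (\<epsilon> * ln 2 / 3 * mass J))"

lemma damp_pos: "damp \<epsilon> J > 0"
  by (simp add: damp_def)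

lemma hfun_eq: "hfun \<epsilon> J z = exp (of_real (\<epsilon> * ln 2 / 3) * kfun J z) * of_real (damp \<epsilon> J)"
proof -
  have "of_real (damp \<epsilon> J) = exp (- (of_real (\<epsilon> * ln 2 / 3) * of_real (mass J)) :: complex)"
    by (simp add: damp_def flip: exp_of_real)
  then show ?thesis by (simp add: hfun_def right_diff_distrib flip: exp_add)
qed

lemma norm_hfun_le:
  assumes "norm z = 1" "d z > 0" "\<epsilon> > 0"
  shows "norm (hfun \<epsilon> J z) \<le> bnd \<epsilon> * d z powr (- \<epsilon>) * damp \<epsilon> J"
proof -
  have "norm (hfun \<epsilon> J z) = exp (\<epsilon> * ln 2 / 3 * Re (kfun J z)) * damp \<epsilon> J"
    unfolding hfun_eq norm_mult norm_exp_eq_Re using damp_pos[of \<epsilon> J] by simp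
  then show ?thesis using exp_kfun_le[OF assms, of J] damp_pos[of \<epsilon> J] by simp
qed

text \<open>What remains of \<open>pole_sum\<close> once the weight d^(2s) is absorbed, see
  \<open>gauge_kern_le\<close>. The summand \<open>t\<close> cuts the singularity off at the scale
  of the increment, in the form integrated by \<open>integral_power_distance\<close>.\<close>

definition kern :: "nat \<Rightarrow> real \<Rightarrow> real \<Rightarrow> complex \<Rightarrow> real" where
  "kern J t a z = (\<Sum>j<J. \<Sum>m\<in>near j. 1 / 2 ^ j * (t + norm (node j m - z)) powr a)"

lemma kern_nonneg: "0 \<le> kern J t a z"
  by (simp add: kern_def sum_nonneg)

text \<open>For points within a multiple of \<open>t\<close> of the zero set no cancellation is
  exploited: the decay d^\<delta> of \<open>f\<close> outweighs the growth d^(-\<epsilon>) of the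
  multiplier. The 19 is 18 + 1, for a point with d \<le> 18 t that has moved by
  \<open>t\<close>.\<close>

lemma weighted_product_le:
  assumes L: "L > 0" and fd: "\<And>z. norm z = 1 \<Longrightarrow> norm (f z) \<le> L * d z powr \<delta>"
    and e: "0 < \<epsilon>" "\<epsilon> < \<delta>" and \<delta>: "\<delta> \<le> 1" and z: "norm z = 1" and t: "0 < t" "d z \<le> 19 * t"
  shows "norm (f z * hfun \<epsilon> J z) \<le> 19 * (L * bnd \<epsilon> * damp \<epsilon> J * t powr (\<delta> - \<epsilon>))"
proof (cases "d z = 0")
  case True
  then have "f z = 0" using fd[OF z] by simp
  then show ?thesis using L bnd_pos[of \<epsilon>] damp_pos[of \<epsilon> J] by simp
next
  case False
  then have dz: "d z > 0" using d_nonneg[of z] by linarith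
  have "norm (f z * hfun \<epsilon> J z) \<le> (L * d z powr \<delta>) * (bnd \<epsilon> * d z powr (- \<epsilon>) * damp \<epsilon> J)"
    unfolding norm_mult using fd[OF z] norm_hfun_le[OF z dz e(1), of J] L by (intro mult_mono) auto
  also have "\<dots> = (L * bnd \<epsilon> * damp \<epsilon> J) * d z powr (\<delta> - \<epsilon>)"
    using dz by (simp add: powr_diff powr_minus_divide)
  also have "\<dots> \<le> (L * bnd \<epsilon> * damp \<epsilon> J) * (19 * t powr (\<delta> - \<epsilon>))"
  proof (rule mult_left_mono)
    have "d z powr (\<delta> - \<epsilon>) \<le> (19 * t) powr (\<delta> - \<epsilon>)" using t e dz by (intro powr_mono2) auto
    also have "\<dots> = 19 powr (\<delta> - \<epsilon>) * t powr (\<delta> - \<epsilon>)" using t by (simp add: powr_mult)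
    also have "\<dots> \<le> 19 * t powr (\<delta> - \<epsilon>)"
      using e \<delta> powr_mono[of "\<delta> - \<epsilon>" 1 19] by (intro mult_right_mono) auto
    finally show "d z powr (\<delta> - \<epsilon>) \<le> 19 * t powr (\<delta> - \<epsilon>)" .
  qed (use L bnd_pos[of \<epsilon>] damp_pos[of \<epsilon> J] in auto)
  finally show ?thesis by (simp add: mult_ac)
qed

text \<open>One factor of the square gets the trivial bound 2 E, the other the mean value bound. The
  result is linear in \<open>pole_sum\<close>, so its integral is controlled by \<open>mass\<close>;
  squaring the mean value bound would give the square of the sum. The hypothesis 18 t < d z gives d
  w \<ge> d z / 2 and, by \<open>pole_far\<close>, poles at distance at least 2 t.\<close>

lemma exp_kfun_diff_sq:
  assumes e: "0 < \<epsilon>" "\<epsilon> \<le> 1"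
    and z: "norm z = 1" and w: "norm w = 1" and t: "norm (w - z) \<le> t" "0 < t" and dz: "18 * t < d z"
  defines "c \<equiv> \<epsilon> * ln 2 / 3"
  shows "(norm (exp (of_real c * kfun J w) - exp (of_real c * kfun J z)))\<^sup>2
    \<le> 64 * (bnd \<epsilon>)\<^sup>2 * d z powr (- 2 * \<epsilon>) * c * t * pole_sum J z"
proof -
  define S where "S = pole_sum J z"
  have c: "c > 0" using e by (simp add: c_def)
  have dz0: "d z > 0" using dz t by linarith
  have dw: "d z / 2 \<le> d w" using d_Lip[OF z w] t dz by (simp add: norm_minus_commute)
  have dw0: "d w > 0" using dw dz0 by linarith
  \<comment> \<open>The factor 2 covers the passage from \<open>w\<close> to \<open>z\<close>, since
    2^\<epsilon> \<le> 2; so \<open>E\<close> bounds both exponentials.\<close>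
  define E where "E = 2 * bnd \<epsilon> * d z powr (- \<epsilon>)"
  have E0: "E > 0" using bnd_pos[of \<epsilon>] dz0 by (simp add: E_def)
  have Ez: "exp (c * Re (kfun J z)) \<le> E"
  proof -
    have "exp (c * Re (kfun J z)) \<le> bnd \<epsilon> * d z powr (- \<epsilon>)"
      unfolding c_def by (rule exp_kfun_le[OF z dz0 e(1)])
    also have "\<dots> \<le> E" using bnd_pos[of \<epsilon>] by (simp add: E_def)
    finally show ?thesis .
  qed
  have Ew: "exp (c * Re (kfun J w)) \<le> E"
  proof -
    have "exp (c * Re (kfun J w)) \<le> bnd \<epsilon> * d w powr (- \<epsilon>)"
      unfolding c_def by (rule exp_kfun_le[OF w dw0 e(1)])
    also have "d w powr (- \<epsilon>) \<le> (d z / 2) powr (- \<epsilon>)"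
      using dw dz0 e by (intro powr_mono2') auto
    also have "(d z / 2) powr (- \<epsilon>) = 2 powr \<epsilon> * d z powr (- \<epsilon>)"
      using dz0 by (simp add: powr_divide powr_minus_divide)
    also have "2 powr \<epsilon> \<le> 2" using e powr_mono[of \<epsilon> 1 2] by simp
    finally show ?thesis using bnd_pos[of \<epsilon>] by (simp add: E_def mult_left_mono mult_right_mono mult_ac)
  qed
  define X where "X = norm (exp (of_real c * kfun J w) - exp (of_real c * kfun J z))"
  have "X \<le> norm (exp (of_real c * kfun J w)) + norm (exp (of_real c * kfun J z))"
    unfolding X_def by (rule norm_triangle_ineq4)
  then have X1: "X \<le> 2 * E" using Ez Ew by simp
  have X2: "X \<le> E * (c * (8 * t * S))"
  proof -
    have "X \<le> exp (ln E) * norm (of_real c * kfun J w - of_real c * kfun J z)"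
      unfolding X_def
      by (rule norm_exp_diff_le) (use Ez Ew E0 in \<open>simp_all add: ln_ge_iff\<close>)
    also have "\<dots> = E * (c * norm (kfun J w - kfun J z))"
      using E0 c by (simp add: norm_mult flip: right_diff_distrib)
    also have "norm (kfun J w - kfun J z) \<le> 8 * t * S"
      unfolding S_def
    proof (rule kfun_diff[OF z w t])
      fix j m assume m: "m \<in> near j"
      show "2 * t \<le> norm (pole j m - z)" using pole_far(1)[OF z m] dz by linarith
    qed
    finally show ?thesis using E0 c by (simp add: mult_left_mono)
  qed
  have "X\<^sup>2 \<le> (2 * E) * (E * (c * (8 * t * S)))"
    unfolding power2_eq_square by (rule mult_mono[OF X1 X2]) (use E0 in \<open>auto simp: X_def\<close>)
  also have "\<dots> = 16 * (E * E) * c * t * S" by simp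
  also have "E * E = 4 * (bnd \<epsilon>)\<^sup>2 * d z powr (- 2 * \<epsilon>)"
  proof -
    have "d z powr (- \<epsilon>) * d z powr (- \<epsilon>) = d z powr (- 2 * \<epsilon>)" by (simp flip: powr_add)
    then show ?thesis by (simp add: E_def power2_eq_square)
  qed
  also have "16 * (4 * (bnd \<epsilon>)\<^sup>2 * d z powr (- 2 * \<epsilon>)) * c * t * S = 64 * (bnd \<epsilon>)\<^sup>2 * d z powr (- 2 * \<epsilon>) * c * t * S"
    by simp
  finally show ?thesis unfolding X_def S_def .
qed

text \<open>With r the distance to the pole, d z \<le> 9 r turns the weight into 9 r^(2s). Then r
  \<ge> 2 t and r \<ge> |node - z| give r \<ge> (t + |node - z|) / 2, and halving the base costs at
  most 4, as the exponent is at least -2; 36 = 9 * 4.\<close>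

lemma gauge_kern_le:
  assumes s: "0 < s" "2 * s < 1" and z: "norm z = 1" and t: "0 < t" and dz: "18 * t < d z"
  shows "d z powr (2 * s) * pole_sum J z \<le> 36 * kern J t (2 * s - 2) z"
proof -
  have "d z powr (2 * s) * (1 / 2 ^ j * (1 / (norm (pole j m - z))\<^sup>2)) \<le> 36 * (1 / 2 ^ j * (t + norm (node j m - z)) powr (2 * s - 2))"
    if m: "m \<in> near j" for j m
  proof -
    define r where "r = norm (pole j m - z)"
    have r: "d z \<le> 9 * r" "norm (node j m - z) \<le> r" using pole_far[OF z m] by (auto simp: r_def)
    have r0: "r > 0" "2 * t \<le> r" using r dz t by linarith+
    have "d z powr (2 * s) \<le> (9 * r) powr (2 * s)" using r d_nonneg s by (intro powr_mono2) auto
    also have "\<dots> = 9 powr (2 * s) * r powr (2 * s)" using r0 by (simp add: powr_mult)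
    also have "\<dots> \<le> 9 * r powr (2 * s)" using s powr_mono[of "2 * s" 1 9] by (intro mult_right_mono) auto
    finally have "d z powr (2 * s) * (1 / r\<^sup>2) \<le> 9 * r powr (2 * s) * (1 / r\<^sup>2)" by (rule mult_right_mono) simp
    also have "\<dots> = 9 * r powr (2 * s - 2)" using r0 by (simp add: powr_diff)
    also have "r powr (2 * s - 2) \<le> ((t + norm (node j m - z)) / 2) powr (2 * s - 2)"
      using r0 r t s by (intro powr_mono2') (auto intro: add_pos_nonneg)
    also have "\<dots> = (1 / 2) powr (2 * s - 2) * (t + norm (node j m - z)) powr (2 * s - 2)"
      using t by (simp add: powr_mult[symmetric] field_simps)
    also have "(1 / 2) powr (2 * s - 2) \<le> (1 / 2) powr (- 2 :: real)" using s by (intro powr_mono') auto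
    also have "(1 / 2) powr (- 2 :: real) = 4" by (simp add: powr_minus powr_numeral power2_eq_square)
    finally have "d z powr (2 * s) * (1 / r\<^sup>2) \<le> 36 * (t + norm (node j m - z)) powr (2 * s - 2)"
      by (simp add: mult_right_mono)
    then have "1 / 2 ^ j * (d z powr (2 * s) * (1 / r\<^sup>2)) \<le> 1 / 2 ^ j * (36 * (t + norm (node j m - z)) powr (2 * s - 2))"
      by (rule mult_left_mono) simp
    then show ?thesis by (simp only: r_def mult_ac)
  qed
  then show ?thesis unfolding kern_def sum_distrib_left by (intro sum_mono) auto
qed

text \<open>At distance comparable to \<open>t\<close> from the zero set both values are small.
  Further away the product difference is split; in the second part |f w|^2 contributes
  d^(2\<delta>), which with d^(- 2\<epsilon>) from the exponentials is the weight d^(2s) of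
  \<open>gauge_kern_le\<close>. The constant rounds up 2 * 4 * 64 * 36 = 18432.\<close>

lemma modulus_pointwise:
  fixes J :: nat
  assumes L: "L > 0" and fd: "\<And>z. norm z = 1 \<Longrightarrow> norm (f z) \<le> L * d z powr \<delta>"
    and fL: "\<And>z w. norm z = 1 \<Longrightarrow> norm w = 1 \<Longrightarrow> norm (f z - f w) \<le> L * norm (z - w) powr \<delta>"
    and e: "0 < \<epsilon>" "\<epsilon> < \<delta>" and \<delta>: "2 * \<delta> < 1"
    and z: "norm z = 1" and w: "norm w = 1" and t: "norm (w - z) \<le> t" "0 < t"
  defines "s \<equiv> \<delta> - \<epsilon>" and "Q \<equiv> L * bnd \<epsilon> * damp \<epsilon> J"
  shows "(norm (f w * hfun \<epsilon> J w - f z * hfun \<epsilon> J z))\<^sup>2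
     \<le> 20000 * Q\<^sup>2 * (t powr (2 * s) + t * (\<epsilon> * ln 2 / 3) * kern J t (2 * s - 2) z)"
proof -
  define c where "c = \<epsilon> * ln 2 / 3"
  have c: "c > 0" using e by (simp add: c_def)
  have Q: "Q > 0" using L bnd_pos[of \<epsilon>] damp_pos[of \<epsilon> J] by (simp add: Q_def)
  have s: "0 < s" "2 * s < 1" using e \<delta> by (auto simp: s_def)
  have ts: "(t powr s)\<^sup>2 = t powr (2 * s)" using powr_powr[of t s 2] t by (simp add: mult.commute)
  have K0: "0 \<le> t * c * kern J t (2 * s - 2) z" using t c kern_nonneg by simp
  show ?thesis
  proof (cases "d z \<le> 18 * t")
    case True
    have dw: "d w \<le> 19 * t" using d_Lip[OF w z] t True by simp
    have "norm (f w * hfun \<epsilon> J w - f z * hfun \<epsilon> J z) \<le> norm (f w * hfun \<epsilon> J w) + norm (f z * hfun \<epsilon> J z)"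
      by (rule norm_triangle_ineq4)
    also have "\<dots> \<le> 19 * (Q * t powr s) + 19 * (Q * t powr s)"
      unfolding Q_def s_def using L fd e \<delta> z w t True dw by (intro add_mono weighted_product_le) auto
    finally have "(norm (f w * hfun \<epsilon> J w - f z * hfun \<epsilon> J z))\<^sup>2 \<le> (38 * (Q * t powr s))\<^sup>2"
      by (intro power_mono) auto
    also have "\<dots> = 1444 * (Q\<^sup>2 * t powr (2 * s))" by (simp add: power_mult_distrib ts)
    also have "\<dots> \<le> 20000 * (Q\<^sup>2 * (t powr (2 * s) + t * c * kern J t (2 * s - 2) z))"
      using K0 Q by (intro mult_mono mult_left_mono) auto
    finally show ?thesis by (simp add: c_def mult.assoc)
  next
    case False
    then have dz: "18 * t < d z" by simp
    have dz0: "d z > 0" using dz t by linarith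
    have dw: "d w \<le> 2 * d z" using d_Lip[OF w z] t dz by simp
    define X where "X = norm (exp (of_real c * kfun J w) - exp (of_real c * kfun J z))"
    have e1: "norm (f w - f z) * norm (hfun \<epsilon> J z) \<le> Q * t powr s"
    proof -
      have "norm (f w - f z) \<le> L * t powr \<delta>"
      proof -
        have "norm (w - z) powr \<delta> \<le> t powr \<delta>" using t e by (intro powr_mono2) auto
        then show ?thesis using fL[OF w z] L by (meson less_imp_le mult_left_mono order_trans)
      qed
      moreover have "norm (hfun \<epsilon> J z) \<le> bnd \<epsilon> * t powr (- \<epsilon>) * damp \<epsilon> J"
      proof -
        have "d z powr (- \<epsilon>) \<le> t powr (- \<epsilon>)" using dz t e by (intro powr_mono2') auto
        then have "bnd \<epsilon> * d z powr (- \<epsilon>) * damp \<epsilon> J \<le> bnd \<epsilon> * t powr (- \<epsilon>) * damp \<epsilon> J"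
          using bnd_pos[of \<epsilon>] damp_pos[of \<epsilon> J] by (intro mult_right_mono mult_left_mono) auto
        then show ?thesis using norm_hfun_le[OF z dz0 e(1), of J] by linarith
      qed
      ultimately have "norm (f w - f z) * norm (hfun \<epsilon> J z) \<le> (L * t powr \<delta>) * (bnd \<epsilon> * t powr (- \<epsilon>) * damp \<epsilon> J)"
        using L by (intro mult_mono) auto
      also have "\<dots> = Q * t powr s" using t by (simp add: Q_def s_def powr_diff powr_minus_divide)
      finally show ?thesis .
    qed
    have e2: "(norm (f w) * norm (hfun \<epsilon> J w - hfun \<epsilon> J z))\<^sup>2 \<le> 9216 * (Q\<^sup>2 * (t * c * kern J t (2 * s - 2) z))"
    proof -
      define S where "S = pole_sum J z"
      have hX: "norm (hfun \<epsilon> J w - hfun \<epsilon> J z) = X * damp \<epsilon> J"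
        unfolding hfun_eq left_diff_distrib[symmetric] norm_mult X_def c_def using damp_pos[of \<epsilon> J] by simp
      have fw: "norm (f w) \<le> 2 * L * d z powr \<delta>"
      proof -
        have "d w powr \<delta> \<le> (2 * d z) powr \<delta>" using dw d_nonneg e by (intro powr_mono2) auto
        also have "\<dots> = 2 powr \<delta> * d z powr \<delta>" using dz0 by (simp add: powr_mult)
        also have "\<dots> \<le> 2 * d z powr \<delta>" using \<delta> powr_mono[of \<delta> 1 2] by (intro mult_right_mono) auto
        finally have "L * d w powr \<delta> \<le> L * (2 * d z powr \<delta>)" using L by (intro mult_left_mono) auto
        then show ?thesis using fd[OF w] by simp
      qed
      have "(norm (f w) * norm (hfun \<epsilon> J w - hfun \<epsilon> J z))\<^sup>2 = (norm (f w))\<^sup>2 * X\<^sup>2 * (damp \<epsilon> J)\<^sup>2"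
        by (simp add: hX power_mult_distrib)
      also have "\<dots> \<le> (2 * L * d z powr \<delta>)\<^sup>2 * (64 * (bnd \<epsilon>)\<^sup>2 * d z powr (- 2 * \<epsilon>) * c * t * S) * (damp \<epsilon> J)\<^sup>2"
        using exp_kfun_diff_sq[OF e(1) _ z w t dz, of J] e \<delta> fw
        by (intro mult_right_mono mult_mono power_mono) (auto simp: X_def c_def S_def)
      also have "\<dots> = 256 * (Q\<^sup>2 * (c * t * (((d z powr \<delta>)\<^sup>2 * d z powr (- 2 * \<epsilon>)) * S)))"
        by (simp only: Q_def power_mult_distrib) simp
      also have "(d z powr \<delta>)\<^sup>2 * d z powr (- 2 * \<epsilon>) = d z powr (2 * s)"
      proof -
        have "(d z powr \<delta>)\<^sup>2 = d z powr (2 * \<delta>)" using powr_powr[of "d z" \<delta> 2] dz0 by (simp add: mult.commute)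
        moreover have "2 * \<delta> + - 2 * \<epsilon> = 2 * s" by (simp add: s_def)
        ultimately show ?thesis by (simp only: powr_add[symmetric])
      qed
      also have "256 * (Q\<^sup>2 * (c * t * (d z powr (2 * s) * S))) \<le> 256 * (Q\<^sup>2 * (c * t * (36 * kern J t (2 * s - 2) z)))"
        using gauge_kern_le[OF s z t(2) dz, of J] c t by (intro mult_left_mono) (auto simp: S_def)
      finally show ?thesis by (simp add: mult_ac)
    qed
    have "f w * hfun \<epsilon> J w - f z * hfun \<epsilon> J z = (f w - f z) * hfun \<epsilon> J z + f w * (hfun \<epsilon> J w - hfun \<epsilon> J z)"
      by (simp add: algebra_simps)
    then have "norm (f w * hfun \<epsilon> J w - f z * hfun \<epsilon> J z) \<le> norm (f w - f z) * norm (hfun \<epsilon> J z) + norm (f w) * norm (hfun \<epsilon> J w - hfun \<epsilon> J z)"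
      by (metis norm_mult norm_triangle_ineq)
    then have "(norm (f w * hfun \<epsilon> J w - f z * hfun \<epsilon> J z))\<^sup>2 \<le> (norm (f w - f z) * norm (hfun \<epsilon> J z) + norm (f w) * norm (hfun \<epsilon> J w - hfun \<epsilon> J z))\<^sup>2"
      by (intro power_mono) auto
    also have "\<dots> \<le> 2 * (norm (f w - f z) * norm (hfun \<epsilon> J z))\<^sup>2 + 2 * (norm (f w) * norm (hfun \<epsilon> J w - hfun \<epsilon> J z))\<^sup>2"
      by (rule power2_add_le)
    also have "\<dots> \<le> 2 * (Q * t powr s)\<^sup>2 + 2 * (9216 * (Q\<^sup>2 * (t * c * kern J t (2 * s - 2) z)))"
      using e1 e2 by (intro add_mono mult_left_mono power_mono) auto
    also have "\<dots> = 2 * (Q\<^sup>2 * t powr (2 * s)) + 18432 * (Q\<^sup>2 * (t * c * kern J t (2 * s - 2) z))"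
      by (simp add: power_mult_distrib ts)
    also have "\<dots> \<le> 20000 * (Q\<^sup>2 * t powr (2 * s)) + 20000 * (Q\<^sup>2 * (t * c * kern J t (2 * s - 2) z))"
      using K0 Q by (intro add_mono mult_right_mono) auto
    also have "\<dots> = 20000 * Q\<^sup>2 * (t powr (2 * s) + t * c * kern J t (2 * s - 2) z)"
      by (simp add: algebra_simps)
    finally show ?thesis by (simp add: c_def)
  qed
qed

lemma hfun_0: "hfun \<epsilon> J 0 = 1"
  by (simp add: hfun_def kfun_0)

lemma hfun_holomorphic: "hfun \<epsilon> J holomorphic_on ball 0 (1 + 1 / 2 ^ J)"
proof -
  have "pole j m - z \<noteq> 0" if "z \<in> ball 0 (1 + 1 / 2 ^ J)" "j < J" for j m z
  proof
    assume "pole j m - z = 0"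
    then have "norm z = 1 + 1 / 2 ^ j" using norm_pole[of j m] by simp
    moreover have "1 / 2 ^ J \<le> (1 / 2 ^ j :: real)"
      using that(2) by (intro divide_left_mono power_increasing) auto
    ultimately show False using that(1) by simp
  qed
  then have "kfun J holomorphic_on ball 0 (1 + 1 / 2 ^ J)"
    unfolding kfun_def by (intro holomorphic_intros) auto
  then show ?thesis unfolding hfun_def by (intro holomorphic_intros) auto
qed

lemma continuous_hfun: "continuous_on circle (hfun \<epsilon> J)"
  by (rule continuous_on_subset[OF holomorphic_on_imp_continuous_on[OF hfun_holomorphic]]) auto

text \<open>Every node contributes the same bound whatever its position, so only the total weight
  \<open>mass J\<close> is left.\<close>

lemma integral_kern_le:
  assumes C: "\<And>w. w \<in> circle \<Longrightarrow> pint (\<lambda>x. (t + norm (w - cis x)) powr a) \<le> C * t powr (a + 1)"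
    and t: "0 < t"
  shows "cper (\<lambda>x. kern J t a (cis x))" "pint (\<lambda>x. kern J t a (cis x)) \<le> mass J * (C * t powr (a + 1))"
proof -
  have per: "cper (\<lambda>x. (t + norm (w - cis x)) powr a)" for w
  proof (rule cper_compose_cis[of "\<lambda>z. (t + norm (w - z)) powr a"])
    have "t + norm (w - z) \<noteq> 0" for z :: complex using t by (smt (verit) norm_ge_zero)
    then show "continuous_on circle (\<lambda>z. (t + norm (w - z)) powr a)"
      by (intro continuous_intros) auto
  qed
  show "cper (\<lambda>x. kern J t a (cis x))" unfolding kern_def by (intro cper_sum cper_mult cper_const per)
  have i: "(\<lambda>x. 1 / 2 ^ j * (t + norm (node j m - cis x)) powr a) integrable_on {0..2 * pi}" for j m
    by (intro cper_integrable cper_mult cper_const per)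
  have "pint (\<lambda>x. kern J t a (cis x)) = (\<Sum>j<J. \<Sum>m\<in>near j. 1 / 2 ^ j * pint (\<lambda>x. (t + norm (node j m - cis x)) powr a))"
  proof -
    have 1: "pint (\<lambda>x. \<Sum>m\<in>near j. 1 / 2 ^ j * (t + norm (node j m - cis x)) powr a) =
        (\<Sum>m\<in>near j. 1 / 2 ^ j * pint (\<lambda>x. (t + norm (node j m - cis x)) powr a))" for j
      by (subst hk_integral_sum[OF finite_near i]) simp
    have "pint (\<lambda>x. kern J t a (cis x)) =
       (\<Sum>j<J. pint (\<lambda>x. \<Sum>m\<in>near j. 1 / 2 ^ j * (t + norm (node j m - cis x)) powr a))"
      unfolding kern_def
      by (rule hk_integral_sum) (intro finite_lessThan integrable_sum finite_near i)+
    then show ?thesis unfolding 1 .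
  qed
  also have "\<dots> \<le> (\<Sum>j<J. \<Sum>m\<in>near j. 1 / 2 ^ j * (C * t powr (a + 1)))"
    by (intro sum_mono mult_left_mono C) auto
  also have "\<dots> = mass J * (C * t powr (a + 1))"
    by (simp only: mass_def sum_distrib_right)
  finally show "pint (\<lambda>x. kern J t a (cis x)) \<le> mass J * (C * t powr (a + 1))" .
qed

text \<open>First \<epsilon> is fixed as half the gap between \<delta> and the critical exponent,
  which leaves s = \<delta> - \<epsilon> in the middle; afterwards only \<open>J\<close> varies.
  With y = c * mass J the squared modulus grows linearly in y, while the squared damping is exp (- 2
  y).\<close>

lemma hfun_small:
  assumes p: "1 < p" "p < 2" and \<delta>: "1 / p - 1 / 2 < \<delta>" "2 * \<delta> < 1"
    and L: "L > 0" and fd: "\<And>z. norm z = 1 \<Longrightarrow> norm (f z) \<le> L * d z powr \<delta>"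
    and fL: "\<And>z w. norm z = 1 \<Longrightarrow> norm w = 1 \<Longrightarrow> norm (f z - f w) \<le> L * norm (z - w) powr \<delta>"
    and fc: "continuous_on circle f"
    and unb: "\<And>M. \<exists>J. M \<le> mass J" and e: "e > 0"
  shows "\<exists>\<epsilon> J. p_small p e (coef (\<lambda>x. f (cis x) * hfun \<epsilon> J (cis x)))"
proof -
  define \<epsilon> where "\<epsilon> = (\<delta> - (1 / p - 1 / 2)) / 2"
  define s where "s = \<delta> - \<epsilon>"
  note s0 = critical_exponent_pos[OF p]
  have eps: "0 < \<epsilon>" "\<epsilon> < \<delta>" using \<delta> s0 by (auto simp: \<epsilon>_def)
  have s_eq: "s = (\<delta> + (1 / p - 1 / 2)) / 2" by (simp add: s_def \<epsilon>_def field_simps)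
  have "q < (\<delta> + q) / 2" if "q < \<delta>" for q :: real using that by simp
  from this[OF \<delta>(1)] have s: "1 / p - 1 / 2 < s" by (simp only: s_eq)
  have s2: "2 * s < 1" using \<delta> eps by (simp add: s_def)
  define c where "c = \<epsilon> * ln 2 / 3"
  have c: "c > 0" using eps by (simp add: c_def)
  from coef_p_small_eps[OF p s e] obtain B where B: "B > 0" and
    small: "\<forall>F. L2_modulus s B F \<longrightarrow> p_small p e (coef F)"
    by (elim exE conjE)
  have "2 * s - 2 < -1" using s2 by simp
  from integral_power_distance[OF this] obtain C where C: "C > 0" and
    CI: "\<forall>t>0. \<forall>w\<in>circle. pint (\<lambda>x. (t + norm (w - cis x)) powr (2 * s - 2)) \<le> C * t powr (2 * s - 2 + 1)"
    by (elim exE conjE)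
  define A where "A = 20000 * (L * bnd \<epsilon>)\<^sup>2"
  have A: "A > 0" using L bnd_pos[of \<epsilon>] by (simp add: A_def)
  obtain J where J: "A * (2 * pi + C) / B / c \<le> mass J" using unb by blast
  define y where "y = c * mass J"
  have y: "A * (2 * pi + C) / B \<le> y" using J unfolding y_def pos_divide_le_eq[OF c] by (simp only: mult.commute)
  moreover have "A * (2 * pi + C) / B > 0" using A C B by (auto intro!: divide_pos_pos mult_pos_pos add_pos_pos)
  ultimately have y0: "y > 0" by linarith
  define Q where "Q = L * bnd \<epsilon> * damp \<epsilon> J"
  have Q: "Q > 0" using L bnd_pos[of \<epsilon>] damp_pos[of \<epsilon> J] by (simp add: Q_def)
  \<comment> \<open>One factor exp (- y) absorbs 2 pi + C y; the other is at most 1/y, and the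
    choice of \<open>J\<close> makes y large enough for \<open>B\<close>.\<close>
  have main: "20000 * Q\<^sup>2 * (2 * pi + C * y) \<le> B"
  proof -
    have d: "(damp \<epsilon> J)\<^sup>2 = exp (- y) * exp (- y)"
      by (simp add: damp_def y_def c_def power2_eq_square)
    have ey: "1 \<le> exp y" "y \<le> exp y" using y0 exp_ge_add_one_self[of y] by (simp, linarith)
    have "2 * pi + C * y \<le> 2 * pi * exp y + C * exp y"
      using ey C by (intro add_mono mult_left_mono) auto
    then have "exp (- y) * (2 * pi + C * y) \<le> exp (- y) * ((2 * pi + C) * exp y)"
      by (intro mult_left_mono) (auto simp: algebra_simps)
    also have "\<dots> = 2 * pi + C" by (simp add: exp_minus field_simps)
    finally have 1: "exp (- y) * (2 * pi + C * y) \<le> 2 * pi + C" .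
    have "20000 * Q\<^sup>2 * (2 * pi + C * y) = A * exp (- y) * (exp (- y) * (2 * pi + C * y))"
      by (simp add: Q_def A_def power_mult_distrib d)
    also have "\<dots> \<le> A * exp (- y) * (2 * pi + C)" using 1 A by (intro mult_left_mono) auto
    also have "\<dots> = (A * (2 * pi + C)) * exp (- y)" by simp
    also have "\<dots> \<le> (y * B) * exp (- y)" using y B by (intro mult_right_mono) (auto simp: field_simps)
    also have "\<dots> \<le> (exp y * B) * exp (- y)" using ey B by (intro mult_right_mono) auto
    also have "\<dots> = B" by (simp add: exp_minus field_simps)
    finally show ?thesis .
  qed
  define F where "F x = f (cis x) * hfun \<epsilon> J (cis x)" for x
  have F: "cper F" unfolding F_def by (intro cper_mult cper_compose_cis fc continuous_hfun)
  have "p_small p e (coef F)"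
  proof (rule small[rule_format, OF L2_modulusI[OF F]])
    have "norm (F x) \<le> 19 * Q" for x
    proof -
      \<comment> \<open>The near-zero estimate at t = 1 holds on the whole circle, since d \<le>
        2.\<close>
      have "norm (F x) \<le> 19 * (L * bnd \<epsilon> * damp \<epsilon> J * 1 powr (\<delta> - \<epsilon>))"
        unfolding F_def
        by (rule weighted_product_le[OF L fd eps]) (use \<delta> eps d_le_2[of "cis x"] in auto)
      then show ?thesis by (simp add: Q_def)
    qed
    from integral_square_le[OF F this] have "pint (\<lambda>x. (norm (F x))\<^sup>2) \<le> 2 * pi * (19 * Q)\<^sup>2" .
    also have "\<dots> = 361 * Q\<^sup>2 * (2 * pi)" by (simp add: power_mult_distrib)
    also have "\<dots> \<le> 20000 * Q\<^sup>2 * (2 * pi + C * y)"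
      using C y0 Q by (intro mult_mono mult_right_mono) auto
    finally show "pint (\<lambda>x. (norm (F x))\<^sup>2) \<le> B" using main by linarith
  next
    fix t :: real assume t: "0 < t" "t \<le> 1"
    note kI = integral_kern_le[OF CI[rule_format, OF t(1)] t(1), where J = J]
    have "pint (\<lambda>x. (norm (F (x + t) - F x))\<^sup>2)
       \<le> pint (\<lambda>x. 20000 * Q\<^sup>2 * (t powr (2 * s) + t * c * kern J t (2 * s - 2) (cis x)))"
    proof (rule integral_le)
      fix x
      have "norm (cis (x + t) - cis x) \<le> t" using norm_cis_diff_le[of "x + t" x] t by simp
      then show "(norm (F (x + t) - F x))\<^sup>2 \<le> 20000 * Q\<^sup>2 * (t powr (2 * s) + t * c * kern J t (2 * s - 2) (cis x))"
        unfolding F_def Q_def s_def c_def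
        by (intro modulus_pointwise[OF L fd fL eps \<delta>(2)]) (use t in auto)
    next
      show "(\<lambda>x. (norm (F (x + t) - F x))\<^sup>2) integrable_on {0..2 * pi}"
        by (intro cper_integrable cper_power cper_norm cper_diff cper_shift[OF F] F)
      show "(\<lambda>x. 20000 * Q\<^sup>2 * (t powr (2 * s) + t * c * kern J t (2 * s - 2) (cis x))) integrable_on {0..2 * pi}"
        by (intro cper_integrable cper_mult cper_add cper_const kI(1))
    qed
    also have "\<dots> = 20000 * Q\<^sup>2 * (2 * pi * t powr (2 * s) + t * c * pint (\<lambda>x. kern J t (2 * s - 2) (cis x)))"
    proof -
      have "pint (\<lambda>x. t powr (2 * s) + t * c * kern J t (2 * s - 2) (cis x)) =
          pint (\<lambda>x. t powr (2 * s)) + pint (\<lambda>x. t * c * kern J t (2 * s - 2) (cis x))"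
        by (rule hk_integral_add) (intro cper_integrable cper_mult cper_const kI(1))+
      then show ?thesis by simp
    qed
    also have "\<dots> \<le> 20000 * Q\<^sup>2 * (2 * pi * t powr (2 * s) + t * c * (mass J * (C * t powr (2 * s - 2 + 1))))"
      using kI(2) t c Q by (intro mult_left_mono add_left_mono) auto
    also have "t * c * (mass J * (C * t powr (2 * s - 2 + 1))) = C * y * t powr (2 * s)"
    proof -
      have "t * t powr (2 * s - 2 + 1) = t powr (2 * s)"
        using t powr_add[of t 1 "2 * s - 2 + 1"] by simp
      then have "C * y * t powr (2 * s) = C * (c * mass J) * (t * t powr (2 * s - 2 + 1))" by (simp only: y_def)
      then show ?thesis by (simp only: mult_ac)
    qed
    also have "20000 * Q\<^sup>2 * (2 * pi * t powr (2 * s) + C * y * t powr (2 * s)) = 20000 * Q\<^sup>2 * (2 * pi + C * y) * t powr (2 * s)"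
      by (simp add: algebra_simps)
    also have "\<dots> \<le> B * t powr (2 * s)" using main by (intro mult_right_mono) auto
    finally show "pint (\<lambda>x. (norm (F (x + t) - F x))\<^sup>2) \<le> B * t powr (2 * s)" .
  qed
  then show ?thesis unfolding F_def by blast
qed

end

text \<open>The multiplier has to be replaced by a polynomial, since only finitely many shifts may occur.\<close>

lemma polynomial_truncation:
  fixes h f :: "complex \<Rightarrow> complex"
  assumes hol: "h holomorphic_on ball 0 R" and R: "R > 1"
    and p: "1 < p" "p < 2" and \<delta>: "1 / p - 1 / 2 < \<delta>" "\<delta> \<le> 1" and f: "f \<in> Lip \<delta>" and e: "e > 0"
    and small: "p_small p e (coef (\<lambda>x. f (cis x) * h (cis x)))"
  shows "\<exists>a K. a 0 = h 0 \<and> p_small p (2 powr p * (e + e)) (coef (\<lambda>x. f (cis x) * (\<Sum>k\<le>K::nat. a k * cis x ^ k)))"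
proof -
  have d0: "\<delta> > 0"
    using critical_exponent_pos[OF p] \<delta> by linarith
  define a where "a n = (deriv ^^ n) h 0 / fact n" for n
  have sums: "(\<lambda>n. a n * z ^ n) sums h z" if "norm z < R" for z
    using holomorphic_power_series[OF hol, of z] that by (simp add: a_def)
  \<comment> \<open>Convergence at a point beyond the unit circle gives absolute convergence at 1,
    for the series and for its derived series.\<close>
  define r where "r = (1 + R) / 2"
  have r: "1 < r" "r < R" using R by (auto simp: r_def)
  have s1: "summable (\<lambda>n. norm (a n))"
  proof -
    have "summable (\<lambda>n. a n * of_real r ^ n)" using sums[of "of_real r"] r by (auto simp: sums_iff)
    from powser_insidea[OF this, of 1] show ?thesis using r by simp
  qed
  have s2: "summable (\<lambda>n. real n * norm (a n))"
  proof -
    have "summable (\<lambda>n. diffs a n * of_real r ^ n)"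
      by (rule termdiff_converges[of _ R]) (use r sums in \<open>auto simp: sums_iff\<close>)
    from powser_insidea[OF this, of 1] have "summable (\<lambda>n. norm (diffs a n))" using r by simp
    then have "summable (\<lambda>n. real (Suc n) * norm (a (Suc n)))" by (simp only: diffs_def norm_mult norm_of_nat)
    then show ?thesis by (rule summable_Suc_iff[THEN iffD1])
  qed
  \<comment> \<open>\<open>D\<close> is a Lipschitz constant on the circle for every tail at once,
    so \<open>C\<close>, and with it \<eta>, is fixed before the degree \<open>N\<close>.\<close>
  define D where "D = suminf (\<lambda>n. real n * norm (a n))"
  have D: "D \<ge> 0" unfolding D_def by (intro suminf_nonneg s2) auto
  define C where "C = D * 2 powr (1 - \<delta>) + 1"
  have C: "C > 0" unfolding C_def using D by (intro add_nonneg_pos) auto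
  from Lip_mult_coef_small[OF p \<delta>(1) f e C] obtain \<eta> where eta: "\<eta> > 0" and
    tail: "\<forall>g. continuous_on circle g \<longrightarrow> (\<forall>z\<in>circle. norm (g z) \<le> \<eta>) \<longrightarrow>
     (\<forall>z\<in>circle. \<forall>w\<in>circle. norm (g z - g w) \<le> C * norm (z - w) powr \<delta>) \<longrightarrow>
     p_small p e (coef (\<lambda>x. f (cis x) * g (cis x)))"
    by (elim exE conjE)
  obtain N where N: "\<And>n. n \<ge> N \<Longrightarrow> norm (\<Sum>i. norm (a (i + n))) < \<eta>"
    using suminf_exist_split[OF eta s1] by blast
  define P where "P z = (\<Sum>k\<le>N. a k * z ^ k)" for z
  define g where "g z = h z - P z" for z
  have gsum: "(\<lambda>i. a (i + Suc N) * z ^ (i + Suc N)) sums g z" if "norm z < R" for z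
  proof -
    have "(\<lambda>i. a (i + Suc N) * z ^ (i + Suc N)) sums (h z - (\<Sum>i<Suc N. a i * z ^ i))"
      using sums_split_initial_segment[OF sums[OF that], of "Suc N"] by simp
    then show ?thesis by (simp only: g_def P_def lessThan_Suc_atMost)
  qed
  have hc: "continuous_on circle h"
    by (rule continuous_on_subset[OF holomorphic_on_imp_continuous_on[OF hol]]) (use R in auto)
  have Pc: "continuous_on circle P" unfolding P_def by (intro continuous_intros)
  have gc: "continuous_on circle g" unfolding g_def by (intro continuous_intros hc Pc)
  have fc: "continuous_on circle f" by (rule Lip_continuous[OF f d0])
  have s1': "summable (\<lambda>i. norm (a (i + Suc N)))" using summable_ignore_initial_segment[OF s1] .
  have s2': "summable (\<lambda>i. real (i + Suc N) * norm (a (i + Suc N)))" using summable_ignore_initial_segment[OF s2] .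
  have "p_small p e (coef (\<lambda>x. f (cis x) * g (cis x)))"
  proof (rule tail[rule_format, OF gc])
    fix z :: complex assume "z \<in> circle"
    then have z: "norm z = 1" by simp
    have "norm (g z) = norm (\<Sum>i. a (i + Suc N) * z ^ (i + Suc N))"
      using gsum[of z] z R by (simp add: sums_iff)
    also have "\<dots> \<le> (\<Sum>i. norm (a (i + Suc N)))"
      by (rule norm_suminf_le[OF _ s1']) (simp add: norm_mult norm_power z)
    also have "\<dots> \<le> \<eta>" using N[of "Suc N"] by simp
    finally show "norm (g z) \<le> \<eta>" .
  next
    fix z w :: complex assume zc: "z \<in> circle" and wc: "w \<in> circle"
    then have z: "norm z = 1" and w: "norm w = 1" by auto
    have "(\<lambda>i. a (i + Suc N) * z ^ (i + Suc N) - a (i + Suc N) * w ^ (i + Suc N)) sums (g z - g w)"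
      using gsum[of z] gsum[of w] z w R by (intro sums_diff) auto
    then have "norm (g z - g w) = norm (\<Sum>i. a (i + Suc N) * z ^ (i + Suc N) - a (i + Suc N) * w ^ (i + Suc N))"
      by (simp add: sums_iff)
    also have "\<dots> \<le> (\<Sum>i. real (i + Suc N) * norm (a (i + Suc N)) * norm (z - w))"
    proof (rule norm_suminf_le)
      fix i
      have "norm (z ^ (i + Suc N) - w ^ (i + Suc N)) \<le> real (i + Suc N) * norm (z - w)"
        by (rule norm_power_diff) (use z w in auto)
      then have "norm (a (i + Suc N)) * norm (z ^ (i + Suc N) - w ^ (i + Suc N)) \<le> norm (a (i + Suc N)) * (real (i + Suc N) * norm (z - w))"
        by (rule mult_left_mono) simp
      then show "norm (a (i + Suc N) * z ^ (i + Suc N) - a (i + Suc N) * w ^ (i + Suc N)) \<le> real (i + Suc N) * norm (a (i + Suc N)) * norm (z - w)"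
        unfolding right_diff_distrib[symmetric] norm_mult by (simp only: mult_ac)
    qed (rule summable_mult2[OF s2'])
    also have "\<dots> = (\<Sum>i. real (i + Suc N) * norm (a (i + Suc N))) * norm (z - w)"
      using suminf_mult2[OF s2'] by simp
    also have "\<dots> \<le> D * norm (z - w)"
    proof (rule mult_right_mono)
      have "D = (\<Sum>i. real (i + Suc N) * norm (a (i + Suc N))) + (\<Sum>i<Suc N. real i * norm (a i))"
        unfolding D_def by (rule suminf_split_initial_segment[OF s2])
      moreover have "0 \<le> (\<Sum>i<Suc N. real i * norm (a i))" by (intro sum_nonneg) auto
      ultimately show "(\<Sum>i. real (i + Suc N) * norm (a (i + Suc N))) \<le> D" by linarith
    qed simp
    also have "\<dots> \<le> D * (2 powr (1 - \<delta>) * norm (z - w) powr \<delta>)"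
      using powr_le_two_powr[OF norm_ge_zero norm_circle_diff_le[OF zc wc] \<delta>(2)] D
      by (intro mult_left_mono) auto
    also have "\<dots> \<le> C * norm (z - w) powr \<delta>" by (simp add: C_def algebra_simps)
    finally show "norm (g z - g w) \<le> C * norm (z - w) powr \<delta>" .
  qed
  then have "p_small p (norm (-1 :: complex) powr p * e) (\<lambda>n. (-1) * coef (\<lambda>x. f (cis x) * g (cis x)) n)"
    by (rule p_small_scale)
  then have "p_small p e (\<lambda>n. - coef (\<lambda>x. f (cis x) * g (cis x)) n)" by simp
  from p_small_add[OF _ small this]
  have "p_small p (2 powr p * (e + e)) (\<lambda>n. coef (\<lambda>x. f (cis x) * h (cis x)) n + - coef (\<lambda>x. f (cis x) * g (cis x)) n)"
    using p by simp
  also have "(\<lambda>n. coef (\<lambda>x. f (cis x) * h (cis x)) n + - coef (\<lambda>x. f (cis x) * g (cis x)) n)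
     = coef (\<lambda>x. f (cis x) * h (cis x) - f (cis x) * g (cis x))"
    by (rule ext, subst coef_diff) (auto intro!: cper_compose_cis continuous_intros fc hc gc)
  also have "(\<lambda>x. f (cis x) * h (cis x) - f (cis x) * g (cis x)) = (\<lambda>x. f (cis x) * P (cis x))"
    by (simp add: g_def algebra_simps)
  finally have "p_small p (2 powr p * (e + e)) (coef (\<lambda>x. f (cis x) * (\<Sum>k\<le>N. a k * cis x ^ k)))"
    unfolding P_def .
  moreover have "a 0 = h 0" by (simp add: a_def)
  ultimately show ?thesis by blast
qed

lemma coef_mult_polynomial:
  assumes c: "cper f" and u: "coef f = u"
  shows "coef (\<lambda>x. f x * (\<Sum>k\<le>K. a k * cis x ^ k)) n = (\<Sum>k\<le>K. a k * u (n - int k))"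
proof -
  have "f x * (\<Sum>k\<le>K. a k * cis x ^ k) = (\<Sum>k\<le>K. a k * (cis (of_int (int k) * x) * f x))" for x
    by (simp add: sum_distrib_left Complex.DeMoivre mult_ac)
  then have "coef (\<lambda>x. f x * (\<Sum>k\<le>K. a k * cis x ^ k)) n = coef (\<lambda>x. \<Sum>k\<le>K. a k * (cis (of_int (int k) * x) * f x)) n"
    by (simp only:)
  also have "\<dots> = (\<Sum>k\<le>K. coef (\<lambda>x. a k * (cis (of_int (int k) * x) * f x)) n)"
    by (rule coef_sum) (auto intro!: cper_mult cper_const cper_cis c simp del: of_int_of_nat_eq)
  also have "\<dots> = (\<Sum>k\<le>K. a k * u (n - int k))"
    unfolding coef_scale coef_cis_mult u ..
  finally show ?thesis .
qed

section \<open>The mass is unbounded when log d is not integrable\<close>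

context circle_gauge
begin

text \<open>A point of the sublevel set lies in an arc [c m, c (Suc m)] of length 2 pi / 2^j \<le> 7
  / 2^j, so at the left end \<open>d\<close> is at most (1 + 7) / 2^j and \<open>m\<close> is
  near.\<close>

lemma emeasure_sublevel_le:
  "emeasure lborel {x \<in> {0..<2 * pi}. d (cis x) < 1 / 2 ^ j} \<le> ennreal (2 * pi * (\<Sum>m\<in>near j. 1 / 2 ^ j))"
proof -
  define c where "c m = 2 * pi * real m / 2 ^ j" for m
  have "{x \<in> {0..<2 * pi}. d (cis x) < 1 / 2 ^ j} \<subseteq> (\<Union>m\<in>near j. {c m..c (Suc m)})"
  proof
    fix x assume "x \<in> {x \<in> {0..<2 * pi}. d (cis x) < 1 / 2 ^ j}"
    then have x: "0 \<le> x" "x < 2 * pi" and dx: "d (cis x) < 1 / 2 ^ j" by auto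
    define y where "y = x * 2 ^ j / (2 * pi)"
    have y: "0 \<le> y" "y < 2 ^ j" using x by (auto simp: y_def field_simps)
    define m where "m = nat \<lfloor>y\<rfloor>"
    have m: "real m \<le> y" "y \<le> real (Suc m)" using y by (auto simp: m_def) linarith
    have "real m < 2 ^ j" using m y by linarith
    then have mj: "m < 2 ^ j" by (metis of_nat_less_iff of_nat_numeral of_nat_power)
    have xy: "x = 2 * pi * y / 2 ^ j" by (simp add: y_def)
    have cx: "c m \<le> x" "x \<le> c (Suc m)"
      unfolding c_def xy using m by (intro divide_right_mono mult_left_mono; simp)+
    have "d (node j m) \<le> d (cis x) + norm (node j m - cis x)" by (rule d_Lip) auto
    also have "norm (node j m - cis x) \<le> \<bar>c m - x\<bar>"
      using norm_cis_diff_le[of "c m" x] by (simp add: node_def c_def)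
    also have "\<bar>c m - x\<bar> \<le> c (Suc m) - c m" using cx by simp
    also have "\<dots> = 2 * pi / 2 ^ j" by (simp add: c_def field_simps)
    also have "\<dots> \<le> 7 / 2 ^ j" using pi_approx by (intro divide_right_mono) auto
    finally have "d (node j m) \<le> 8 / 2 ^ j" using dx by (simp add: field_simps)
    then have "m \<in> near j" using mj by (simp add: near_def)
    then show "x \<in> (\<Union>m\<in>near j. {c m..c (Suc m)})" using cx by auto
  qed
  then have "emeasure lborel {x \<in> {0..<2 * pi}. d (cis x) < 1 / 2 ^ j} \<le> emeasure lborel (\<Union>m\<in>near j. {c m..c (Suc m)})"
    by (intro emeasure_mono sets.finite_UN) auto
  also have "\<dots> \<le> (\<Sum>m\<in>near j. emeasure lborel {c m..c (Suc m)})"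
    by (intro emeasure_subadditive_finite) auto
  also have "\<dots> = (\<Sum>m\<in>near j. ennreal (2 * pi * (1 / 2 ^ j)))"
  proof (rule sum.cong)
    fix m
    have "c m \<le> c (Suc m)" by (simp add: c_def divide_right_mono)
    moreover have "c (Suc m) - c m = 2 * pi * (1 / 2 ^ j)" by (simp add: c_def field_simps)
    ultimately show "emeasure lborel {c m..c (Suc m)} = ennreal (2 * pi * (1 / 2 ^ j))" by simp
  qed simp
  also have "\<dots> = ennreal (\<Sum>m\<in>near j. 2 * pi * (1 / 2 ^ j))" by (rule sum_ennreal) auto
  finally show ?thesis by (simp only: sum_distrib_left)
qed

end

lemma borel_measurable_cis: "cis \<in> borel_measurable borel"
  by (intro borel_measurable_continuous_onI continuous_intros)

lemma measurable_cis_circle: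
  "cis \<in> measurable (restrict_space lborel {0..<2 * pi}) (restrict_space borel circle)"
proof (rule measurable_restrict_space2)
  show "cis \<in> borel_measurable (restrict_space lborel {0..<2 * pi})"
    by (rule measurable_restrict_space1) (use borel_measurable_cis in simp)
qed auto

lemma circle_gauge_infdist:
  assumes "Z \<subseteq> circle" "Z \<noteq> {}"
  shows "circle_gauge (\<lambda>z. infdist z Z)"
proof
  fix z w :: complex
  show "0 \<le> infdist z Z" by (rule infdist_nonneg)
  show "infdist z Z \<le> infdist w Z + norm (z - w)" using infdist_triangle[of z Z w] by (simp add: dist_norm)
  assume z: "norm z = 1"
  obtain a where a: "a \<in> Z" using assms by blast
  then have "infdist z Z \<le> dist z a" by (rule infdist_le)
  also have "\<dots> \<le> 2" unfolding dist_norm by (rule norm_circle_diff_le) (use z a assms in auto)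
  finally show "infdist z Z \<le> 2" .
qed

text \<open>Both sides are infinite at \<open>y = 0\<close>.\<close>

lemma abs_ln_le_count:
  fixes y :: real
  assumes "0 \<le> y" "y \<le> 2"
  shows "e2ennreal \<bar>if y = 0 then - \<infinity> else ereal (ln y)\<bar> \<le> 1 + (\<Sum>j. if y < 1 / 2 ^ j then 1 else 0)"
proof -
  define S :: ennreal where "S = (\<Sum>j. if y < 1 / 2 ^ j then 1 else 0)"
  have S: "of_nat n \<le> S" if "\<And>j. j < n \<Longrightarrow> y < 1 / 2 ^ j" for n
  proof -
    have "of_nat n = (\<Sum>j<n. if y < 1 / 2 ^ j then 1 else (0::ennreal))" using that by simp
    also have "\<dots> \<le> S" unfolding S_def by (rule sum_le_suminf) auto
    finally show ?thesis .
  qed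
  show ?thesis
  proof (cases "y = 0")
    case True
    then have "of_nat n \<le> S" for n by (intro S) simp
    then have "S = \<infinity>" by (metis ennreal_Ex_less_of_nat infinity_ennreal_def leD less_top)
    then show ?thesis unfolding S_def[symmetric] by simp
  next
    case False
    then have y: "y > 0" using assms by simp
    have "ennreal \<bar>ln y\<bar> \<le> 1 + S"
    proof (cases "y \<ge> 1")
      case True
      have "ln y \<le> ln 2" using y assms by simp
      also have "ln (2::real) \<le> 1" using ln_le_minus_one[of "2::real"] by simp
      finally have "\<bar>ln y\<bar> \<le> 1" using True by simp
      then have "ennreal \<bar>ln y\<bar> \<le> ennreal 1" by (rule ennreal_leI)
      then show ?thesis by (simp add: add_increasing2)
    next
      case False
      then have ly: "0 < - ln y" using y by simp
      \<comment> \<open>Since ln 2 \<le> 1, every j < - ln y satisfies y < 2^(-j); so at least as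
        many levels are counted as |ln y| rounded up.\<close>
      define n where "n = nat \<lceil>- ln y\<rceil>"
      have "of_nat n \<le> S"
      proof (rule S)
        fix j assume "j < n"
        then have "real j < - ln y" unfolding n_def by linarith
        then have "ln y < - (real j * ln 2)"
        proof -
          have "real j * ln 2 \<le> real j * 1" using ln_le_minus_one[of "2::real"] by (intro mult_left_mono) auto
          then show ?thesis using \<open>real j < - ln y\<close> by linarith
        qed
        also have "\<dots> = ln (1 / 2 ^ j)" by (simp add: ln_div ln_realpow)
        finally show "y < 1 / 2 ^ j" using y by simp
      qed
      then have "ennreal (real n) \<le> S" by (simp add: ennreal_of_nat_eq_real_of_nat)
      moreover have "ennreal \<bar>ln y\<bar> \<le> ennreal (real n)"
        using ly unfolding n_def by (intro ennreal_leI) linarith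
      ultimately have "ennreal \<bar>ln y\<bar> \<le> S" by (rule order_trans[rotated])
      then show ?thesis by (simp add: add_increasing)
    qed
    then show ?thesis using False unfolding S_def[symmetric] by simp
  qed
qed

text \<open>Integrating the layer-cake bound \<open>abs_ln_le_count\<close> and inserting the
  measures of the sublevel sets bounds the integral of |log d| by 2 pi + 2 pi M whenever the masses
  stay below M.\<close>

lemma log_dist_not_L1_imp_mass_unbounded:
  assumes Z: "Z \<subseteq> circle" "Z \<noteq> {}" and log: "log_dist Z \<notin> circle_L1"
  shows "\<exists>J. M \<le> circle_gauge.mass (\<lambda>z. infdist z Z) J"
proof (rule ccontr)
  interpret circle_gauge "\<lambda>z. infdist z Z" by (rule circle_gauge_infdist[OF Z])
  assume "\<not> ?thesis"
  then have bnd: "mass J \<le> M" for J by (meson linear)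
  define g where "g y = (if y = 0 then - \<infinity> else ereal (ln y))" for y :: real
  have ld: "log_dist Z = (\<lambda>z. g (infdist z Z))"
    using Z by (simp add: log_dist_def circle_dist_def g_def fun_eq_iff)
  \<comment> \<open>Membership in \<open>circle_L1\<close> includes measurability, which must be
    established before its failure can be blamed on the integral.\<close>
  have inf_meas: "(\<lambda>z. infdist z Z) \<in> borel_measurable borel"
    by (intro borel_measurable_continuous_onI continuous_intros)
  have g_meas: "g \<in> borel_measurable borel" unfolding g_def by measurable
  have meas0: "log_dist Z \<in> borel_measurable borel"
    unfolding ld by (rule measurable_compose[OF inf_meas g_meas])
  have meas1: "log_dist Z \<in> borel_measurable (restrict_space borel circle)"
    by (rule measurable_restrict_space1[OF meas0])
  have meas: "log_dist Z \<in> borel_measurable circle_measure"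
    using meas1 by (simp add: circle_measure_def measurable_distr_eq1)
  have "(\<integral>\<^sup>+ \<zeta>. e2ennreal \<bar>log_dist Z \<zeta>\<bar> \<partial>circle_measure) =
      (\<integral>\<^sup>+ x. e2ennreal \<bar>log_dist Z (cis x)\<bar> \<partial>restrict_space lborel {0..<2 * pi})"
    unfolding circle_measure_def
    by (rule nn_integral_distr[OF measurable_cis_circle]) (use meas1 in measurable)
  also have "\<dots> = (\<integral>\<^sup>+ x. e2ennreal \<bar>log_dist Z (cis x)\<bar> * indicator {0..<2 * pi} x \<partial>lborel)"
    by (rule nn_integral_restrict_space) simp
  also have "\<dots> \<le> (\<integral>\<^sup>+ x. indicator {0..<2 * pi} x + (\<Sum>j. indicator {x \<in> {0..<2 * pi}. infdist (cis x) Z < 1 / 2 ^ j} x) \<partial>lborel)"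
  proof (rule nn_integral_mono)
    fix x
    show "e2ennreal \<bar>log_dist Z (cis x)\<bar> * indicator {0..<2 * pi} x \<le>
       indicator {0..<2 * pi} x + (\<Sum>j. indicator {x \<in> {0..<2 * pi}. infdist (cis x) Z < 1 / 2 ^ j} x)"
    proof (cases "x \<in> {0..<2 * pi}")
      case True
      have "e2ennreal \<bar>g (infdist (cis x) Z)\<bar> \<le> 1 + (\<Sum>j. if infdist (cis x) Z < 1 / 2 ^ j then 1 else 0)"
        unfolding g_def by (rule abs_ln_le_count) (use d_nonneg d_le_2 in auto)
      moreover have "indicator {x \<in> {0..<2 * pi}. infdist (cis x) Z < 1 / 2 ^ j} x = (if infdist (cis x) Z < 1 / 2 ^ j then 1 else (0::ennreal))" for j
        using True by simp
      ultimately show ?thesis using True by (simp add: ld)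
    qed simp
  qed
  also have "\<dots> = (\<integral>\<^sup>+ x. indicator {0..<2 * pi} x \<partial>lborel) + (\<integral>\<^sup>+ x. (\<Sum>j. indicator {x \<in> {0..<2 * pi}. infdist (cis x) Z < 1 / 2 ^ j} x) \<partial>lborel)"
  proof (rule nn_integral_add)
    have "(\<lambda>x. infdist (cis x) Z) \<in> borel_measurable borel" by (rule measurable_compose[OF borel_measurable_cis inf_meas])
    then have "{x \<in> {0..<2 * pi}. infdist (cis x) Z < 1 / 2 ^ j} \<in> sets borel" for j :: nat by measurable
    then show "(\<lambda>x. \<Sum>j. indicator {x \<in> {0..<2 * pi}. infdist (cis x) Z < 1 / 2 ^ j} x :: ennreal) \<in> borel_measurable lborel"
      by (intro borel_measurable_suminf_order borel_measurable_indicator) auto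
  qed auto
  also have "(\<integral>\<^sup>+ x. (\<Sum>j. indicator {x \<in> {0..<2 * pi}. infdist (cis x) Z < 1 / 2 ^ j} x) \<partial>lborel) =
     (\<Sum>j. emeasure lborel {x \<in> {0..<2 * pi}. infdist (cis x) Z < 1 / 2 ^ j})"
  proof -
    have "(\<lambda>x. infdist (cis x) Z) \<in> borel_measurable borel" by (rule measurable_compose[OF borel_measurable_cis inf_meas])
    then have "{x \<in> {0..<2 * pi}. infdist (cis x) Z < 1 / 2 ^ j} \<in> sets lborel" for j :: nat by measurable
    then show ?thesis by (subst nn_integral_suminf) (auto intro!: borel_measurable_indicator)
  qed
  also have "\<dots> \<le> ennreal (2 * pi * M)"
  proof (rule suminf_le_const)
    fix J
    have "(\<Sum>j<J. emeasure lborel {x \<in> {0..<2 * pi}. infdist (cis x) Z < 1 / 2 ^ j}) \<le> (\<Sum>j<J. ennreal (2 * pi * (\<Sum>m\<in>near j. 1 / 2 ^ j)))"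
      by (intro sum_mono emeasure_sublevel_le)
    also have "\<dots> = ennreal (\<Sum>j<J. 2 * pi * (\<Sum>m\<in>near j. 1 / 2 ^ j))"
      by (rule sum_ennreal) (auto intro!: mult_nonneg_nonneg sum_nonneg)
    also have "(\<Sum>j<J. 2 * pi * (\<Sum>m\<in>near j. 1 / 2 ^ j)) = 2 * pi * mass J"
      by (simp only: mass_def sum_distrib_left)
    also have "ennreal (2 * pi * mass J) \<le> ennreal (2 * pi * M)"
      using bnd[of J] by (intro ennreal_leI mult_left_mono) auto
    finally show "(\<Sum>j<J. emeasure lborel {x \<in> {0..<2 * pi}. infdist (cis x) Z < 1 / 2 ^ j}) \<le> ennreal (2 * pi * M)" .
  qed auto
  finally have "(\<integral>\<^sup>+ \<zeta>. e2ennreal \<bar>log_dist Z \<zeta>\<bar> \<partial>circle_measure) \<le> (\<integral>\<^sup>+ x. indicator {0..<2 * pi} x \<partial>lborel) + ennreal (2 * pi * M)"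
    by (simp add: add_left_mono)
  also have "(\<integral>\<^sup>+ x. indicator {0..<2 * pi} x \<partial>lborel) = ennreal (2 * pi)" by simp
  also have "ennreal (2 * pi) + ennreal (2 * pi * M) < \<infinity>" by simp
  finally have "log_dist Z \<in> circle_L1" using meas by (simp add: circle_L1_def)
  then show False using log by contradiction
qed

section \<open>Approximation by trigonometric polynomials\<close>

text \<open>Up to normalisation the de la Vallee-Poussin kernel, as 1 + cos y = 2 cos^2 (y/2). It is
  a nonnegative trigonometric polynomial, so convolution with it averages translates.\<close>

definition cospow :: "nat \<Rightarrow> real \<Rightarrow> real" where
  "cospow n y = (1 + cos y) ^ n"

lemma cper_cospow: "cper (cospow n)"
  unfolding cospow_def by (rule cperI) (auto intro!: continuous_intros)

lemma cospow_nonneg: "0 \<le> cospow n y"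
  unfolding cospow_def using cos_ge_minus_one[of y] by (intro zero_le_power) linarith

lemma integral_cospow_pos: "0 < pint (cospow n)"
proof -
  have "pint (cospow n) \<noteq> 0"
  proof
    assume "pint (cospow n) = 0"
    then have "\<forall>x\<in>{0..2 * pi}. cospow n x = 0"
      using integral_eq_0_iff[of 0 "2 * pi" "cospow n"] cper_cont[OF cper_cospow] cospow_nonneg by auto
    then have "cospow n 0 = 0" by simp
    then show False by (simp add: cospow_def)
  qed
  moreover have "0 \<le> pint (cospow n)"
    by (rule hk_integral_nonneg) (auto intro: cper_integrable cper_cospow cospow_nonneg)
  ultimately show ?thesis by linarith
qed

text \<open>Integrate the derivative of \<open>sin y (1 + cos y)\<^sup>n\<close>. A second moment of
  order \<open>1 / n\<close> is all that is needed for the kernel to concentrate at 0.\<close>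

lemma integral_cospow_second_moment:
  "pint (\<lambda>y. (1 - cos y) * cospow n y) = pint (cospow n) / (real n + 1)"
proof -
  have ccos: "cper cos" by (rule cperI) (auto intro: continuous_intros)
  have ib: "(\<lambda>y. (1 - cos y) * cospow n y) integrable_on {0..2 * pi}"
    by (intro cper_integrable cper_mult cper_diff cper_const ccos cper_cospow)
  have "((\<lambda>y. cospow n y - (real n + 1) * ((1 - cos y) * cospow n y)) has_integral
      (sin (2 * pi) * (1 + cos (2 * pi)) ^ n - sin 0 * (1 + cos 0) ^ n)) {0..2 * pi}"
  proof (rule fundamental_theorem_of_calculus)
    fix y :: real
    have "((\<lambda>y. sin y * (1 + cos y) ^ n) has_real_derivative
        cos y * (1 + cos y) ^ n + sin y * (real n * (1 + cos y) ^ (n - 1) * (- sin y))) (at y)"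
      by (auto intro!: derivative_eq_intros)
    \<comment> \<open>The power lost by differentiation returns through sin^2 y = (1 - cos y)(1 +
      cos y). The case n = 0 is separate because \<open>n - 1\<close> is a difference of natural
      numbers.\<close>
    also have "sin y * (real n * (1 + cos y) ^ (n - 1) * (- sin y)) = - (real n * (1 - cos y) * (1 + cos y) ^ n)"
    proof (cases n)
      case (Suc m)
      have "sin y * (real n * (1 + cos y) ^ (n - 1) * (- sin y)) = - (real n * (sin y)\<^sup>2 * (1 + cos y) ^ m)"
        by (simp add: Suc power2_eq_square)
      also have "(sin y)\<^sup>2 = (1 - cos y) * (1 + cos y)"
        by (simp add: sin_squared_eq power2_eq_square algebra_simps)
      finally show ?thesis by (simp add: Suc)
    qed simp
    also have "cos y * (1 + cos y) ^ n + - (real n * (1 - cos y) * (1 + cos y) ^ n) =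
        cospow n y - (real n + 1) * ((1 - cos y) * cospow n y)"
      by (simp add: cospow_def algebra_simps)
    finally show "((\<lambda>y. sin y * (1 + cos y) ^ n) has_vector_derivative
        cospow n y - (real n + 1) * ((1 - cos y) * cospow n y)) (at y within {0..2 * pi})"
      by (simp add: has_real_derivative_iff_has_vector_derivative has_vector_derivative_at_within)
  qed simp
  then have "pint (\<lambda>y. cospow n y - (real n + 1) * ((1 - cos y) * cospow n y)) = 0"
    by (simp add: integral_unique)
  moreover have "pint (\<lambda>y. cospow n y - (real n + 1) * ((1 - cos y) * cospow n y)) =
      pint (cospow n) - (real n + 1) * pint (\<lambda>y. (1 - cos y) * cospow n y)"
    using hk_integral_diff[OF cper_integrable[OF cper_cospow] integrable_on_mult_right[OF ib, of "real n + 1"]]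
    by simp
  ultimately show ?thesis by (simp add: field_simps)
qed

text \<open>Writing 1 + cos y = (1 + cis y)(1 + cis (- y)) / 2 makes the kernel a product of two
  binomial expansions, with frequencies i - j.\<close>

lemma cospow_expand:
  "complex_of_real (cospow n y) = (\<Sum>i\<le>n. \<Sum>j\<le>n. of_nat (n choose i) * of_nat (n choose j) / 2 ^ n * cis (of_int (int i - int j) * y))"
proof -
  have "complex_of_real (1 + cos y) = (1 + cis y) * (1 + cis (- y)) / 2"
    using sin_cos_squared_add[of y] by (simp add: complex_eq_iff algebra_simps power2_eq_square)
  then have "complex_of_real (1 + cos y) ^ n = (cis y + 1) ^ n * (cis (- y) + 1) ^ n / 2 ^ n"
    by (simp only: power_mult_distrib power_divide add.commute)
  then have "complex_of_real (cospow n y) = (cis y + 1) ^ n * (cis (- y) + 1) ^ n / 2 ^ n"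
    by (simp only: cospow_def of_real_power)
  also have "(cis y + 1) ^ n = (\<Sum>i\<le>n. of_nat (n choose i) * cis (real i * y))"
    by (simp add: binomial_ring Complex.DeMoivre)
  also have "(cis (- y) + 1) ^ n = (\<Sum>j\<le>n. of_nat (n choose j) * cis (- (real j * y)))"
    by (simp add: binomial_ring Complex.DeMoivre)
  also have "(\<Sum>i\<le>n. of_nat (n choose i) * cis (real i * y)) * (\<Sum>j\<le>n. of_nat (n choose j) * cis (- (real j * y))) / 2 ^ n
     = (\<Sum>i\<le>n. \<Sum>j\<le>n. (of_nat (n choose i) * cis (real i * y)) * (of_nat (n choose j) * cis (- (real j * y))) / 2 ^ n)"
    by (simp only: sum_product sum_divide_distrib)
  also have "\<dots> = (\<Sum>i\<le>n. \<Sum>j\<le>n. of_nat (n choose i) * of_nat (n choose j) / 2 ^ n * cis (of_int (int i - int j) * y))"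
  proof (intro sum.cong refl)
    fix i j
    have "cis (of_int (int i - int j) * y) = cis (real i * y) * cis (- (real j * y))"
      by (simp add: cis_mult left_diff_distrib)
    then show "(of_nat (n choose i) * cis (real i * y)) * (of_nat (n choose j) * cis (- (real j * y))) / 2 ^ n
      = of_nat (n choose i) * of_nat (n choose j) / 2 ^ n * cis (of_int (int i - int j) * y)"
      by simp
  qed
  finally show ?thesis .
qed

lemma norm_integral_mult_kernel_le:
  fixes F :: "real \<Rightarrow> complex" and q G :: "real \<Rightarrow> real"
  assumes F: "cper F" and q: "cper q" "\<And>y. 0 \<le> q y" and G: "cper G" "\<And>y. norm (F y) \<le> G y"
  shows "norm (pint (\<lambda>y. F y * of_real (q y))) \<le> pint (\<lambda>y. G y * q y)"
proof (rule integral_norm_bound_integral)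
  have "cper (\<lambda>y. complex_of_real (q y))" using q(1) by (auto simp: cper_def intro!: continuous_intros)
  then show "(\<lambda>y. F y * of_real (q y)) integrable_on {0..2 * pi}" by (intro cper_integrable cper_mult F)
  show "(\<lambda>y. G y * q y) integrable_on {0..2 * pi}" by (intro cper_integrable cper_mult G q)
  show "norm (F y * of_real (q y)) \<le> G y * q y" for y
    using G(2)[of y] q(2)[of y] by (simp add: norm_mult mult_right_mono)
qed

abbreviation trig_poly :: "nat \<Rightarrow> (nat \<Rightarrow> nat \<Rightarrow> complex) \<Rightarrow> real \<Rightarrow> complex" where
  "trig_poly N \<beta> x \<equiv> (\<Sum>i\<le>N. \<Sum>j\<le>N. \<beta> i j * cis (of_int (int j - int i) * x))"

text \<open>Convolution with a positive kernel of total mass one keeps the Hoelder constant,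
  whatever the quality \<eta> of the approximation; \<open>Lip_mult_coef_small\<close> depends on
  this. The error is an average of C |cis y - 1|^\<delta>, which is reduced to the second moment of
  the kernel.\<close>

lemma Lip_trigonometric_approx:
  fixes b :: "complex \<Rightarrow> complex"
  assumes bc: "continuous_on circle b" and C: "C > 0" and \<delta>: "0 < \<delta>" "\<delta> \<le> 2"
    and bL: "\<And>z w. z \<in> circle \<Longrightarrow> w \<in> circle \<Longrightarrow> norm (b z - b w) \<le> C * norm (z - w) powr \<delta>"
    and \<eta>: "\<eta> > 0"
  shows "\<exists>(N::nat) \<beta>. (\<forall>x. norm (b (cis x) - trig_poly N \<beta> x) \<le> \<eta>) \<and>
    (\<forall>x y. norm (trig_poly N \<beta> x - trig_poly N \<beta> y)
       \<le> C * norm (cis x - cis y) powr \<delta>)"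
proof -
  \<comment> \<open>The threshold is chosen to make C l^\<delta> equal to \<eta> / 2; then
    \<open>n\<close> is taken so large that the second moment pays for the other half.\<close>
  define l where "l = (\<eta> / (2 * C)) powr (1 / \<delta>)"
  have l: "l > 0" using \<eta> C by (simp add: l_def)
  have lC: "C * l powr \<delta> = \<eta> / 2" using \<eta> C \<delta> by (simp add: l_def powr_powr)
  obtain n :: nat where n: "4 * C * l powr (\<delta> - 2) / \<eta> < real n" using reals_Archimedean2 by blast
  define I where "I = pint (cospow n)"
  have I: "I > 0" unfolding I_def by (rule integral_cospow_pos)
  define B where "B x = b (cis x)" for x
  have B: "cper B" unfolding B_def by (rule cper_compose_cis[OF bc])
  have cq: "cper (\<lambda>y. complex_of_real (cospow n y))"
    using cper_cospow[of n] by (auto simp: cper_def intro!: continuous_intros)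
  define T where "T x = pint (\<lambda>y. B (y + x) * of_real (cospow n y)) / of_real I" for x
  define \<beta> where "\<beta> i j = of_nat (n choose i) * of_nat (n choose j) / 2 ^ n *
     pint (\<lambda>y. B y * cis (of_int (int i - int j) * y)) / of_real I" for i j
  have Tsum: "T x = (\<Sum>i\<le>n. \<Sum>j\<le>n. \<beta> i j * cis (of_int (int j - int i) * x))" for x
  proof -
    define k :: "nat \<Rightarrow> nat \<Rightarrow> complex" where "k i j = of_nat (n choose i) * of_nat (n choose j) / 2 ^ n" for i j
    \<comment> \<open>Moving the translation from \<open>B\<close> to the kernel lets the expansion
      separate \<open>x\<close> from the variable of integration.\<close>
    define H where "H y = B y * of_real (cospow n (y + - x))" for y
    have H: "cper H" unfolding H_def by (intro cper_mult B cper_shift[OF cq])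
    have "pint (\<lambda>y. B (y + x) * of_real (cospow n y)) = pint (\<lambda>y. H (y + x))"
      by (simp add: H_def)
    also have "\<dots> = pint H" by (rule integral_shift_period[OF H])
    also have "H = (\<lambda>y. \<Sum>i\<le>n. \<Sum>j\<le>n. k i j * cis (of_int (int j - int i) * x) * (B y * cis (of_int (int i - int j) * y)))"
    proof
      fix y
      have "cis (of_int (int i - int j) * (y + - x)) = cis (of_int (int j - int i) * x) * cis (of_int (int i - int j) * y)" for i j
        by (simp add: cis_mult algebra_simps)
      then show "H y = (\<Sum>i\<le>n. \<Sum>j\<le>n. k i j * cis (of_int (int j - int i) * x) * (B y * cis (of_int (int i - int j) * y)))"
        unfolding H_def cospow_expand k_def sum_distrib_left by (simp only: mult_ac)
    qed
    also have "pint \<dots> = (\<Sum>i\<le>n. \<Sum>j\<le>n. k i j * cis (of_int (int j - int i) * x) *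
         pint (\<lambda>y. B y * cis (of_int (int i - int j) * y)))"
    proof -
      have i: "(\<lambda>y. k i j * cis (of_int (int j - int i) * x) * (B y * cis (of_int (int i - int j) * y))) integrable_on {0..2 * pi}" for i j
        by (intro cper_integrable cper_mult cper_const B cper_cis)
      show ?thesis
        apply (subst hk_integral_sum[OF finite_atMost])
         apply (intro integrable_sum finite_atMost i)
        apply (subst hk_integral_sum[OF finite_atMost i])
        apply simp
        done
    qed
    finally show ?thesis unfolding T_def \<beta>_def k_def by (simp add: mult_ac sum_divide_distrib)
  qed
  have TL: "norm (T x - T x') \<le> C * norm (cis x - cis x') powr \<delta>" for x x'
  proof -
    have i: "(\<lambda>y. B (y + x) * of_real (cospow n y)) integrable_on {0..2 * pi}" for x
      by (intro cper_integrable cper_mult cper_shift[OF B] cq)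
    have "pint (\<lambda>y. B (y + x) * of_real (cospow n y)) - pint (\<lambda>y. B (y + x') * of_real (cospow n y))
       = pint (\<lambda>y. (B (y + x) - B (y + x')) * of_real (cospow n y))"
      unfolding left_diff_distrib by (rule hk_integral_diff[symmetric, OF i i])
    then have "norm (T x - T x') = norm (pint (\<lambda>y. (B (y + x) - B (y + x')) * of_real (cospow n y))) / I"
      unfolding T_def diff_divide_distrib[symmetric] using I by (simp add: norm_divide)
    also have "\<dots> \<le> pint (\<lambda>y. C * norm (cis x - cis x') powr \<delta> * cospow n y) / I"
    proof (intro divide_right_mono norm_integral_mult_kernel_le cper_diff cper_shift[OF B] cper_cospow cospow_nonneg cper_const)
      fix y
      have "norm (cis (y + x) - cis (y + x')) = norm (cis x - cis x')"
        unfolding norm_cis_diff by simp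
      then show "norm (B (y + x) - B (y + x')) \<le> C * norm (cis x - cis x') powr \<delta>"
        unfolding B_def using bL[of "cis (y + x)" "cis (y + x')"] by simp
    qed (use I in simp)
    also have "\<dots> = C * norm (cis x - cis x') powr \<delta>" using I by (simp add: I_def[symmetric])
    finally show ?thesis .
  qed
  have TB: "norm (b (cis x) - T x) \<le> \<eta>" for x
  proof -
    define G where "G y = C * (l powr \<delta> + 2 * l powr (\<delta> - 2) * (1 - cos y))" for y
    have G: "cper G" unfolding G_def by (rule cperI) (auto intro!: continuous_intros)
    have iq: "(\<lambda>y. B x * complex_of_real (cospow n y)) integrable_on {0..2 * pi}"
      by (intro cper_integrable cper_mult cper_const cq)
    have ib: "(\<lambda>y. B (y + x) * of_real (cospow n y)) integrable_on {0..2 * pi}"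
      by (intro cper_integrable cper_mult cper_shift[OF B] cq)
    have "pint (\<lambda>y. complex_of_real (cospow n y)) = of_real I"
      unfolding I_def
      using integral_linear[OF cper_integrable[OF cper_cospow, of n 0 "2 * pi"] bounded_linear_of_real[where 'a = complex]]
      by (simp add: o_def)
    then have "B x = pint (\<lambda>y. B x * complex_of_real (cospow n y)) / of_real I"
      using I by simp
    then have "b (cis x) - T x = pint (\<lambda>y. (B x - B (y + x)) * of_real (cospow n y)) / of_real I"
      unfolding T_def left_diff_distrib hk_integral_diff[OF iq ib] diff_divide_distrib
      by (simp add: B_def)
    then have "norm (b (cis x) - T x) = norm (pint (\<lambda>y. (B x - B (y + x)) * of_real (cospow n y))) / I"
      using I by (simp add: norm_divide)
    also have "\<dots> \<le> pint (\<lambda>y. G y * cospow n y) / I"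
    proof (intro divide_right_mono norm_integral_mult_kernel_le cper_diff cper_shift[OF B] cper_cospow cospow_nonneg cper_const G)
      fix y
      have n2: "(norm (cis y - 1))\<^sup>2 = 2 * (1 - cos y)"
      proof -
        have "(norm (cis y - 1))\<^sup>2 = (cos y - 1)\<^sup>2 + (sin y)\<^sup>2" by (simp add: cmod_power2)
        also have "\<dots> = 2 * (1 - cos y)" using sin_cos_squared_add[of y] by (simp add: power2_eq_square algebra_simps)
        finally show ?thesis .
      qed
      have "norm (cis x - cis (y + x)) = norm (cis y - 1)"
        using norm_cis_diff[of "y + x" x] by (simp add: norm_minus_commute)
      then have "norm (B x - B (y + x)) \<le> C * norm (cis y - 1) powr \<delta>"
        unfolding B_def using bL[of "cis x" "cis (y + x)"] by simp
      also have "norm (cis y - 1) powr \<delta> \<le> (norm (cis y - 1))\<^sup>2 * l powr (\<delta> - 2) + l powr \<delta>"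
        by (rule powr_le_square_interp) (use l \<delta> in auto)
      finally show "norm (B x - B (y + x)) \<le> G y" unfolding n2 G_def using C by (simp add: algebra_simps)
    qed (use I in simp)
    also have "pint (\<lambda>y. G y * cospow n y) = C * (l powr \<delta> * I + 2 * l powr (\<delta> - 2) * (I / (real n + 1)))"
    proof -
      have ccos: "cper cos" by (rule cperI) (auto intro: continuous_intros)
      have 1: "(\<lambda>y. C * l powr \<delta> * cospow n y) integrable_on {0..2 * pi}"
        by (intro cper_integrable cper_mult cper_const cper_cospow)
      have 2: "(\<lambda>y. C * (2 * l powr (\<delta> - 2)) * ((1 - cos y) * cospow n y)) integrable_on {0..2 * pi}"
        by (intro cper_integrable cper_mult cper_const cper_cospow cper_diff ccos)
      have "G y * cospow n y = C * l powr \<delta> * cospow n y + C * (2 * l powr (\<delta> - 2)) * ((1 - cos y) * cospow n y)" for y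
        by (simp add: G_def algebra_simps)
      then have "pint (\<lambda>y. G y * cospow n y) =
          pint (\<lambda>y. C * l powr \<delta> * cospow n y) + pint (\<lambda>y. C * (2 * l powr (\<delta> - 2)) * ((1 - cos y) * cospow n y))"
        using hk_integral_add[OF 1 2] by simp
      also have "\<dots> = C * l powr \<delta> * I + C * (2 * l powr (\<delta> - 2)) * (I / (real n + 1))"
        unfolding I_def integral_cospow_second_moment[symmetric] by simp
      finally show ?thesis by (simp add: distrib_left)
    qed
    also have "C * (l powr \<delta> * I + 2 * l powr (\<delta> - 2) * (I / (real n + 1))) / I = C * l powr \<delta> + 2 * C * l powr (\<delta> - 2) / (real n + 1)"
    proof -
      have "C * (l powr \<delta> * I + 2 * l powr (\<delta> - 2) * (I / (real n + 1))) = (C * l powr \<delta> + 2 * C * l powr (\<delta> - 2) / (real n + 1)) * I"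
        by (simp add: distrib_left distrib_right)
      then show ?thesis using I by simp
    qed
    also have "\<dots> \<le> \<eta> / 2 + \<eta> / 2"
    proof (rule add_mono)
      show "C * l powr \<delta> \<le> \<eta> / 2" using lC by simp
      have "4 * C * l powr (\<delta> - 2) < real n * \<eta>" using n \<eta> by (simp add: field_simps)
      also have "\<dots> \<le> (real n + 1) * \<eta>" using \<eta> by simp
      finally show "2 * C * l powr (\<delta> - 2) / (real n + 1) \<le> \<eta> / 2" by (simp add: field_simps)
    qed
    finally show ?thesis by simp
  qed
  show ?thesis
    by (intro exI[of _ n] exI[of _ \<beta>]) (use TB TL in \<open>auto simp: Tsum\<close>)
qed

section \<open>Coverings and cutoff functions\<close>

text \<open>Sets of diameter at most 1 with a small sum of powers come from the premeasure at scale
  1, and the bound 1 allows the larger exponent \<tau>. Each set that meets \<open>Z\<close> is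
  replaced by an open ball centred in \<open>Z\<close>; compactness makes the family finite.\<close>

lemma hausdorff_null_finite_cover:
  fixes Z :: "'a::metric_space set"
  assumes Z: "compact Z" and H: "hausdorff_measure \<sigma> Z = 0" and \<tau>: "\<sigma> \<le> \<tau>" "0 < \<tau>" "\<tau> \<le> 1"
    and \<eta>: "0 < \<eta>"
  shows "\<exists>(I::nat set) z \<rho>. finite I \<and> (\<forall>i\<in>I. z i \<in> Z \<and> 0 < \<rho> i) \<and> Z \<subseteq> (\<Union>i\<in>I. ball (z i) (\<rho> i)) \<and>
     (\<Sum>i\<in>I. \<rho> i powr \<tau>) \<le> \<eta>"
proof -
  \<comment> \<open>The 6 is 2 * (1 + 2): doubling a radius costs 2^\<tau> \<le> 2, the diameters
    contribute \<eta>' and the added radii at most 2 \<eta>'.\<close>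
  define \<eta>' where "\<eta>' = \<eta> / 6"
  have e': "\<eta>' > 0" using \<eta> by (simp add: \<eta>'_def)
  have "hausdorff_premeasure \<sigma> 1 Z \<le> hausdorff_measure \<sigma> Z"
    unfolding hausdorff_measure_def by (rule SUP_upper) simp
  then have "hausdorff_premeasure \<sigma> 1 Z < ennreal \<eta>'" using H e' by simp
  then obtain U :: "nat \<Rightarrow> 'a set" where cov: "Z \<subseteq> (\<Union>i. U i)"
    and bU: "\<And>i. bounded (U i)" and dU: "\<And>i. diameter (U i) \<le> 1"
    and sU: "(\<Sum>i. ennreal (diameter (U i) powr \<sigma>)) < ennreal \<eta>'"
    unfolding hausdorff_premeasure_def INF_less_iff by blast
  define J where "J = {i. U i \<inter> Z \<noteq> {}}"
  define z where "z i = (SOME x. x \<in> U i \<inter> Z)" for i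
  have z: "z i \<in> U i" "z i \<in> Z" if "i \<in> J" for i
  proof -
    have "\<exists>x. x \<in> U i \<inter> Z" using that by (auto simp: J_def)
    from someI_ex[OF this] show "z i \<in> U i" "z i \<in> Z" unfolding z_def by auto
  qed
  \<comment> \<open>These give positive radii even to sets of diameter 0, with \<tau>-th powers that
    sum geometrically.\<close>
  define \<kappa> where "\<kappa> i = (\<eta>' / 2 ^ i) powr (1 / \<tau>)" for i :: nat
  have k: "\<kappa> i > 0" for i using e' by (simp add: \<kappa>_def)
  define \<rho> where "\<rho> i = 2 * max (diameter (U i)) (\<kappa> i)" for i
  have dU0: "0 \<le> diameter (U i)" for i by (rule diameter_ge_0[OF bU])
  have r: "\<rho> i > 0" "diameter (U i) < \<rho> i" for i using k[of i] dU0[of i] by (auto simp: \<rho>_def max_def)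
  have cov2: "Z \<subseteq> (\<Union>i\<in>J. ball (z i) (\<rho> i))"
  proof
    fix x assume x: "x \<in> Z"
    then obtain i where i: "x \<in> U i" using cov by blast
    then have iJ: "i \<in> J" using x by (auto simp: J_def)
    have "dist (z i) x \<le> diameter (U i)" by (rule diameter_bounded_bound[OF bU z(1)[OF iJ] i])
    then have "x \<in> ball (z i) (\<rho> i)" using r(2)[of i] by simp
    then show "x \<in> (\<Union>i\<in>J. ball (z i) (\<rho> i))" using iJ by blast
  qed
  obtain I where I: "I \<subseteq> J" "finite I" "Z \<subseteq> (\<Union>i\<in>I. ball (z i) (\<rho> i))"
    by (rule compactE_image[OF Z _ cov2]) auto
  have "(\<Sum>i\<in>I. \<rho> i powr \<tau>) \<le> (\<Sum>i\<in>I. 2 * (diameter (U i) powr \<sigma> + \<eta>' / 2 ^ i))"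
  proof (rule sum_mono)
    fix i
    define m where "m = max (diameter (U i)) (\<kappa> i)"
    have m0: "0 \<le> m" using k[of i] by (simp add: m_def)
    have "\<rho> i powr \<tau> = 2 powr \<tau> * m powr \<tau>" using m0 by (simp add: \<rho>_def m_def[symmetric] powr_mult)
    also have "\<dots> \<le> 2 * m powr \<tau>" using \<tau> powr_mono[of \<tau> 1 2] by (intro mult_right_mono) auto
    also have "m powr \<tau> \<le> diameter (U i) powr \<tau> + \<kappa> i powr \<tau>" by (auto simp: m_def max_def)
    also have "diameter (U i) powr \<tau> \<le> diameter (U i) powr \<sigma>"
      using \<tau> dU dU0 by (intro powr_mono') auto
    also have "\<kappa> i powr \<tau> = \<eta>' / 2 ^ i" using e' \<tau> by (simp add: \<kappa>_def powr_powr)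
    finally show "\<rho> i powr \<tau> \<le> 2 * (diameter (U i) powr \<sigma> + \<eta>' / 2 ^ i)" by simp
  qed
  also have "\<dots> = 2 * ((\<Sum>i\<in>I. diameter (U i) powr \<sigma>) + \<eta>' * (\<Sum>i\<in>I. 1 / 2 ^ i))"
  proof -
    have "(\<Sum>i\<in>I. \<eta>' / 2 ^ i) = \<eta>' * (\<Sum>i\<in>I. 1 / 2 ^ i)" by (simp add: sum_distrib_left)
    moreover have "(\<Sum>i\<in>I. 2 * (diameter (U i) powr \<sigma> + \<eta>' / 2 ^ i)) = 2 * ((\<Sum>i\<in>I. diameter (U i) powr \<sigma>) + (\<Sum>i\<in>I. \<eta>' / 2 ^ i))"
      by (simp only: sum_distrib_left[symmetric] sum.distrib)
    ultimately show ?thesis by (simp only:)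
  qed
  also have "(\<Sum>i\<in>I. diameter (U i) powr \<sigma>) \<le> \<eta>'"
  proof -
    have "ennreal (\<Sum>i\<in>I. diameter (U i) powr \<sigma>) = (\<Sum>i\<in>I. ennreal (diameter (U i) powr \<sigma>))"
      by (rule sum_ennreal[symmetric]) simp
    also have "\<dots> \<le> (\<Sum>i. ennreal (diameter (U i) powr \<sigma>))" using I by (intro sum_le_suminf) auto
    also have "\<dots> < ennreal \<eta>'" by (rule sU)
    finally show ?thesis using e' by (simp add: ennreal_less_iff sum_nonneg)
  qed
  also have "(\<Sum>i\<in>I. 1 / 2 ^ i) \<le> (2::real)"
  proof -
    have "(\<Sum>i\<in>I. 1 / 2 ^ i) = (\<Sum>i\<in>I. (1 / 2 :: real) ^ i)" by (simp only: power_divide power_one)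
    also have "\<dots> \<le> (\<Sum>i. (1 / 2 :: real) ^ i)"
      by (rule sum_le_suminf) (use I in auto)
    also have "\<dots> = 2" using suminf_geometric[of "1 / 2 :: real"] by simp
    finally show ?thesis .
  qed
  finally have "(\<Sum>i\<in>I. \<rho> i powr \<tau>) \<le> 2 * (\<eta>' + \<eta>' * 2)" using e' by simp
  then have "(\<Sum>i\<in>I. \<rho> i powr \<tau>) \<le> \<eta>" by (simp add: \<eta>'_def)
  with I(2,3) show ?thesis
    by (intro exI[of _ I] exI[of _ z] exI[of _ \<rho>] conjI ballI) (use I(1) z(2) r(1) in auto)
qed

section \<open>Tent functions, their maxima, and quotients by the symbol\<close>

definition tent :: "real \<Rightarrow> complex \<Rightarrow> complex \<Rightarrow> real" where
  "tent r a z = max 0 (min 1 (2 - norm (z - a) / r))"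

lemma tent_bounds: "0 \<le> tent r a z" "tent r a z \<le> 1"
  by (auto simp: tent_def)

lemma tent_eq_1: "0 < r \<Longrightarrow> norm (z - a) \<le> r \<Longrightarrow> tent r a z = 1"
  by (simp add: tent_def field_simps)

lemma tent_eq_0: "0 < r \<Longrightarrow> 2 * r \<le> norm (z - a) \<Longrightarrow> tent r a z = 0"
  by (simp add: tent_def field_simps)

lemma tent_Lip: assumes "0 < r" shows "\<bar>tent r a z - tent r a w\<bar> \<le> norm (z - w) / r"
proof -
  have clamp: "\<bar>max 0 (min 1 (2 - x)) - max 0 (min 1 (2 - y))\<bar> \<le> \<bar>y - x\<bar>" for x y :: real
    by linarith
  have "\<bar>tent r a z - tent r a w\<bar> \<le> \<bar>norm (w - a) / r - norm (z - a) / r\<bar>"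
    unfolding tent_def by (rule clamp)
  also have "\<dots> = \<bar>norm (w - a) - norm (z - a)\<bar> / r"
    unfolding diff_divide_distrib[symmetric] abs_divide using assms by simp
  also have "\<bar>norm (w - a) - norm (z - a)\<bar> \<le> norm (z - w)"
    using norm_triangle_ineq3[of "w - a" "z - a"] by (simp add: norm_minus_commute)
  finally show ?thesis using assms by (simp add: divide_right_mono)
qed

text \<open>A majorant of the indicator of the ball of radius 2 r whose integral over the circle is
  of order r by \<open>integral_power_distance\<close>; 9 = 3^2 normalises it to 1 at distance 2
  r.\<close>

definition tail_bump :: "real \<Rightarrow> complex \<Rightarrow> complex \<Rightarrow> real" where
  "tail_bump r a z = 9 * r\<^sup>2 * (r + norm (a - z)) powr (- 2)"

lemma tail_bump_nonneg: "0 \<le> tail_bump r a z"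
  by (simp add: tail_bump_def)

lemma tail_bump_ge_1:
  assumes "0 < r" "norm (z - a) \<le> 2 * r"
  shows "1 \<le> tail_bump r a z"
proof -
  have "r + norm (a - z) \<le> 3 * r" using assms by (simp add: norm_minus_commute)
  then have "(3 * r) powr (- 2) \<le> (r + norm (a - z)) powr (- 2)"
    using assms by (intro powr_mono2') (auto intro: add_pos_nonneg)
  then have "9 * r\<^sup>2 * (3 * r) powr (- 2) \<le> tail_bump r a z"
    unfolding tail_bump_def by (intro mult_left_mono) auto
  moreover have "9 * r\<^sup>2 * (3 * r) powr (- 2) = 1"
    using assms by (simp add: powr_minus powr_numeral power2_eq_square field_simps)
  ultimately show ?thesis by simp
qed

lemma tent_sq_le: assumes "0 < r" shows "(tent r a z)\<^sup>2 \<le> tail_bump r a z"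
proof (cases "norm (z - a) \<le> 2 * r")
  case True
  have "(tent r a z)\<^sup>2 \<le> 1\<^sup>2" using tent_bounds by (intro power_mono) auto
  then show ?thesis using tail_bump_ge_1[OF assms True] by simp
next
  case False
  then show ?thesis using tent_eq_0[OF assms, of z a] tail_bump_nonneg by simp
qed

text \<open>If both points are outside the support the difference is 0. Otherwise one bump is at
  least 1, and the difference is at most min(1, t/r) \<le> (t/r)^s.\<close>

lemma tent_diff_sq_le:
  assumes r: "0 < r" and s: "0 \<le> s" "s \<le> 1" and t: "0 < t" "norm (w - z) \<le> t"
  shows "(tent r a w - tent r a z)\<^sup>2 \<le> (t / r) powr (2 * s) * (tail_bump r a w + tail_bump r a z)"
proof (cases "norm (w - a) \<le> 2 * r \<or> norm (z - a) \<le> 2 * r")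
  case True
  then have "1 \<le> tail_bump r a w + tail_bump r a z"
    using tail_bump_ge_1[OF r] tail_bump_nonneg by (metis add_increasing add_increasing2)
  then have 1: "(t / r) powr (2 * s) \<le> (t / r) powr (2 * s) * (tail_bump r a w + tail_bump r a z)"
    by (simp add: mult_le_cancel_left1)
  define D where "D = \<bar>tent r a w - tent r a z\<bar>"
  have D1: "D \<le> 1" using tent_bounds[of r a w] tent_bounds[of r a z] by (auto simp: D_def)
  have D2: "D \<le> t / r"
    using tent_Lip[OF r, of a w z] t r unfolding D_def by (meson divide_right_mono less_imp_le order_trans)
  have "D \<le> 1 powr (1 - s) * (t / r) powr s"
    using D1 D2 s by (intro min_le_interp) (auto simp: D_def)
  then have "D\<^sup>2 \<le> ((t / r) powr s)\<^sup>2" by (intro power_mono) (auto simp: D_def)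
  also have "\<dots> = (t / r) powr (2 * s)" using powr_powr[of "t / r" s 2] r t by (simp add: mult.commute)
  finally show ?thesis using 1 by (simp add: D_def)
next
  case False
  then show ?thesis using tent_eq_0[OF r] tail_bump_nonneg by (simp add: mult_nonneg_nonneg)
qed

text \<open>With a maximum the values stay below 1 and are exactly 1 on every ball, so 1 minus it
  vanishes on a neighbourhood of the zero set; a sum would overshoot where balls overlap.\<close>

definition tents :: "nat set \<Rightarrow> (nat \<Rightarrow> complex) \<Rightarrow> (nat \<Rightarrow> real) \<Rightarrow> complex \<Rightarrow> real" where
  "tents I a r z = Max ((\<lambda>i. tent (r i) (a i) z) ` I)"

lemma tents_attained:
  assumes "finite I" "I \<noteq> {}"
  shows "\<exists>i\<in>I. tents I a r z = tent (r i) (a i) z"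
proof -
  have "tents I a r z \<in> (\<lambda>i. tent (r i) (a i) z) ` I"
    unfolding tents_def by (rule Max_in) (use assms in auto)
  then show ?thesis by auto
qed

lemma tents_ge: "finite I \<Longrightarrow> i \<in> I \<Longrightarrow> tent (r i) (a i) z \<le> tents I a r z"
  unfolding tents_def by (rule Max_ge) auto

lemma tents_bounds:
  assumes "finite I" "I \<noteq> {}"
  shows "0 \<le> tents I a r z" "tents I a r z \<le> 1"
  using tents_attained[OF assms, of a r z] tent_bounds by auto

lemma tents_eq_1:
  assumes "finite I" "i \<in> I" "0 < r i" "norm (z - a i) \<le> r i"
  shows "tents I a r z = 1"
  using tents_ge[OF assms(1,2), of r a z] tents_bounds[OF assms(1), of a r z] tent_eq_1[OF assms(3,4)] assms(2)
  by fastforce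

text \<open>The member attaining the maximum at the point with the larger value drops at least as
  much as the maximum does, for at the other point it lies below the maximum.\<close>

lemma tents_diff_attained:
  assumes "finite I" "I \<noteq> {}"
  shows "\<exists>i\<in>I. \<bar>tents I a r w - tents I a r z\<bar> \<le> \<bar>tent (r i) (a i) w - tent (r i) (a i) z\<bar>"
proof (cases "tents I a r z \<le> tents I a r w")
  case True
  obtain i where i: "i \<in> I" "tents I a r w = tent (r i) (a i) w" using tents_attained[OF assms] by blast
  then show ?thesis using tents_ge[OF assms(1) i(1), of r a z] True by (intro bexI[of _ i]) auto
next
  case False
  obtain i where i: "i \<in> I" "tents I a r z = tent (r i) (a i) z" using tents_attained[OF assms] by blast
  then show ?thesis using tents_ge[OF assms(1) i(1), of r a w] False by (intro bexI[of _ i]) auto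
qed

lemma tents_diff_sq_le:
  assumes "finite I" "I \<noteq> {}"
  shows "(tents I a r w - tents I a r z)\<^sup>2 \<le> (\<Sum>i\<in>I. (tent (r i) (a i) w - tent (r i) (a i) z)\<^sup>2)"
proof -
  obtain i where i: "i \<in> I" "\<bar>tents I a r w - tents I a r z\<bar> \<le> \<bar>tent (r i) (a i) w - tent (r i) (a i) z\<bar>"
    using tents_diff_attained[OF assms] by blast
  have "(tents I a r w - tents I a r z)\<^sup>2 \<le> (tent (r i) (a i) w - tent (r i) (a i) z)\<^sup>2"
    using i(2) by (rule abs_le_square_iff[THEN iffD1])
  also have "\<dots> \<le> (\<Sum>i\<in>I. (tent (r i) (a i) w - tent (r i) (a i) z)\<^sup>2)"
    using assms(1) i(1) by (intro member_le_sum) auto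
  finally show ?thesis .
qed

lemma tents_sq_le:
  assumes "finite I" "I \<noteq> {}"
  shows "(tents I a r z)\<^sup>2 \<le> (\<Sum>i\<in>I. (tent (r i) (a i) z)\<^sup>2)"
proof -
  obtain i where i: "i \<in> I" "tents I a r z = tent (r i) (a i) z" using tents_attained[OF assms] by blast
  have "(tent (r i) (a i) z)\<^sup>2 \<le> (\<Sum>i\<in>I. (tent (r i) (a i) z)\<^sup>2)"
    using assms(1) i(1) by (intro member_le_sum) auto
  then show ?thesis using i(2) by simp
qed

lemma tents_Lip:
  assumes "finite I" "I \<noteq> {}" and r: "\<And>i. i \<in> I \<Longrightarrow> 0 < r i"
  shows "\<bar>tents I a r w - tents I a r z\<bar> \<le> (\<Sum>i\<in>I. 1 / r i) * norm (w - z)"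
proof -
  obtain i where i: "i \<in> I" "\<bar>tents I a r w - tents I a r z\<bar> \<le> \<bar>tent (r i) (a i) w - tent (r i) (a i) z\<bar>"
    using tents_diff_attained[OF assms(1,2)] by blast
  note i(2)
  also have "\<bar>tent (r i) (a i) w - tent (r i) (a i) z\<bar> \<le> 1 / r i * norm (w - z)"
    using tent_Lip[OF r[OF i(1)], of "a i" w z] by simp
  also have "1 / r i \<le> (\<Sum>i\<in>I. 1 / r i)"
    using assms(1) i(1) r by (intro member_le_sum) (auto simp: less_imp_le)
  finally show ?thesis by (simp add: mult_right_mono)
qed

lemma of_real_tents_Lip:
  assumes "finite I" "I \<noteq> {}" and r: "\<And>i. i \<in> I \<Longrightarrow> 0 < r i"
  shows "(\<lambda>z. of_real (tents I a r z)) \<in> Lip 1"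
proof -
  have "(\<Sum>i\<in>I. 1 / r i) > 0" using assms by (intro sum_pos) auto
  moreover have "norm (of_real (tents I a r z) - of_real (tents I a r w) :: complex) \<le> (\<Sum>i\<in>I. 1 / r i) * norm (z - w) powr 1" for z w
    using tents_Lip[OF assms, where a = a and w = z and z = w] by (simp flip: of_real_diff)
  ultimately show ?thesis unfolding Lip_def by blast
qed

lemma integral_tail_bump_le:
  assumes C: "\<And>t w. t > 0 \<Longrightarrow> w \<in> circle \<Longrightarrow> pint (\<lambda>x. (t + norm (w - cis x)) powr (- 2)) \<le> C * t powr (- 2 + 1)"
    and r: "0 < r" and a: "a \<in> circle"
  shows "cper (\<lambda>x. tail_bump r a (cis x))" "pint (\<lambda>x. tail_bump r a (cis x)) \<le> 9 * C * r"
proof -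
  have nz: "r + norm (a - z) \<noteq> 0" for z using r by (smt (verit) norm_ge_zero)
  show "cper (\<lambda>x. tail_bump r a (cis x))"
    by (rule cper_compose_cis) (use nz in \<open>auto simp: tail_bump_def intro!: continuous_intros\<close>)
  have "pint (\<lambda>x. tail_bump r a (cis x)) = 9 * r\<^sup>2 * pint (\<lambda>x. (r + norm (a - cis x)) powr (- 2))"
    by (simp add: tail_bump_def)
  also have "\<dots> \<le> 9 * r\<^sup>2 * (C * r powr (- 2 + 1))"
    by (rule mult_left_mono[OF C[OF r a]]) simp
  also have "\<dots> = 9 * C * r" using r by (simp add: powr_minus power2_eq_square field_simps)
  finally show "pint (\<lambda>x. tail_bump r a (cis x)) \<le> 9 * C * r" .
qed

text \<open>A bump has integral of order r, and (t/r)^(2s) * r = t^(2s) * r^(1 - 2s); this is how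
  the covering sum enters. The 18 is twice the 9 of the bump, for the two endpoints of an
  increment.\<close>

lemma tents_coef_small:
  assumes p: "1 < p" "p < 2" and s: "1 / p - 1 / 2 < s" "2 * s < 1" and e: "e > 0"
  shows "\<exists>\<eta>>0. \<forall>(I::nat set) a r. finite I \<longrightarrow> I \<noteq> {} \<longrightarrow> (\<forall>i\<in>I. a i \<in> circle \<and> 0 < r i) \<longrightarrow>
     (\<Sum>i\<in>I. r i powr (1 - 2 * s)) \<le> \<eta> \<longrightarrow> p_small p e (coef (\<lambda>x. of_real (tents I a r (cis x))))"
proof -
  have s0: "s > 0"
    using critical_exponent_pos[OF p] s by linarith
  from coef_p_small_eps[OF p s(1) e] obtain B where B: "B > 0" and
    small: "\<forall>F. L2_modulus s B F \<longrightarrow> p_small p e (coef F)"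
    by (elim exE conjE)
  have "- 2 < (- 1 :: real)" by simp
  from integral_power_distance[OF this] obtain C where C: "C > 0" and
    CI: "\<forall>t>0. \<forall>w\<in>circle. pint (\<lambda>x. (t + norm (w - cis x)) powr (- 2)) \<le> C * t powr (- 2 + 1)"
    by (elim exE conjE)
  define \<eta> where "\<eta> = min 1 (B / (18 * C))"
  have eta: "\<eta> > 0" "\<eta> \<le> 1" using B C by (auto simp: \<eta>_def)
  have etaB: "18 * C * \<eta> \<le> B"
  proof -
    have "18 * C * \<eta> \<le> 18 * C * (B / (18 * C))" using C by (intro mult_left_mono) (auto simp: \<eta>_def)
    then show ?thesis using C by simp
  qed
  show ?thesis
  proof (intro exI[of _ \<eta>] conjI eta allI impI)
    fix I :: "nat set" and a r
    assume I: "finite I" "I \<noteq> {}" and ar: "\<forall>i\<in>I. a i \<in> circle \<and> 0 < r i"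
      and sum: "(\<Sum>i\<in>I. r i powr (1 - 2 * s)) \<le> \<eta>"
    define F where "F x = complex_of_real (tents I a r (cis x))" for x
    have r: "0 < r i" if "i \<in> I" for i using ar that by blast
    have F: "cper F" unfolding F_def
      by (rule cper_compose_cis[OF Lip_continuous[OF of_real_tents_Lip[OF I r]]]) auto
    define b where "b i = (\<lambda>x. tail_bump (r i) (a i) (cis x))" for i
    have b: "cper (b i)" "pint (b i) \<le> 9 * C * r i" if "i \<in> I" for i
      using integral_tail_bump_le[OF CI[rule_format], of "r i" "a i"] ar that by (auto simp: b_def)
    have "p_small p e (coef F)"
    proof (rule small[rule_format, OF L2_modulusI[OF F]])
      have "pint (\<lambda>x. (norm (F x))\<^sup>2) \<le> pint (\<lambda>x. \<Sum>i\<in>I. b i x)"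
      proof (rule integral_le)
        fix x
        have "(norm (F x))\<^sup>2 = (tents I a r (cis x))\<^sup>2" by (simp add: F_def)
        also have "\<dots> \<le> (\<Sum>i\<in>I. (tent (r i) (a i) (cis x))\<^sup>2)" by (rule tents_sq_le[OF I])
        also have "\<dots> \<le> (\<Sum>i\<in>I. b i x)" unfolding b_def by (intro sum_mono tent_sq_le r)
        finally show "(norm (F x))\<^sup>2 \<le> (\<Sum>i\<in>I. b i x)" .
      next
        show "(\<lambda>x. (norm (F x))\<^sup>2) integrable_on {0..2 * pi}" by (intro cper_integrable cper_power cper_norm F)
        show "(\<lambda>x. \<Sum>i\<in>I. b i x) integrable_on {0..2 * pi}" by (intro cper_integrable cper_sum b(1))
      qed
      also have "\<dots> = (\<Sum>i\<in>I. pint (b i))"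
        by (rule hk_integral_sum[OF I(1)]) (intro cper_integrable b(1))
      also have "\<dots> \<le> (\<Sum>i\<in>I. 9 * C * r i powr (1 - 2 * s))"
      proof (rule sum_mono)
        fix i assume i: "i \<in> I"
        \<comment> \<open>The L^2 norm produces r instead of r^(1 - 2s). As \<eta> \<le> 1, no
          radius exceeds 1, and then r \<le> r^(1 - 2s).\<close>
        have "r i powr (1 - 2 * s) \<le> (\<Sum>i\<in>I. r i powr (1 - 2 * s))"
          using I(1) i by (intro member_le_sum) auto
        then have "r i powr (1 - 2 * s) \<le> 1" using sum eta by linarith
        then have r1: "r i \<le> 1"
          using r[OF i] s powr_less_mono2[of "1 - 2 * s" 1 "r i"] by fastforce
        have "r i = r i powr 1" using r[OF i] by simp
        also have "\<dots> \<le> r i powr (1 - 2 * s)" using r[OF i] r1 s0 by (intro powr_mono') auto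
        finally show "pint (b i) \<le> 9 * C * r i powr (1 - 2 * s)"
          using b(2)[OF i] C by (smt (verit) mult_left_mono)
      qed
      also have "\<dots> = 9 * C * (\<Sum>i\<in>I. r i powr (1 - 2 * s))" by (simp only: sum_distrib_left)
      also have "\<dots> \<le> 9 * C * \<eta>" using C sum by (intro mult_left_mono) auto
      also have "\<dots> \<le> 18 * C * \<eta>" using C eta by (intro mult_right_mono) auto
      finally show "pint (\<lambda>x. (norm (F x))\<^sup>2) \<le> B" using etaB by linarith
    next
      fix t :: real assume t: "0 < t" "t \<le> 1"
      define G where "G i x = (t / r i) powr (2 * s) * (b i (x + t) + b i x)" for i x
      have G: "cper (G i)" if "i \<in> I" for i
        unfolding G_def by (intro cper_mult cper_const cper_add cper_shift[OF b(1)] b(1) that)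
      have "pint (\<lambda>x. (norm (F (x + t) - F x))\<^sup>2) \<le> pint (\<lambda>x. \<Sum>i\<in>I. G i x)"
      proof (rule integral_le)
        fix x
        have "(norm (F (x + t) - F x))\<^sup>2 = (tents I a r (cis (x + t)) - tents I a r (cis x))\<^sup>2"
          unfolding F_def of_real_diff[symmetric] norm_of_real by simp
        also have "\<dots> \<le> (\<Sum>i\<in>I. (tent (r i) (a i) (cis (x + t)) - tent (r i) (a i) (cis x))\<^sup>2)"
          by (rule tents_diff_sq_le[OF I])
        also have "\<dots> \<le> (\<Sum>i\<in>I. G i x)"
        proof (rule sum_mono)
          fix i assume i: "i \<in> I"
          have "norm (cis (x + t) - cis x) \<le> t" using norm_cis_diff_le[of "x + t" x] t by simp
          then show "(tent (r i) (a i) (cis (x + t)) - tent (r i) (a i) (cis x))\<^sup>2 \<le> G i x"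
            unfolding G_def b_def using s s0 t by (intro tent_diff_sq_le r i) auto
        qed
        finally show "(norm (F (x + t) - F x))\<^sup>2 \<le> (\<Sum>i\<in>I. G i x)" .
      next
        show "(\<lambda>x. (norm (F (x + t) - F x))\<^sup>2) integrable_on {0..2 * pi}"
          by (intro cper_integrable cper_power cper_norm cper_diff cper_shift[OF F] F)
        show "(\<lambda>x. \<Sum>i\<in>I. G i x) integrable_on {0..2 * pi}" by (intro cper_integrable cper_sum G)
      qed
      also have "\<dots> = (\<Sum>i\<in>I. pint (G i))"
        by (rule hk_integral_sum[OF I(1)]) (intro cper_integrable G)
      also have "\<dots> \<le> (\<Sum>i\<in>I. t powr (2 * s) * (18 * C * r i powr (1 - 2 * s)))"
      proof (rule sum_mono)
        fix i assume i: "i \<in> I"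
        have "pint (G i) = (t / r i) powr (2 * s) * (pint (\<lambda>x. b i (x + t)) + pint (b i))"
        proof -
          have "pint (\<lambda>x. b i (x + t) + b i x) = pint (\<lambda>x. b i (x + t)) + pint (b i)"
            by (rule hk_integral_add)
               (rule cper_integrable[OF cper_shift[OF b(1)[OF i]]], rule cper_integrable[OF b(1)[OF i]])
          then show ?thesis unfolding G_def by simp
        qed
        also have "\<dots> = (t / r i) powr (2 * s) * (2 * pint (b i))"
          unfolding integral_shift_period[OF b(1)[OF i]] by simp
        also have "\<dots> \<le> (t / r i) powr (2 * s) * (2 * (9 * C * r i))"
          using b(2)[OF i] by (intro mult_left_mono) auto
        also have "\<dots> = t powr (2 * s) * (18 * C * r i powr (1 - 2 * s))"
          using r[OF i] t by (simp add: powr_divide powr_diff)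
        finally show "pint (G i) \<le> t powr (2 * s) * (18 * C * r i powr (1 - 2 * s))" .
      qed
      also have "\<dots> = t powr (2 * s) * (18 * C * (\<Sum>i\<in>I. r i powr (1 - 2 * s)))"
        by (simp only: sum_distrib_left)
      also have "\<dots> \<le> t powr (2 * s) * (18 * C * \<eta>)" using C sum by (intro mult_left_mono) auto
      also have "\<dots> \<le> t powr (2 * s) * B" using etaB by (intro mult_left_mono) auto
      finally show "pint (\<lambda>x. (norm (F (x + t) - F x))\<^sup>2) \<le> B * t powr (2 * s)"
        by (simp add: mult.commute)
    qed
    then show "p_small p e (coef (\<lambda>x. of_real (tents I a r (cis x))))" unfolding F_def .
  qed
qed

text \<open>The quotient is extended by zero into the balls, where the numerator vanishes.\<close>

lemma Lip_tents_quotient: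
  assumes f: "f \<in> Lip \<delta>" and \<delta>: "0 < \<delta>" "\<delta> \<le> 1"
    and I: "finite I" "I \<noteq> {}" and r: "\<And>i. i \<in> I \<Longrightarrow> 0 < r i"
    and cov: "zeros f \<subseteq> (\<Union>i\<in>I. ball (a i) (r i))"
  shows "\<exists>b\<in>Lip \<delta>. \<forall>z\<in>circle. f z * b z = 1 - of_real (tents I a r z)"
proof -
  define W where "W = {z \<in> circle. \<forall>i\<in>I. r i \<le> norm (z - a i)}"
  have fc: "continuous_on circle f" by (rule Lip_continuous[OF f \<delta>(1)])
  have Wc: "compact W"
  proof -
    have "W = circle \<inter> (\<Inter>i\<in>I. {z. r i \<le> norm (z - a i)})" using I by (auto simp: W_def)
    moreover have "closed (\<Inter>i\<in>I. {z. r i \<le> norm (z - a i)})"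
      by (intro closed_INT ballI closed_Collect_le continuous_intros)
    ultimately show ?thesis by (simp add: compact_Int_closed)
  qed
  have Wnz: "f z \<noteq> 0" if "z \<in> W" for z
  proof
    assume "f z = 0"
    then have "z \<in> zeros f" using that by (simp add: zeros_def W_def)
    then obtain i where "i \<in> I" "dist (a i) z < r i" using cov by auto
    then show False using that by (auto simp: W_def dist_norm norm_minus_commute)
  qed
  \<comment> \<open>If the balls cover the circle there is no minimum to attain, and any positive
    \<open>c\<close> will do.\<close>
  obtain c where c: "c > 0" "\<And>z. z \<in> W \<Longrightarrow> c \<le> norm (f z)"
  proof (cases "W = {}")
    case True
    then show ?thesis using that[of 1] by simp
  next
    case False
    have "continuous_on W (\<lambda>z. norm (f z))"
      by (intro continuous_intros continuous_on_subset[OF fc]) (auto simp: W_def)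
    from continuous_attains_inf[OF Wc False this] obtain z0 where "z0 \<in> W" "\<And>z. z \<in> W \<Longrightarrow> norm (f z0) \<le> norm (f z)"
      by blast
    then show ?thesis using that[of "norm (f z0)"] Wnz by auto
  qed
  define X where "X = tents I a r"
  define b where "b z = (if z \<in> W then (1 - of_real (X z)) / f z else 0)" for z
  have X1: "X z = 1" if "z \<in> circle" "z \<notin> W" for z
  proof -
    obtain i where i: "i \<in> I" "norm (z - a i) < r i" using \<open>z \<notin> W\<close> \<open>z \<in> circle\<close> by (auto simp: W_def not_le)
    then show ?thesis unfolding X_def using tents_eq_1[of I i r z a] I(1) i r[OF i(1)] by simp
  qed
  have X01: "0 \<le> X z" "X z \<le> 1" for z unfolding X_def by (rule tents_bounds[OF I])+
  obtain L where L: "L > 0" and Lf: "\<And>x y. x \<in> circle \<Longrightarrow> y \<in> circle \<Longrightarrow> norm (f x - f y) \<le> L * norm (x - y) powr \<delta>"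
    using f by (auto simp: Lip_def)
  have "(\<lambda>z. of_real (X z)) \<in> Lip \<delta>"
    unfolding X_def using Lip_weaken[OF of_real_tents_Lip[OF I r] \<delta>(2)] by simp
  then obtain M where M: "M > 0" and LX: "\<And>x y. x \<in> circle \<Longrightarrow> y \<in> circle \<Longrightarrow> norm (of_real (X x) - of_real (X y) :: complex) \<le> M * norm (x - y) powr \<delta>"
    by (auto simp: Lip_def)
  define K where "K = L / c\<^sup>2 + M / c"
  have K: "K > 0" "M / c \<le> K" using L M c by (auto simp: K_def intro: add_pos_pos)
  \<comment> \<open>At such a \<open>y\<close> both \<open>b y\<close> and 1 - X y vanish, so the
    difference is (X y - X x) / f x; the denominator is at the point of \<open>W\<close>, although f
    may vanish at \<open>y\<close>.\<close>
  have one: "norm (b x - b y) \<le> K * norm (x - y) powr \<delta>" if x: "x \<in> W" and y: "y \<in> circle" "y \<notin> W" for x y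
  proof -
    have xc: "x \<in> circle" using x by (simp add: W_def)
    have "norm (b x - b y) = norm (of_real (X x) - of_real (X y) :: complex) / norm (f x)"
      using x y X1[OF y] by (simp add: b_def norm_divide norm_minus_commute)
    also have "\<dots> \<le> (M * norm (x - y) powr \<delta>) / c"
      using LX[OF xc y(1)] c x M by (intro frac_le) auto
    also have "\<dots> \<le> K * norm (x - y) powr \<delta>"
      using mult_right_mono[OF K(2), of "norm (x - y) powr \<delta>"] by simp
    finally show ?thesis .
  qed
  have "norm (b x - b y) \<le> K * norm (x - y) powr \<delta>" if x: "x \<in> circle" and y: "y \<in> circle" for x y
  proof (cases "x \<in> W"; cases "y \<in> W")
    assume xW: "x \<in> W" and yW: "y \<in> W"
    have "b x - b y = (1 - of_real (X x)) * (f y - f x) / (f x * f y) + (of_real (X y) - of_real (X x)) / f y"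
      using Wnz[OF xW] Wnz[OF yW] xW yW by (simp add: b_def field_simps)
    then have "norm (b x - b y) \<le> norm ((1 - of_real (X x)) * (f y - f x) / (f x * f y)) + norm ((of_real (X y) - of_real (X x)) / f y)"
      by (metis norm_triangle_ineq)
    also have "norm ((1 - of_real (X x)) * (f y - f x) / (f x * f y)) \<le> (1 * (L * norm (x - y) powr \<delta>)) / (c * c)"
    proof -
      have "norm (1 - of_real (X x) :: complex) \<le> 1"
      proof -
        have "norm (1 - of_real (X x) :: complex) = \<bar>1 - X x\<bar>"
          by (metis norm_of_real of_real_1 of_real_diff)
        then show ?thesis using X01[of x] by simp
      qed
      then show ?thesis
        unfolding norm_divide norm_mult
        using Lf[OF y x] c(1) c(2)[OF xW] c(2)[OF yW] L
        by (intro frac_le mult_mono) (auto simp: norm_minus_commute)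
    qed
    also have "norm ((of_real (X y) - of_real (X x)) / f y) \<le> (M * norm (x - y) powr \<delta>) / c"
      unfolding norm_divide using LX[OF y x] c(1) c(2)[OF yW] M by (intro frac_le) (auto simp: norm_minus_commute)
    also have "(1 * (L * norm (x - y) powr \<delta>)) / (c * c) + (M * norm (x - y) powr \<delta>) / c = K * norm (x - y) powr \<delta>"
      by (simp add: K_def power2_eq_square distrib_right)
    finally show ?thesis by simp
  next
    assume "x \<notin> W" "y \<in> W"
    then show ?thesis using one[of y x] x by (simp add: norm_minus_commute[of x] norm_minus_commute[of "b x"])
  next
    assume "x \<in> W" "y \<notin> W"
    then show ?thesis using one[OF _ y] by simp
  next
    assume "x \<notin> W" "y \<notin> W"
    then show ?thesis using K by (simp add: b_def)
  qed
  then have "b \<in> Lip \<delta>" unfolding Lip_def using K(1) by blast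
  moreover have "f z * b z = 1 - of_real (tents I a r z)" if "z \<in> circle" for z
    using that X1[of z] Wnz[of z] by (auto simp: b_def X_def)
  ultimately show ?thesis by blast
qed

section \<open>Cyclicity\<close>

text \<open>Since 2(p - 1)/p = 1 - 2(1/p - 1/2), the choice s = (1 - \<sigma>)/2 turns an admissible
  Hausdorff exponent \<sigma> below the bound into a smoothness above the critical one.\<close>

lemma ex_between_dimension:
  fixes Z :: "complex set" and p :: real
  assumes p: "1 < p" "p < 2" and dim: "hausdorff_dim Z < ennreal (2 * (p - 1) / p)"
  shows "\<exists>s \<sigma>. 1 / p - 1 / 2 < s \<and> 2 * s < 1 \<and> \<sigma> \<le> 1 - 2 * s \<and> hausdorff_measure \<sigma> Z = 0"
proof -
  obtain \<sigma> where \<sigma>: "0 < \<sigma>" "hausdorff_measure \<sigma> Z = 0" "ennreal \<sigma> < ennreal (2 * (p - 1) / p)"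
    using dim unfolding hausdorff_dim_def INF_less_iff by blast
  then have "\<sigma> < 2 * (p - 1) / p" by (simp add: ennreal_less_iff)
  also have "2 * (p - 1) / p = 1 - 2 * (1 / p - 1 / 2)" using p by (simp add: field_simps)
  finally have *: "\<sigma> < 1 - 2 * (1 / p - 1 / 2)" .
  have "q < (1 - \<sigma>) / 2" if "\<sigma> < 1 - 2 * q" for q using that by simp
  from this[OF *] have lt: "1 / p - 1 / 2 < (1 - \<sigma>) / 2" .
  have eq: "2 * ((1 - \<sigma>) / 2) = 1 - \<sigma>" by simp
  show ?thesis
  proof (intro exI conjI)
    show "1 / p - 1 / 2 < (1 - \<sigma>) / 2" by (rule lt)
    show "2 * ((1 - \<sigma>) / 2) < 1" unfolding eq using \<sigma>(1) by simp
    show "\<sigma> \<le> 1 - 2 * ((1 - \<sigma>) / 2)" unfolding eq by simp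
    show "hausdorff_measure \<sigma> Z = 0" by (rule \<sigma>(2))
  qed
qed

text \<open>The order of choices matters: the covering fixes the cutoff and the quotient
  \<open>b\<close>, whose Hoelder constant may be huge; the accuracy \<theta> is chosen for that
  constant, and the degree \<open>N\<close> for \<theta>. The polynomial has negative frequencies as
  well, which is why \<open>inv\<close> ranges over all integers.\<close>

lemma delta_in_closure:
  assumes p: "1 < p" "p < 2" and u: "u \<in> ell 1"
    and \<delta>: "1 / p - 1 / 2 < \<delta>" "\<delta> \<le> 1" and f: "fourier u \<in> Lip \<delta>"
    and ne: "zeros (fourier u) \<noteq> {}" and comp: "compact (zeros (fourier u))"
    and dim: "hausdorff_dim (zeros (fourier u)) < ennreal (2 * (p - 1) / p)"
    and inv: "\<And>i. bishift i u \<in> p_closure p (forward_span u)"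
  shows "delta \<in> p_closure p (forward_span u)"
proof (rule p_closure_closed)
  let ?L = "p_closure p (forward_span u)"
  show p0: "p > 0" using p by simp
  have sub: "seq.subspace ?L" by (rule p_closure_subspace[OF p0 seq.subspace_span])
  fix e :: real assume e: "e > 0"
  define e' where "e' = e / (2 * 2 powr p)"
  have e': "e' > 0" using e by (simp add: e'_def)
  define f where "f = fourier u"
  define Z where "Z = zeros f"
  have fL: "f \<in> Lip \<delta>" using f by (simp add: f_def)
  have \<delta>0: "\<delta> > 0"
    using critical_exponent_pos[OF p] \<delta> by linarith
  have fc: "continuous_on circle f" by (rule Lip_continuous[OF fL \<delta>0])
  from ex_between_dimension[OF p dim] obtain s \<sigma> where s: "1 / p - 1 / 2 < s" "2 * s < 1"
    and \<sigma>: "\<sigma> \<le> 1 - 2 * s" "hausdorff_measure \<sigma> Z = 0"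
    unfolding Z_def f_def by blast
  have s0: "s > 0"
    using critical_exponent_pos[OF p] s by linarith
  from tents_coef_small[OF p s e'] obtain \<eta> where eta: "\<eta> > 0" and
    tsmall: "\<forall>(I::nat set) a r. finite I \<longrightarrow> I \<noteq> {} \<longrightarrow> (\<forall>i\<in>I. a i \<in> circle \<and> 0 < r i) \<longrightarrow>
     (\<Sum>i\<in>I. r i powr (1 - 2 * s)) \<le> \<eta> \<longrightarrow> p_small p e' (coef (\<lambda>x. of_real (tents I a r (cis x))))"
    by (elim exE conjE)
  have "compact Z" using comp by (simp add: Z_def f_def)
  from hausdorff_null_finite_cover[OF this \<sigma>(2,1) _ _ eta] obtain I :: "nat set" and a r where
    I: "finite I" and ar: "\<forall>i\<in>I. a i \<in> Z \<and> 0 < r i" and cov: "Z \<subseteq> (\<Union>i\<in>I. ball (a i) (r i))"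
    and sum: "(\<Sum>i\<in>I. r i powr (1 - 2 * s)) \<le> \<eta>"
    using s s0 by auto
  have I0: "I \<noteq> {}" using cov ne by (auto simp: Z_def f_def)
  have r: "0 < r i" if "i \<in> I" for i using ar that by blast
  have ac: "\<forall>i\<in>I. a i \<in> circle \<and> 0 < r i" using ar by (auto simp: Z_def zeros_def)
  define X where "X z = complex_of_real (tents I a r z)" for z
  have Xs: "p_small p e' (coef (\<lambda>x. X (cis x)))"
    unfolding X_def using tsmall I I0 ac sum by blast
  have Xc: "continuous_on circle X"
    unfolding X_def by (rule Lip_continuous[OF of_real_tents_Lip[OF I I0 r]]) auto
  obtain b where b: "b \<in> Lip \<delta>" and fb: "\<And>z. z \<in> circle \<Longrightarrow> f z * b z = 1 - X z"
    using Lip_tents_quotient[OF fL \<delta>0 \<delta>(2) I I0 r cov[unfolded Z_def]] unfolding X_def by blast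
  have bc: "continuous_on circle b" by (rule Lip_continuous[OF b \<delta>0])
  obtain C where C: "C > 0" and bL: "\<And>z w. z \<in> circle \<Longrightarrow> w \<in> circle \<Longrightarrow> norm (b z - b w) \<le> C * norm (z - w) powr \<delta>"
    using b by (auto simp: Lip_def)
  \<comment> \<open>Both \<open>b\<close> and its approximation have Hoelder constant
    \<open>C\<close>, so their difference has 2 C.\<close>
  have C2: "2 * C > 0" using C by simp
  from Lip_mult_coef_small[OF p \<delta>(1) fL e' C2] obtain \<theta> where th: "\<theta> > 0" and
    prod: "\<forall>g. continuous_on circle g \<longrightarrow> (\<forall>z\<in>circle. norm (g z) \<le> \<theta>) \<longrightarrow>
     (\<forall>z\<in>circle. \<forall>w\<in>circle. norm (g z - g w) \<le> 2 * C * norm (z - w) powr \<delta>) \<longrightarrow>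
     p_small p e' (coef (\<lambda>x. f (cis x) * g (cis x)))"
    by (elim exE conjE)
  have "\<delta> \<le> 2" using \<delta> by simp
  from Lip_trigonometric_approx[OF bc C \<delta>0 this bL th] obtain N \<beta> where
    T1: "\<And>x. norm (b (cis x) - trig_poly N \<beta> x) \<le> \<theta>" and
    T2: "\<And>x y. norm (trig_poly N \<beta> x - trig_poly N \<beta> y)
       \<le> C * norm (cis x - cis y) powr \<delta>"
    by blast
  \<comment> \<open>The approximation comes as a function of the angle; integer powers make it a
    function on the circle, the form that \<open>Lip_mult_coef_small\<close> takes.\<close>
  define T where "T z = (\<Sum>i\<le>N. \<Sum>j\<le>N. \<beta> i j * z powi (int j - int i))" for z :: complex
  have T: "T (cis x) = trig_poly N \<beta> x" for x
    by (simp only: T_def cis_power_int)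
  have Tc: "continuous_on circle T" unfolding T_def by (intro continuous_intros) auto
  define g where "g z = b z - T z" for z
  have gc: "continuous_on circle g" unfolding g_def by (intro continuous_intros bc Tc)
  have circ: "\<exists>x. z = cis x" if "z \<in> circle" for z
    using that by (metis complex_norm_eq_1_exp cis_conv_exp mem_sphere_0)
  have gs: "p_small p e' (coef (\<lambda>x. f (cis x) * g (cis x)))"
  proof (rule prod[rule_format, OF gc])
    fix z :: complex assume "z \<in> circle"
    then obtain x where "z = cis x" using circ by blast
    then show "norm (g z) \<le> \<theta>" using T1[of x] by (simp add: g_def T)
  next
    fix z w :: complex assume z: "z \<in> circle" and w: "w \<in> circle"
    then obtain x y where xy: "z = cis x" "w = cis y" using circ by meson
    have "norm (g z - g w) \<le> norm (b z - b w) + norm (T z - T w)"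
      using norm_triangle_ineq4[of "b z - b w" "T z - T w"] by (simp add: g_def algebra_simps)
    also have "\<dots> \<le> C * norm (z - w) powr \<delta> + C * norm (z - w) powr \<delta>"
      using bL[OF z w] T2[of x y] by (intro add_mono) (simp_all add: xy T)
    finally show "norm (g z - g w) \<le> 2 * C * norm (z - w) powr \<delta>" by simp
  qed
  define w where "w = (\<Sum>i\<le>N. \<Sum>j\<le>N. seq_scale (\<beta> i j) (bishift (int j - int i) u))"
  have wL: "w \<in> ?L" unfolding w_def
    by (intro seq.subspace_sum[OF sub] seq.subspace_scale[OF sub] inv)
  have fper: "cper (\<lambda>x. f (cis x))" by (rule cper_compose_cis[OF fc])
  have cu: "coef (\<lambda>x. f (cis x)) = u" using coef_fourier[OF u] fper by (simp add: f_def)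
  have cw: "coef (\<lambda>x. f (cis x) * T (cis x)) n = w n" for n
  proof -
    have per: "cper (\<lambda>x. \<beta> i j * (cis (of_int (int j - int i) * x) * f (cis x)))" for i j
      by (intro cper_mult cper_const cper_cis fper)
    have "f (cis x) * T (cis x) = (\<Sum>i\<le>N. \<Sum>j\<le>N. \<beta> i j * (cis (of_int (int j - int i) * x) * f (cis x)))" for x
      unfolding T sum_distrib_left by (simp only: mult_ac)
    then have "coef (\<lambda>x. f (cis x) * T (cis x)) n = coef (\<lambda>x. \<Sum>i\<le>N. \<Sum>j\<le>N. \<beta> i j * (cis (of_int (int j - int i) * x) * f (cis x))) n"
      by (simp only:)
    also have "\<dots> = (\<Sum>i\<le>N. coef (\<lambda>x. \<Sum>j\<le>N. \<beta> i j * (cis (of_int (int j - int i) * x) * f (cis x))) n)"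
      by (rule coef_sum) (intro finite_atMost cper_sum per)+
    also have "\<dots> = (\<Sum>i\<le>N. \<Sum>j\<le>N. coef (\<lambda>x. \<beta> i j * (cis (of_int (int j - int i) * x) * f (cis x))) n)"
      by (intro sum.cong refl coef_sum finite_atMost per)
    also have "\<dots> = (\<Sum>i\<le>N. \<Sum>j\<le>N. \<beta> i j * u (n - (int j - int i)))"
      unfolding coef_scale coef_cis_mult cu ..
    also have "\<dots> = w n"
    proof -
      have app: "(sum F {..N}) n = (\<Sum>i\<le>N. F i n)" for F :: "nat \<Rightarrow> int \<Rightarrow> complex"
        by (induction N) auto
      show ?thesis unfolding w_def app by (simp add: seq_scale_def bishift_def)
    qed
    finally show ?thesis .
  qed
  have "delta n - w n = coef (\<lambda>x. X (cis x)) n + coef (\<lambda>x. f (cis x) * g (cis x)) n" for n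
  proof -
    have Tper: "cper (\<lambda>x. f (cis x) * T (cis x))" by (intro cper_mult fper cper_compose_cis[OF Tc])
    have Xper: "cper (\<lambda>x. X (cis x))" by (rule cper_compose_cis[OF Xc])
    have gper: "cper (\<lambda>x. f (cis x) * g (cis x))" by (intro cper_mult fper cper_compose_cis[OF gc])
    have "delta n = coef (\<lambda>x. 1) n" using coef_cis[of 0 n] by (simp add: delta_def)
    then have "delta n - w n = coef (\<lambda>x. 1 - f (cis x) * T (cis x)) n"
      using coef_diff[OF cper_const Tper, of 1 n] cw by simp
    also have "(\<lambda>x. 1 - f (cis x) * T (cis x)) = (\<lambda>x. X (cis x) + f (cis x) * g (cis x))"
    proof
      fix x
      show "1 - f (cis x) * T (cis x) = X (cis x) + f (cis x) * g (cis x)"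
        using fb[of "cis x"] by (simp add: g_def algebra_simps)
    qed
    finally show ?thesis using coef_add[OF Xper gper] by simp
  qed
  moreover have "p_small p e (\<lambda>n. coef (\<lambda>x. X (cis x)) n + coef (\<lambda>x. f (cis x) * g (cis x)) n)"
    by (rule p_small_add_half[OF p0]) (use Xs gs in \<open>simp_all add: e'_def\<close>)
  ultimately have "p_small p e (\<lambda>n. delta n - w n)" by (simp only:)
  then show "\<exists>w\<in>?L. p_small p e (\<lambda>n. delta n - w n)" using wL by blast
qed

text \<open>Excludes an empty zero set in \<open>mainTheorem3\<close>; here the value 2 of the
  distance to the empty set enters.\<close>

lemma log_dist_empty_circle_L1: "log_dist {} \<in> circle_L1"
proof -
  have eq: "log_dist {} = (\<lambda>z. ereal (ln 2))" by (simp add: log_dist_def circle_dist_def fun_eq_iff)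
  have "(\<integral>\<^sup>+ \<zeta>. e2ennreal \<bar>ereal (ln 2)\<bar> \<partial>circle_measure) =
      (\<integral>\<^sup>+ x. e2ennreal \<bar>ereal (ln 2)\<bar> \<partial>restrict_space lborel {0..<2 * pi})"
    unfolding circle_measure_def by (rule nn_integral_distr[OF measurable_cis_circle]) simp
  also have "\<dots> = ennreal (ln 2) * ennreal (2 * pi)"
    by (simp add: emeasure_restrict_space space_restrict_space)
  also have "\<dots> < \<infinity>" by (simp add: ennreal_mult_less_top)
  finally show ?thesis unfolding eq circle_L1_def by simp
qed

lemma compact_zeros:
  assumes "continuous_on circle f"
  shows "compact (zeros f)"
proof -
  have "closed (circle \<inter> f -` {0})"
    by (rule continuous_closed_preimage[OF assms]) auto
  moreover have "zeros f = circle \<inter> f -` {0}" by (auto simp: zeros_def)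
  ultimately show ?thesis by (simp add: compact_eq_bounded_closed bounded_Int)
qed

theorem mainTheorem3:
  fixes p :: real and u :: "int \<Rightarrow> complex"
  assumes "1 < p" and "p < 2"
    and "u \<in> ell 1"
    and "\<exists>\<delta>. \<delta> > 1 / p - 1 / 2 \<and> fourier u \<in> Lip \<delta>"
    and "hausdorff_dim (zeros (fourier u)) < ennreal (2 * (p - 1) / p)"
    and "log_dist (zeros (fourier u)) \<notin> circle_L1"
  shows "ell_cyclic p u"
proof -
  note p = assms(1,2) and u = assms(3)
  define f where "f = fourier u"
  define Z where "Z = zeros f"
  define q where "q = 1 / p - 1 / 2"
  have q: "0 < q" "q < 1 / 2" using p by (auto simp: q_def field_simps)
  obtain \<delta>' where \<delta>': "q < \<delta>'" "f \<in> Lip \<delta>'" using assms(4) unfolding q_def f_def by blast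
  \<comment> \<open>Lowering the exponent below 1/2, while staying above \<open>q\<close>, keeps the
    kernel exponent 2 s - 2 below -1, the range of \<open>integral_power_distance\<close>.\<close>
  define \<delta> where "\<delta> = min \<delta>' ((q + 1 / 2) / 2)"
  have \<delta>: "q < \<delta>" "2 * \<delta> < 1" "\<delta> \<le> 1" "0 < \<delta>" using \<delta>' q by (auto simp: \<delta>_def min_def)
  have fLip: "f \<in> Lip \<delta>" by (rule Lip_weaken[OF \<delta>'(2)]) (simp add: \<delta>_def)
  have fc: "continuous_on circle f" by (rule Lip_continuous[OF fLip \<delta>(4)])
  have comp: "compact Z" unfolding Z_def by (rule compact_zeros[OF fc])
  have ne: "Z \<noteq> {}" using assms(6) log_dist_empty_circle_L1 by (metis Z_def f_def)
  have Zc: "Z \<subseteq> circle" by (auto simp: Z_def zeros_def)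
  interpret circle_gauge "\<lambda>z. infdist z Z" by (rule circle_gauge_infdist[OF Zc ne])
  obtain L where L: "L > 0" and fL: "\<And>x y. x \<in> circle \<Longrightarrow> y \<in> circle \<Longrightarrow> norm (f x - f y) \<le> L * norm (x - y) powr \<delta>"
    using fLip by (auto simp: Lip_def)
  have fd: "norm (f z) \<le> L * infdist z Z powr \<delta>" if "norm z = 1" for z
  proof -
    obtain a where a: "a \<in> Z" "infdist z Z = dist z a"
      using infdist_attains_inf[OF compact_imp_closed[OF comp] ne] by blast
    have "f a = 0" "a \<in> circle" using a(1) by (auto simp: Z_def zeros_def)
    then show ?thesis using fL[of z a] that by (simp add: a(2) dist_norm)
  qed
  have fL': "norm (f z - f w) \<le> L * norm (z - w) powr \<delta>" if "norm z = 1" "norm w = 1" for z w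
    using fL that by simp
  have unb: "\<exists>J. M \<le> mass J" for M
    by (rule log_dist_not_L1_imp_mass_unbounded[OF Zc ne]) (use assms(6) in \<open>simp add: Z_def f_def\<close>)
  have fper: "cper (\<lambda>x. f (cis x))" by (rule cper_compose_cis[OF fc])
  have cu: "coef (\<lambda>x. f (cis x)) = u" using coef_fourier[OF u] fper by (simp add: f_def)
  have bk: "bishift (- 1) u \<in> p_closure p (forward_span u)"
  proof (rule backward_shift_in_closure)
    fix e :: real assume e: "e > 0"
    define e' where "e' = e / (2 * 2 powr p)"
    have e': "e' > 0" "2 powr p * (e' + e') = e" using e by (auto simp: e'_def)
    have "\<exists>\<epsilon> J. p_small p e' (coef (\<lambda>x. f (cis x) * hfun \<epsilon> J (cis x)))"
      by (rule hfun_small[OF p _ \<delta>(2) L fd fL' fc unb e'(1)]) (use \<delta>(1) in \<open>auto simp: q_def\<close>)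
    then obtain \<epsilon> J where small: "p_small p e' (coef (\<lambda>x. f (cis x) * hfun \<epsilon> J (cis x)))"
      by (elim exE)
    have R: "1 + 1 / 2 ^ J > (1 :: real)" by simp
    obtain a K where a: "a 0 = hfun \<epsilon> J 0"
      and sm: "p_small p (2 powr p * (e' + e')) (coef (\<lambda>x. f (cis x) * (\<Sum>k\<le>K::nat. a k * cis x ^ k)))"
      using polynomial_truncation[OF hfun_holomorphic R p \<delta>(1)[unfolded q_def] \<delta>(3) fLip e'(1) small] by blast
    have "coef (\<lambda>x. f (cis x) * (\<Sum>k\<le>K. a k * cis x ^ k)) = (\<lambda>n. \<Sum>k\<le>K. a k * u (n - int k))"
      by (rule ext, rule coef_mult_polynomial[OF fper cu])
    then show "\<exists>h K. h 0 = 1 \<and> p_small p e (\<lambda>n. \<Sum>k\<le>K. h k * u (n - int k))"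
      using sm a e'(2) by (intro exI[of _ a] exI[of _ K]) (simp add: hfun_0)
  qed
  have inv: "bishift i v \<in> p_closure p (forward_span u)" if "v \<in> p_closure p (forward_span u)" for i v
    by (rule bishift_invariant[OF _ bk that]) (use p in simp)
  have "shift 0 u \<in> forward_span u" by (rule seq.span_base) (rule rangeI)
  then have "u \<in> forward_span u" by (simp add: shift_eq_bishift)
  then have "u \<in> p_closure p (forward_span u)" by (rule subsetD[OF p_closure_superset])
  then have "bishift i u \<in> p_closure p (forward_span u)" for i by (rule inv)
  then have "delta \<in> p_closure p (forward_span u)"
    by (intro delta_in_closure[OF p u \<delta>(1)[unfolded q_def] \<delta>(3)])
       (use fLip ne comp assms(5) in \<open>auto simp: f_def Z_def\<close>)
  then have "bishift i delta \<in> p_closure p (forward_span u)" for i by (rule inv)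
  then show ?thesis by (intro ell_cyclicI p(1) ell_one_imp_ell[OF u p(1)])
qed

end
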